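(* Let $\mathcal{C}$ be a $\mathbf{DCPO}$-enriched join inverse rig category (with the structure described in the context) in which the objects $0$ and $1$ are distinct, and let $[\![-]\!]$ be the interpretation of the language in $\mathcal{C}$. For every closed well-typed term $\vdash t:A$, $t$ is terminating (there is a value $v$ with $t\to^* v$) if and only if $[\![\vdash t:A]\!]\neq 0_{[\![A]\!]}$, where $0_{[\![A]\!]}=0_{1,[\![A]\!]}$ is the zero morphism.
   Context: The language. Base types $A,B ::= \mathbb{1} \mid A\oplus B\mid A\otimes B\mid \mu X.A\mid X$ (only closed types are used for terms); iso types $T::=A\leftrightarrow B\mid T_1\to T_2$. Values $v::=()\mid x\mid \mathtt{inl}\,v\mid\mathtt{inr}\,v\mid\langle v_1,v_2\rangle\mid \mathtt{fold}\,v$; patterns $p::=x\mid\langle p_1,p_2\rangle$; expressions $e::=v\mid \mathtt{let}\,p_1=\omega\,p_2\,\mathtt{in}\,e$; isos $\omega::=\{v_1\leftrightarrow e_1\mid\dots\mid v_n\leftrightarrow e_n\}\mid \mathtt{fix}\,\phi.\omega\mid\lambda\phi.\omega\mid\phi\mid\omega_1\omega_2$; terms $t::=()\mid x\mid\mathtt{inl}\,t\mid\mathtt{inr}\,t\mid\langle t_1,t_2\rangle\mid\mathtt{fold}\,t\mid\omega\,t\mid\mathtt{let}\,p=t_1\,\mathtt{in}\,t_2$. Typing judgements $\Psi;\Delta\vdash t:A$ ($\Delta$ linear context of term variables; $\Psi$ non-linear context of iso variables) and $\Psi\vdash_\omega\omega:T$, with the expected rules: $\mathtt{fold}\,t:\mu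 X.A$ when $t:A[\mu X.A/X]$; $\omega\,t:B$ when $\omega:A\leftrightarrow B$, $t:A$; $\mathtt{let}\,(x_1,\dots,x_n)=t_1\,\mathtt{in}\,t_2:B$ when $\Delta_1\vdash t_1:A_1\otimes\dots\otimes A_n$ and $\Delta_2,x_1:A_1,\dots,x_n:A_n\vdash t_2:B$; $\mathtt{fix}\,\phi.\omega:T$ when $\Psi,\phi:T\vdash_\omega\omega:T$; $\lambda\phi.\omega:T_1\to T_2$ when $\Psi,\phi:T_1\vdash_\omega\omega:T_2$; application as usual; $\{v_i\leftrightarrow e_i\}_i:A\leftrightarrow B$ when $\Psi;\Delta_i\vdash v_i:A$, $\Psi;\Delta_i\vdash e_i:B$, and $v_i\perp v_j$, $e_i\perp e_j$ for $i\neq j$, where orthogonality $\perp$ is the smallest relation with $\mathtt{inl}\,t_1\perp\mathtt{inr}\,t_2$, $\mathtt{inr}\,t_1\perp\mathtt{inl}\,t_2$, and $C[t_1]\perp C[t_2]$ when $t_1\perp t_2$ for $C::=[-]\mid\mathtt{inl}\,C\mid\mathtt{inr}\,C\mid\langle C,t\rangle\mid\langle t,C\rangle\mid\mathtt{fold}\,C\mid\mathtt{let}\,p=t\,\mathtt{in}\,C$. Reduction $\to$: $\mathtt{fix}\,\phi.\omega\to\omega[\mathtt{fix}\,\phi.\omega/\phi]$; $(\lambda\phi.\omega_1)\omega_2\to\omega_1[\omega_2/\phi]$; reduction of the head iso in $\omega_1\omega_2$ and in $\omega\,t$; $\{v_i\leftrightarrow e_i\}_i\,v'\to\sigma(e_i)$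 if $\sigma(v_i)=v'$; $\mathtt{let}\,p=v\,\mathtt{in}\,t\to\sigma(t)$ if $\sigma(p)=v$; closure under evaluation contexts $[\,]\mid\mathtt{inl}\,C\mid\mathtt{inr}\,C\mid\{\dots\}\,C\mid\mathtt{let}\,p=C\,\mathtt{in}\,t\mid\langle C,v\rangle\mid\langle v,C\rangle\mid C\,t\mid\mathtt{fold}\,C$; $\to^*$ reflexive transitive closure. Categorical setting: an inverse category is one where every morphism $f$ has a unique $f^\circ$ with $f^\circ f=\overline{f}$ and $ff^\circ=\overline{f^\circ}$ ($\overline{f}$ the restriction, a partial identity). A join inverse rig category has joins $\bigvee$ of restriction-compatible families (with zero morphisms $0_{X,Y}$ the empty join), a join-preserving symmetric monoidal tensor $(\otimes,1)$, a disjointness tensor $(\oplus,0)$ with total injections $\iota_l,\iota_r$, and distributivity isomorphisms. Hom-sets are dcpos (with $f\le g$ iff $g\overline{f}=f$) with continuous composition; $\mathcal{C}$ is assumed to have an ep-zero and colimits of $\omega$-chains of embeddings, so each $\mathbf{DCPO}$-functor has a parametrised initial algebra. Interpretation: $[\![\mathbb{1}]\!]=1$, $[\![A\oplus B]\!]=[\![A]\!]\oplus[\![B]\!]$, $[\![A\otimes B]\!]=[\![A]\!]\otimes[\![B]\!]$, $[\![\mu X.A]\!]$ the (parametrised) initial algebra of the functor interpreting $X\vDash A$, with isomorphism $\alpha:[\![A[\mu X.A/X]]\!]\to[\![\mu X.A]\!]$; $[\![A\leftrightarrow B]\!]=\mathcal{C}([\![A]\!],[\![B]\!])$, $[\![T_1\to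 T_2]\!]$ the dcpo of Scott continuous maps; $[\![\Delta]\!]$ the tensor of its types, $[\![\Psi]\!]$ the product of dcpos. A term $\Psi;\Delta\vdash t:A$ is interpreted as a Scott continuous $[\![\Psi]\!]\to\mathcal{C}([\![\Delta]\!],[\![A]\!])$: for $g\in[\![\Psi]\!]$, $()\mapsto\mathrm{id}_1$, $x\mapsto\mathrm{id}$, $\mathtt{inl}\,t\mapsto\iota_l\circ[\![t]\!](g)$, $\mathtt{inr}\,t\mapsto\iota_r\circ[\![t]\!](g)$, $\langle t_1,t_2\rangle\mapsto[\![t_1]\!](g)\otimes[\![t_2]\!](g)$, $\mathtt{fold}\,t\mapsto\alpha\circ[\![t]\!](g)$, $\omega\,t\mapsto[\![\omega]\!](g)\circ[\![t]\!](g)$, $\mathtt{let}\,p=t_1\,\mathtt{in}\,t_2\mapsto[\![t_2]\!](g)\circ(\mathrm{id}\otimes[\![t_1]\!](g))$. An iso $\Psi\vdash_\omega\omega:T$ is interpreted as a Scott continuous $[\![\Psi]\!]\to[\![T]\!]$: variables by projection, application by evaluation, $\lambda$ by currying, $\mathtt{fix}\,\phi.\omega$ by the least fixed point of $[\![\omega]\!]$ in $\phi$, and $\{v_i\leftrightarrow e_i\}_{i}$ by $g\mapsto\bigvee_i [\![e_i]\!](g)\circ[\![v_i]\!](g)^\circ$. A closed term $\vdash t:A$ is thus a morphism $1\to[\![A]\!]$.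
   Formalization: Pairs are evaluated left to right (contexts ⟨C,t⟩ and ⟨v,C⟩), since with ⟨C,v⟩, ⟨v,C⟩ a pair of two non-values is stuck though its denotation is nonzero; "0 and 1 distinct" is read as non-isomorphic, since if 0 ≅ 1 every denotation is 0. *)

theory Defs
  imports "HOL-Library.FuncSet"
begin

section \<open>The language\<close>

subsection \<open>Types\<close>

text \<open>Type variables are de Bruijn indices; \<open>Mu\<close> binds index 0.\<close>

datatype ty = One | Sum ty ty | Prod ty ty | Mu ty | TVar nat

primrec closed_above :: "nat \<Rightarrow> ty \<Rightarrow> bool" where
  "closed_above k One = True"
| "closed_above k (Sum A B) = (closed_above k A \<and> closed_above k B)"
| "closed_above k (Prod A B) = (closed_above k A \<and> closed_above k B)"
| "closed_above k (Mu A) = closed_above (Suc k) A"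
| "closed_above k (TVar n) = (n < k)"

abbreviation closed_ty :: "ty \<Rightarrow> bool" where
  "closed_ty \<equiv> closed_above 0"

primrec ty_lift :: "ty \<Rightarrow> nat \<Rightarrow> ty" where
  "ty_lift One k = One"
| "ty_lift (Sum A B) k = Sum (ty_lift A k) (ty_lift B k)"
| "ty_lift (Prod A B) k = Prod (ty_lift A k) (ty_lift B k)"
| "ty_lift (Mu A) k = Mu (ty_lift A (Suc k))"
| "ty_lift (TVar n) k = TVar (if n < k then n else Suc n)"

text \<open>\<open>ty_subst A k B\<close> is \<open>A\<close> with \<open>B\<close> substituted for index \<open>k\<close>, which is thereby eliminated.\<close>

primrec ty_subst :: "ty \<Rightarrow> nat \<Rightarrow> ty \<Rightarrow> ty" where
  "ty_subst One k B = One"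
| "ty_subst (Sum A A') k B = Sum (ty_subst A k B) (ty_subst A' k B)"
| "ty_subst (Prod A A') k B = Prod (ty_subst A k B) (ty_subst A' k B)"
| "ty_subst (Mu A) k B = Mu (ty_subst A (Suc k) (ty_lift B 0))"
| "ty_subst (TVar n) k B = (if n < k then TVar n else if n = k then B else TVar (n - 1))"

datatype ity = Iso ty ty  (infix "\<leftrightarrow>" 60) | Fun ity ity

primrec closed_ity :: "ity \<Rightarrow> bool" where
  "closed_ity (A \<leftrightarrow> B) = (closed_ty A \<and> closed_ty B)"
| "closed_ity (Fun T1 T2) = (closed_ity T1 \<and> closed_ity T2)"

subsection \<open>Terms and isos\<close>

type_synonym var = nat
type_synonym ivar = nat

datatype pat = PVar var | PPair pat pat

datatype trm =
    Unit
  | Var var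
  | Inl trm
  | Inr trm
  | Pair trm trm
  | Fold trm
  | App iso trm
  | Let pat trm trm
and iso =
    Clauses "(trm \<times> trm) list"
  | Fix ivar iso
  | Lam ivar iso
  | IVar ivar
  | IApp iso iso

primrec pat_trm :: "pat \<Rightarrow> trm" where
  "pat_trm (PVar x) = Var x"
| "pat_trm (PPair p q) = Pair (pat_trm p) (pat_trm q)"

fun is_val :: "trm \<Rightarrow> bool" where
  "is_val Unit = True"
| "is_val (Var x) = True"
| "is_val (Inl t) = is_val t"
| "is_val (Inr t) = is_val t"
| "is_val (Pair t u) = (is_val t \<and> is_val u)"
| "is_val (Fold t) = is_val t"
| "is_val (App w t) = False"
| "is_val (Let p t u) = False"

inductive is_expr :: "trm \<Rightarrow> bool" where
  "is_val v \<Longrightarrow> is_expr v"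
| "is_expr e \<Longrightarrow> is_expr (Let p (App w (pat_trm q)) e)"

inductive orth :: "trm \<Rightarrow> trm \<Rightarrow> bool"  (infix "\<bottom>" 50) where
  orth_lr: "Inl t1 \<bottom> Inr t2"
| orth_rl: "Inr t1 \<bottom> Inl t2"
| orth_Inl: "t1 \<bottom> t2 \<Longrightarrow> Inl t1 \<bottom> Inl t2"
| orth_Inr: "t1 \<bottom> t2 \<Longrightarrow> Inr t1 \<bottom> Inr t2"
| orth_PairL: "t1 \<bottom> t2 \<Longrightarrow> Pair t1 t \<bottom> Pair t2 t"
| orth_PairR: "t1 \<bottom> t2 \<Longrightarrow> Pair t t1 \<bottom> Pair t t2"
| orth_Fold: "t1 \<bottom> t2 \<Longrightarrow> Fold t1 \<bottom> Fold t2"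
| orth_Let: "t1 \<bottom> t2 \<Longrightarrow> Let p t t1 \<bottom> Let p t t2"

subsection \<open>Typing\<close>

text \<open>
  A linear context is a list with an explicit exchange rule; every rule keeps its names distinct.
  Patterns are values, and a pattern of type \<open>A\<close> binding \<open>\<Gamma>\<close> is one with \<open>\<Gamma> \<turnstile> p : A\<close>.
  In a clause set, the \<open>i\<close>-th clause has its own context \<open>\<Delta> i\<close>.
\<close>

type_synonym ctx = "(var \<times> ty) list"
type_synonym ictx = "ivar \<rightharpoonup> ity"

inductive has_type :: "ictx \<Rightarrow> ctx \<Rightarrow> trm \<Rightarrow> ty \<Rightarrow> bool"
  and has_itype :: "ictx \<Rightarrow> iso \<Rightarrow> ity \<Rightarrow> bool"
where
  ty_Unit: "has_type \<Psi> [] Unit One"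
| ty_Var: "closed_ty A \<Longrightarrow> has_type \<Psi> [(x, A)] (Var x) A"
| ty_Inl: "has_type \<Psi> \<Delta> t A \<Longrightarrow> closed_ty B \<Longrightarrow> has_type \<Psi> \<Delta> (Inl t) (Sum A B)"
| ty_Inr: "has_type \<Psi> \<Delta> t B \<Longrightarrow> closed_ty A \<Longrightarrow> has_type \<Psi> \<Delta> (Inr t) (Sum A B)"
| ty_Pair: "has_type \<Psi> \<Delta>1 t1 A \<Longrightarrow> has_type \<Psi> \<Delta>2 t2 B \<Longrightarrow> distinct (map fst (\<Delta>1 @ \<Delta>2))
    \<Longrightarrow> has_type \<Psi> (\<Delta>1 @ \<Delta>2) (Pair t1 t2) (Prod A B)"
| ty_Fold: "has_type \<Psi> \<Delta> t (ty_subst A 0 (Mu A)) \<Longrightarrow> has_type \<Psi> \<Delta> (Fold t) (Mu A)"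
| ty_App: "has_itype \<Psi> w (A \<leftrightarrow> B) \<Longrightarrow> has_type \<Psi> \<Delta> t A \<Longrightarrow> has_type \<Psi> \<Delta> (App w t) B"
| ty_Let: "has_type \<Psi> \<Delta>1 t1 A \<Longrightarrow> has_type \<Psi> \<Gamma> (pat_trm p) A \<Longrightarrow> has_type \<Psi> (\<Delta>2 @ \<Gamma>) t2 B
    \<Longrightarrow> distinct (map fst (\<Delta>1 @ \<Delta>2)) \<Longrightarrow> has_type \<Psi> (\<Delta>1 @ \<Delta>2) (Let p t1 t2) B"
| ty_Exch: "has_type \<Psi> (\<Delta>1 @ (x, A) # (y, B) # \<Delta>2) t D
    \<Longrightarrow> has_type \<Psi> (\<Delta>1 @ (y, B) # (x, A) # \<Delta>2) t D"
| ty_Clauses: "closed_ty A \<Longrightarrow> closed_ty B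
    \<Longrightarrow> (\<And>i. i < length cs \<Longrightarrow> is_val (fst (cs ! i)))
    \<Longrightarrow> (\<And>i. i < length cs \<Longrightarrow> is_expr (snd (cs ! i)))
    \<Longrightarrow> (\<And>i. i < length cs \<Longrightarrow> has_type \<Psi> (\<Delta> i) (fst (cs ! i)) A)
    \<Longrightarrow> (\<And>i. i < length cs \<Longrightarrow> has_type \<Psi> (\<Delta> i) (snd (cs ! i)) B)
    \<Longrightarrow> (\<And>i j. i < length cs \<Longrightarrow> j < length cs \<Longrightarrow> i \<noteq> j \<Longrightarrow> fst (cs ! i) \<bottom> fst (cs ! j))
    \<Longrightarrow> (\<And>i j. i < length cs \<Longrightarrow> j < length cs \<Longrightarrow> i \<noteq> j \<Longrightarrow> snd (cs ! i) \<bottom> snd (cs ! j))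
    \<Longrightarrow> has_itype \<Psi> (Clauses cs) (A \<leftrightarrow> B)"
| ty_Fix: "has_itype (\<Psi>(\<phi> \<mapsto> T)) w T \<Longrightarrow> has_itype \<Psi> (Fix \<phi> w) T"
| ty_Lam: "closed_ity T1 \<Longrightarrow> has_itype (\<Psi>(\<phi> \<mapsto> T1)) w T2 \<Longrightarrow> has_itype \<Psi> (Lam \<phi> w) (Fun T1 T2)"
| ty_IVar: "\<Psi> \<phi> = Some T \<Longrightarrow> closed_ity T \<Longrightarrow> has_itype \<Psi> (IVar \<phi>) T"
| ty_IApp: "has_itype \<Psi> w1 (Fun T1 T2) \<Longrightarrow> has_itype \<Psi> w2 T1 \<Longrightarrow> has_itype \<Psi> (IApp w1 w2) T2"

subsection \<open>Reduction\<close>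

text \<open>
  Evaluation never goes under a binder, so on closed terms only closed values and closed isos are
  substituted and the substitutions below cannot capture variables. Typable isos have no free
  term variables, so term substitution does not descend into isos.
\<close>

primrec pat_vars :: "pat \<Rightarrow> var set" where
  "pat_vars (PVar x) = {x}"
| "pat_vars (PPair p q) = pat_vars p \<union> pat_vars q"

fun subst :: "(var \<rightharpoonup> trm) \<Rightarrow> trm \<Rightarrow> trm" where
  "subst \<sigma> Unit = Unit"
| "subst \<sigma> (Var x) = (case \<sigma> x of None \<Rightarrow> Var x | Some v \<Rightarrow> v)"
| "subst \<sigma> (Inl t) = Inl (subst \<sigma> t)"
| "subst \<sigma> (Inr t) = Inr (subst \<sigma> t)"
| "subst \<sigma> (Pair t u) = Pair (subst \<sigma> t) (subst \<sigma> u)"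
| "subst \<sigma> (Fold t) = Fold (subst \<sigma> t)"
| "subst \<sigma> (App w t) = App w (subst \<sigma> t)"
| "subst \<sigma> (Let p t u) = Let p (subst \<sigma> t) (subst (\<sigma> |` (- pat_vars p)) u)"

primrec isubst_trm :: "ivar \<Rightarrow> iso \<Rightarrow> trm \<Rightarrow> trm"
  and isubst :: "ivar \<Rightarrow> iso \<Rightarrow> iso \<Rightarrow> iso"
where
  "isubst_trm \<phi> w0 Unit = Unit"
| "isubst_trm \<phi> w0 (Var x) = Var x"
| "isubst_trm \<phi> w0 (Inl t) = Inl (isubst_trm \<phi> w0 t)"
| "isubst_trm \<phi> w0 (Inr t) = Inr (isubst_trm \<phi> w0 t)"
| "isubst_trm \<phi> w0 (Pair t u) = Pair (isubst_trm \<phi> w0 t) (isubst_trm \<phi> w0 u)"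
| "isubst_trm \<phi> w0 (Fold t) = Fold (isubst_trm \<phi> w0 t)"
| "isubst_trm \<phi> w0 (App w t) = App (isubst \<phi> w0 w) (isubst_trm \<phi> w0 t)"
| "isubst_trm \<phi> w0 (Let p t u) = Let p (isubst_trm \<phi> w0 t) (isubst_trm \<phi> w0 u)"
| "isubst \<phi> w0 (Clauses cs) = Clauses (map (map_prod (isubst_trm \<phi> w0) (isubst_trm \<phi> w0)) cs)"
| "isubst \<phi> w0 (Fix \<psi> w) = Fix \<psi> (if \<psi> = \<phi> then w else isubst \<phi> w0 w)"
| "isubst \<phi> w0 (Lam \<psi> w) = Lam \<psi> (if \<psi> = \<phi> then w else isubst \<phi> w0 w)"
| "isubst \<phi> w0 (IVar \<psi>) = (if \<psi> = \<phi> then w0 else IVar \<psi>)"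
| "isubst \<phi> w0 (IApp w1 w2) = IApp (isubst \<phi> w0 w1) (isubst \<phi> w0 w2)"

text \<open>The variables of a value; only applied to values.\<close>

fun val_vars :: "trm \<Rightarrow> var set" where
  "val_vars (Var x) = {x}"
| "val_vars (Inl t) = val_vars t"
| "val_vars (Inr t) = val_vars t"
| "val_vars (Pair t u) = val_vars t \<union> val_vars u"
| "val_vars (Fold t) = val_vars t"
| "val_vars _ = {}"

definition matches :: "(var \<rightharpoonup> trm) \<Rightarrow> trm \<Rightarrow> trm \<Rightarrow> bool" where
  "matches \<sigma> v v' \<longleftrightarrow> dom \<sigma> = val_vars v \<and> subst \<sigma> v = v'"

inductive ired :: "iso \<Rightarrow> iso \<Rightarrow> bool" where
  ired_Fix: "ired (Fix \<phi> w) (isubst \<phi> (Fix \<phi> w) w)"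
| ired_beta: "ired (IApp (Lam \<phi> w1) w2) (isubst \<phi> w2 w1)"
| ired_IApp: "ired w1 w1' \<Longrightarrow> ired (IApp w1 w2) (IApp w1' w2)"

text \<open>
  Pairs are evaluated from left to right: the left component may be reduced next to an arbitrary
  right component.
\<close>

inductive red :: "trm \<Rightarrow> trm \<Rightarrow> bool" where
  red_clause: "i < length cs \<Longrightarrow> is_val v' \<Longrightarrow> matches \<sigma> (fst (cs ! i)) v'
    \<Longrightarrow> red (App (Clauses cs) v') (subst \<sigma> (snd (cs ! i)))"
| red_let: "is_val v \<Longrightarrow> matches \<sigma> (pat_trm p) v \<Longrightarrow> red (Let p v t) (subst \<sigma> t)"
| red_iso: "ired w w' \<Longrightarrow> red (App w t) (App w' t)"
| red_Inl: "red t t' \<Longrightarrow> red (Inl t) (Inl t')"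
| red_Inr: "red t t' \<Longrightarrow> red (Inr t) (Inr t')"
| red_arg: "red t t' \<Longrightarrow> red (App (Clauses cs) t) (App (Clauses cs) t')"
| red_let1: "red t t' \<Longrightarrow> red (Let p t u) (Let p t' u)"
| red_PairL: "red t t' \<Longrightarrow> red (Pair t u) (Pair t' u)"
| red_PairR: "is_val v \<Longrightarrow> red t t' \<Longrightarrow> red (Pair v t) (Pair v t')"
| red_Fold: "red t t' \<Longrightarrow> red (Fold t) (Fold t')"

definition terminating :: "trm \<Rightarrow> bool" where
  "terminating t \<longleftrightarrow> (\<exists>v. is_val v \<and> red\<^sup>*\<^sup>* t v)"

section \<open>Posets and Scott continuity\<close>

definition is_lub :: "'a set \<Rightarrow> ('a \<Rightarrow> 'a \<Rightarrow> bool) \<Rightarrow> 'a set \<Rightarrow> 'a \<Rightarrow> bool" where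
  "is_lub D le S x \<longleftrightarrow> x \<in> D \<and> (\<forall>s\<in>S. le s x) \<and> (\<forall>y\<in>D. (\<forall>s\<in>S. le s y) \<longrightarrow> le x y)"

definition is_directed :: "('a \<Rightarrow> 'a \<Rightarrow> bool) \<Rightarrow> 'a set \<Rightarrow> bool" where
  "is_directed le S \<longleftrightarrow> S \<noteq> {} \<and> (\<forall>x\<in>S. \<forall>y\<in>S. \<exists>z\<in>S. le x z \<and> le y z)"

type_synonym 'a poset = "'a set \<times> ('a \<Rightarrow> 'a \<Rightarrow> bool)"

text \<open>Scott continuous maps, made extensional outside the domain.\<close>

definition scott_maps :: "'a poset \<Rightarrow> 'b poset \<Rightarrow> ('a \<Rightarrow> 'b) set" where
  "scott_maps P Q = {f \<in> fst P \<rightarrow>\<^sub>E fst Q.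
     \<forall>S x. S \<subseteq> fst P \<and> is_directed (snd P) S \<and> is_lub (fst P) (snd P) S x \<longrightarrow>
       is_lub (fst Q) (snd Q) (f ` S) (f x)}"

definition least_fixpoint :: "'a poset \<Rightarrow> ('a \<Rightarrow> 'a) \<Rightarrow> 'a" where
  "least_fixpoint P f =
     (THE x. x \<in> fst P \<and> f x = x \<and> (\<forall>y\<in>fst P. f y = y \<longrightarrow> snd P x y))"

section \<open>Join inverse rig categories\<close>

text \<open>
  The objects are all elements of \<open>'o\<close>, the morphisms all elements of \<open>'m\<close>; \<open>g \<cdot> f\<close> is the
  composite of \<open>g\<close> after \<open>f\<close> and is meaningful only if \<open>tgt f = src g\<close>.
\<close>

record ('o, 'm) tensor =
  tob :: "'o \<Rightarrow> 'o \<Rightarrow> 'o"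
  tar :: "'m \<Rightarrow> 'm \<Rightarrow> 'm"
  tunit :: "'o"
  assc :: "'o \<Rightarrow> 'o \<Rightarrow> 'o \<Rightarrow> 'm"  \<comment> \<open>\<open>(A \<otimes> B) \<otimes> D \<rightarrow> A \<otimes> (B \<otimes> D)\<close>\<close>
  lunit :: "'o \<Rightarrow> 'm"  \<comment> \<open>\<open>I \<otimes> A \<rightarrow> A\<close>\<close>
  runit :: "'o \<Rightarrow> 'm"  \<comment> \<open>\<open>A \<otimes> I \<rightarrow> A\<close>\<close>
  symm :: "'o \<Rightarrow> 'o \<Rightarrow> 'm"  \<comment> \<open>\<open>A \<otimes> B \<rightarrow> B \<otimes> A\<close>\<close>

record ('o, 'm) rig_cat =
  src :: "'m \<Rightarrow> 'o"
  tgt :: "'m \<Rightarrow> 'o"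
  idm :: "'o \<Rightarrow> 'm"
  comp :: "'m \<Rightarrow> 'm \<Rightarrow> 'm"  (infixr "\<cdot>\<index>" 55)
  restr :: "'m \<Rightarrow> 'm"
  mult :: "('o, 'm) tensor"
  add :: "('o, 'm) tensor"
  distr :: "'o \<Rightarrow> 'o \<Rightarrow> 'o \<Rightarrow> 'm"
  annih :: "'o \<Rightarrow> 'm"

abbreviation tensor_ob :: "'o \<Rightarrow> ('o, 'm) rig_cat \<Rightarrow> 'o \<Rightarrow> 'o"  ("_ \<otimes>\<^sub>o[_] _" [66, 0, 65] 65) where
  "A \<otimes>\<^sub>o[C] B \<equiv> tob (mult C) A B"

abbreviation tensor_ar :: "'m \<Rightarrow> ('o, 'm) rig_cat \<Rightarrow> 'm \<Rightarrow> 'm"  ("_ \<otimes>\<^sub>m[_] _" [66, 0, 65] 65) where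
  "f \<otimes>\<^sub>m[C] g \<equiv> tar (mult C) f g"

abbreviation one_ob :: "('o, 'm) rig_cat \<Rightarrow> 'o" where
  "one_ob C \<equiv> tunit (mult C)"

abbreviation zero_ob :: "('o, 'm) rig_cat \<Rightarrow> 'o" where
  "zero_ob C \<equiv> tunit (add C)"

definition hom :: "('o, 'm) rig_cat \<Rightarrow> 'o \<Rightarrow> 'o \<Rightarrow> 'm set" where
  "hom C A B = {f. src C f = A \<and> tgt C f = B}"

definition is_iso :: "('o, 'm) rig_cat \<Rightarrow> 'm \<Rightarrow> bool" where
  "is_iso C f \<longleftrightarrow> (\<exists>g \<in> hom C (tgt C f) (src C f).
     g \<cdot>\<^bsub>C\<^esub> f = idm C (src C f) \<and> f \<cdot>\<^bsub>C\<^esub> g = idm C (tgt C f))"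

definition isomorphic :: "('o, 'm) rig_cat \<Rightarrow> 'o \<Rightarrow> 'o \<Rightarrow> bool" where
  "isomorphic C A B \<longleftrightarrow> (\<exists>f \<in> hom C A B. is_iso C f)"

definition le :: "('o, 'm) rig_cat \<Rightarrow> 'm \<Rightarrow> 'm \<Rightarrow> bool" where
  "le C f g \<longleftrightarrow> g \<cdot>\<^bsub>C\<^esub> restr C f = f"

definition pinv :: "('o, 'm) rig_cat \<Rightarrow> 'm \<Rightarrow> 'm" where
  "pinv C f = (THE g. g \<in> hom C (tgt C f) (src C f)
     \<and> g \<cdot>\<^bsub>C\<^esub> f = restr C f \<and> f \<cdot>\<^bsub>C\<^esub> g = restr C g)"

text \<open>
  In an inverse category a family that has an upper bound is restriction compatible and so are the
  partial inverses of its members, so both are required of the families that have a join.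
\<close>

definition compatible :: "('o, 'm) rig_cat \<Rightarrow> 'm set \<Rightarrow> bool" where
  "compatible C S \<longleftrightarrow> (\<forall>f\<in>S. \<forall>g\<in>S. f \<cdot>\<^bsub>C\<^esub> restr C g = g \<cdot>\<^bsub>C\<^esub> restr C f
     \<and> pinv C f \<cdot>\<^bsub>C\<^esub> restr C (pinv C g) = pinv C g \<cdot>\<^bsub>C\<^esub> restr C (pinv C f))"

definition Join :: "('o, 'm) rig_cat \<Rightarrow> 'o \<Rightarrow> 'o \<Rightarrow> 'm set \<Rightarrow> 'm" where
  "Join C A B S = (THE f. is_lub (hom C A B) (le C) S f)"

definition zero :: "('o, 'm) rig_cat \<Rightarrow> 'o \<Rightarrow> 'o \<Rightarrow> 'm" where
  "zero C A B = Join C A B {}"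

definition embedding :: "('o, 'm) rig_cat \<Rightarrow> 'm \<Rightarrow> bool" where
  "embedding C e \<longleftrightarrow> (\<exists>p \<in> hom C (tgt C e) (src C e).
     p \<cdot>\<^bsub>C\<^esub> e = idm C (src C e) \<and> le C (e \<cdot>\<^bsub>C\<^esub> p) (idm C (tgt C e)))"

definition projection :: "('o, 'm) rig_cat \<Rightarrow> 'm \<Rightarrow> bool" where
  "projection C p \<longleftrightarrow> (\<exists>e \<in> hom C (tgt C p) (src C p).
     p \<cdot>\<^bsub>C\<^esub> e = idm C (tgt C p) \<and> le C (e \<cdot>\<^bsub>C\<^esub> p) (idm C (src C p)))"

definition ep_zero :: "('o, 'm) rig_cat \<Rightarrow> 'o \<Rightarrow> bool" where
  "ep_zero C Z \<longleftrightarrow> (\<forall>A. (\<exists>!f. f \<in> hom C Z A) \<and> (\<exists>!f. f \<in> hom C A Z)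
     \<and> (\<forall>f \<in> hom C Z A. embedding C f) \<and> (\<forall>f \<in> hom C A Z. projection C f))"

definition omega_cocone ::
    "('o, 'm) rig_cat \<Rightarrow> (nat \<Rightarrow> 'o) \<Rightarrow> (nat \<Rightarrow> 'm) \<Rightarrow> 'o \<Rightarrow> (nat \<Rightarrow> 'm) \<Rightarrow> bool" where
  "omega_cocone C X e L c \<longleftrightarrow> (\<forall>n. c n \<in> hom C (X n) L \<and> c (Suc n) \<cdot>\<^bsub>C\<^esub> e n = c n)"

definition omega_colimit ::
    "('o, 'm) rig_cat \<Rightarrow> (nat \<Rightarrow> 'o) \<Rightarrow> (nat \<Rightarrow> 'm) \<Rightarrow> 'o \<Rightarrow> (nat \<Rightarrow> 'm) \<Rightarrow> bool" where
  "omega_colimit C X e L c \<longleftrightarrow> omega_cocone C X e L c \<and>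
     (\<forall>Y d. omega_cocone C X e Y d \<longrightarrow> (\<exists>!u. u \<in> hom C L Y \<and> (\<forall>n. u \<cdot>\<^bsub>C\<^esub> c n = d n)))"

definition inj_l :: "('o, 'm) rig_cat \<Rightarrow> 'o \<Rightarrow> 'o \<Rightarrow> 'm" where
  "inj_l C A B = tar (add C) (idm C A) (zero C (zero_ob C) B) \<cdot>\<^bsub>C\<^esub> pinv C (runit (add C) A)"

definition inj_r :: "('o, 'm) rig_cat \<Rightarrow> 'o \<Rightarrow> 'o \<Rightarrow> 'm" where
  "inj_r C A B = tar (add C) (zero C (zero_ob C) A) (idm C B) \<cdot>\<^bsub>C\<^esub> pinv C (lunit (add C) B)"

locale category =
  fixes C :: "('o, 'm) rig_cat" (structure)
  assumes idm_hom: "idm C A \<in> hom C A A"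
    and comp_hom: "f \<in> hom C A B \<Longrightarrow> g \<in> hom C B D \<Longrightarrow> g \<cdot> f \<in> hom C A D"
    and idm_right: "f \<in> hom C A B \<Longrightarrow> f \<cdot> idm C A = f"
    and idm_left: "f \<in> hom C A B \<Longrightarrow> idm C B \<cdot> f = f"
    and comp_assoc: "f \<in> hom C A B \<Longrightarrow> g \<in> hom C B D \<Longrightarrow> h \<in> hom C D E \<Longrightarrow> (h \<cdot> g) \<cdot> f = h \<cdot> (g \<cdot> f)"

locale restriction_category = category +
  assumes restr_hom: "f \<in> hom C A B \<Longrightarrow> restr C f \<in> hom C A A"
    and restr1: "f \<in> hom C A B \<Longrightarrow> f \<cdot> restr C f = f"
    and restr2: "f \<in> hom C A B \<Longrightarrow> g \<in> hom C A D \<Longrightarrow> restr C f \<cdot> restr C g = restr C g \<cdot> restr C f"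
    and restr3: "f \<in> hom C A B \<Longrightarrow> g \<in> hom C A D \<Longrightarrow> restr C (f \<cdot> restr C g) = restr C f \<cdot> restr C g"
    and restr4: "f \<in> hom C A B \<Longrightarrow> h \<in> hom C B D \<Longrightarrow> restr C h \<cdot> f = f \<cdot> restr C (h \<cdot> f)"

locale inverse_category = restriction_category +
  assumes pinv_ex1: "f \<in> hom C A B \<Longrightarrow> \<exists>!g. g \<in> hom C B A \<and> g \<cdot> f = restr C f \<and> f \<cdot> g = restr C g"

locale join_inverse_category = inverse_category +
  assumes Join_lub: "S \<subseteq> hom C A B \<Longrightarrow> compatible C S \<Longrightarrow> is_lub (hom C A B) (le C) S (Join C A B S)"
    and Join_restr: "S \<subseteq> hom C A B \<Longrightarrow> compatible C S \<Longrightarrow>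
      restr C (Join C A B S) = Join C A A (restr C ` S)"
    and Join_comp_left: "S \<subseteq> hom C A B \<Longrightarrow> compatible C S \<Longrightarrow> f \<in> hom C B D \<Longrightarrow>
      f \<cdot> Join C A B S = Join C A D ((\<lambda>s. f \<cdot> s) ` S)"
    and Join_comp_right: "S \<subseteq> hom C A B \<Longrightarrow> compatible C S \<Longrightarrow> f \<in> hom C D A \<Longrightarrow>
      Join C A B S \<cdot> f = Join C D B ((\<lambda>s. s \<cdot> f) ` S)"

locale symmetric_monoidal = category C for C :: "('o, 'm) rig_cat" (structure) +
  fixes M :: "('o, 'm) tensor"
  assumes tar_hom: "f \<in> hom C A A' \<Longrightarrow> g \<in> hom C B B' \<Longrightarrow> tar M f g \<in> hom C (tob M A B) (tob M A' B')"
    and tar_idm: "tar M (idm C A) (idm C B) = idm C (tob M A B)"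
    and tar_comp: "f \<in> hom C A A' \<Longrightarrow> f' \<in> hom C A' A'' \<Longrightarrow> g \<in> hom C B B' \<Longrightarrow> g' \<in> hom C B' B'' \<Longrightarrow>
      tar M (f' \<cdot> f) (g' \<cdot> g) = tar M f' g' \<cdot> tar M f g"
    and assc_hom: "assc M A B D \<in> hom C (tob M (tob M A B) D) (tob M A (tob M B D))"
    and assc_iso: "is_iso C (assc M A B D)"
    and assc_nat: "f \<in> hom C A A' \<Longrightarrow> g \<in> hom C B B' \<Longrightarrow> h \<in> hom C D D' \<Longrightarrow>
      assc M A' B' D' \<cdot> tar M (tar M f g) h = tar M f (tar M g h) \<cdot> assc M A B D"
    and lunit_hom: "lunit M A \<in> hom C (tob M (tunit M) A) A"
    and lunit_iso: "is_iso C (lunit M A)"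
    and lunit_nat: "f \<in> hom C A B \<Longrightarrow> lunit M B \<cdot> tar M (idm C (tunit M)) f = f \<cdot> lunit M A"
    and runit_hom: "runit M A \<in> hom C (tob M A (tunit M)) A"
    and runit_iso: "is_iso C (runit M A)"
    and runit_nat: "f \<in> hom C A B \<Longrightarrow> runit M B \<cdot> tar M f (idm C (tunit M)) = f \<cdot> runit M A"
    and symm_hom: "symm M A B \<in> hom C (tob M A B) (tob M B A)"
    and symm_inverse: "symm M B A \<cdot> symm M A B = idm C (tob M A B)"
    and symm_nat: "f \<in> hom C A A' \<Longrightarrow> g \<in> hom C B B' \<Longrightarrow>
      symm M A' B' \<cdot> tar M f g = tar M g f \<cdot> symm M A B"
    and triangle: "tar M (idm C A) (lunit M B) \<cdot> assc M A (tunit M) B = tar M (runit M A) (idm C B)"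
    and pentagon: "assc M A B (tob M D E) \<cdot> assc M (tob M A B) D E =
      tar M (idm C A) (assc M B D E) \<cdot> assc M A (tob M B D) E \<cdot> tar M (assc M A B D) (idm C E)"
    and hexagon: "assc M B D A \<cdot> symm M A (tob M B D) \<cdot> assc M A B D =
      tar M (idm C B) (symm M A D) \<cdot> assc M B A D \<cdot> tar M (symm M A B) (idm C D)"

locale join_inverse_rig_category =
  join_inverse_category C + T: symmetric_monoidal C "mult C" + P: symmetric_monoidal C "add C"
  for C :: "('o, 'm) rig_cat" (structure) +
  assumes mult_Join_left: "S \<subseteq> hom C A A' \<Longrightarrow> compatible C S \<Longrightarrow> g \<in> hom C B B' \<Longrightarrow>
      Join C A A' S \<otimes>\<^sub>m[C] g = Join C (A \<otimes>\<^sub>o[C] B) (A' \<otimes>\<^sub>o[C] B') ((\<lambda>f. f \<otimes>\<^sub>m[C] g) ` S)"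
    and mult_Join_right: "S \<subseteq> hom C A A' \<Longrightarrow> compatible C S \<Longrightarrow> g \<in> hom C B B' \<Longrightarrow>
      g \<otimes>\<^sub>m[C] Join C A A' S = Join C (B \<otimes>\<^sub>o[C] A) (B' \<otimes>\<^sub>o[C] A') ((\<lambda>f. g \<otimes>\<^sub>m[C] f) ` S)"
    and zero_ob_ep_zero: "ep_zero C (zero_ob C)"
    and add_restr: "restr C (tar (add C) f g) = tar (add C) (restr C f) (restr C g)"
    and mult_restr: "restr C (f \<otimes>\<^sub>m[C] g) = restr C f \<otimes>\<^sub>m[C] restr C g"
    and inj_l_total: "restr C (inj_l C A B) = idm C A"
    and inj_r_total: "restr C (inj_r C A B) = idm C B"
    and inj_jointly_epic: "f \<in> hom C (tob (add C) A B) D \<Longrightarrow> g \<in> hom C (tob (add C) A B) D \<Longrightarrow>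
      f \<cdot> inj_l C A B = g \<cdot> inj_l C A B \<Longrightarrow> f \<cdot> inj_r C A B = g \<cdot> inj_r C A B \<Longrightarrow> f = g"
    and inj_jointly_monic: "f \<in> hom C D (tob (add C) A B) \<Longrightarrow> g \<in> hom C D (tob (add C) A B) \<Longrightarrow>
      pinv C (inj_l C A B) \<cdot> f = pinv C (inj_l C A B) \<cdot> g \<Longrightarrow>
      pinv C (inj_r C A B) \<cdot> f = pinv C (inj_r C A B) \<cdot> g \<Longrightarrow> f = g"
    and distr_hom: "distr C A B D \<in>
      hom C (A \<otimes>\<^sub>o[C] (tob (add C) B D)) (tob (add C) (A \<otimes>\<^sub>o[C] B) (A \<otimes>\<^sub>o[C] D))"
    and distr_iso: "is_iso C (distr C A B D)"
    and distr_nat: "f \<in> hom C A A' \<Longrightarrow> g \<in> hom C B B' \<Longrightarrow> h \<in> hom C D D' \<Longrightarrow>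
      distr C A' B' D' \<cdot> (f \<otimes>\<^sub>m[C] tar (add C) g h) =
      tar (add C) (f \<otimes>\<^sub>m[C] g) (f \<otimes>\<^sub>m[C] h) \<cdot> distr C A B D"
    and annih_hom: "annih C A \<in> hom C (A \<otimes>\<^sub>o[C] zero_ob C) (zero_ob C)"
    and annih_iso: "is_iso C (annih C A)"
    and annih_nat: "f \<in> hom C A B \<Longrightarrow> annih C B \<cdot> (f \<otimes>\<^sub>m[C] idm C (zero_ob C)) = annih C A"

locale dcpo_join_inverse_rig_category = join_inverse_rig_category +
  assumes hom_dcpo: "S \<subseteq> hom C A B \<Longrightarrow> is_directed (le C) S \<Longrightarrow> \<exists>f. is_lub (hom C A B) (le C) S f"
    and comp_continuous_right: "S \<subseteq> hom C A B \<Longrightarrow> is_directed (le C) S \<Longrightarrow>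
      is_lub (hom C A B) (le C) S f \<Longrightarrow> g \<in> hom C B D \<Longrightarrow> is_lub (hom C A D) (le C) ((\<lambda>s. g \<cdot> s) ` S) (g \<cdot> f)"
    and comp_continuous_left: "S \<subseteq> hom C A B \<Longrightarrow> is_directed (le C) S \<Longrightarrow>
      is_lub (hom C A B) (le C) S f \<Longrightarrow> g \<in> hom C D A \<Longrightarrow> is_lub (hom C D B) (le C) ((\<lambda>s. s \<cdot> g) ` S) (f \<cdot> g)"
    and omega_colimits: "(\<And>n. e n \<in> hom C (X n) (X (Suc n))) \<Longrightarrow> (\<And>n. embedding C (e n)) \<Longrightarrow>
      \<exists>L c. omega_colimit C X e L c"

section \<open>The interpretation\<close>

subsection \<open>Base types\<close>

text \<open>
  An endofunctor is given by its action \<open>Fo\<close> on objects and \<open>Fa\<close> on morphisms; \<open>mu_ob\<close> and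
  \<open>mu_in\<close> choose an initial algebra.
\<close>

definition initial_algebra ::
    "('o, 'm) rig_cat \<Rightarrow> ('o \<Rightarrow> 'o) \<Rightarrow> ('m \<Rightarrow> 'm) \<Rightarrow> 'o \<times> 'm \<Rightarrow> bool" where
  "initial_algebra C Fo Fa = (\<lambda>(M, a). a \<in> hom C (Fo M) M \<and>
     (\<forall>X. \<forall>b \<in> hom C (Fo X) X. \<exists>!h. h \<in> hom C M X \<and> h \<cdot>\<^bsub>C\<^esub> a = b \<cdot>\<^bsub>C\<^esub> Fa h))"

definition mu_ob :: "('o, 'm) rig_cat \<Rightarrow> ('o \<Rightarrow> 'o) \<Rightarrow> ('m \<Rightarrow> 'm) \<Rightarrow> 'o" where
  "mu_ob C Fo Fa = fst (SOME Ma. initial_algebra C Fo Fa Ma)"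

definition mu_in :: "('o, 'm) rig_cat \<Rightarrow> ('o \<Rightarrow> 'o) \<Rightarrow> ('m \<Rightarrow> 'm) \<Rightarrow> 'm" where
  "mu_in C Fo Fa = snd (SOME Ma. initial_algebra C Fo Fa Ma)"

text \<open>
  \<open>ty_ob\<close> and \<open>ty_ar\<close> are the functor interpreting an open type, on environments of objects and
  of morphisms. On \<open>Mu A\<close> they form the parametrised initial algebra of the functor interpreting
  \<open>A\<close>: the action on a morphism \<open>f\<close> of environments is the only one that makes the algebra
  structures natural, namely the mediating morphism \<open>k\<close> with \<open>k \<cdot> \<alpha> = \<alpha>' \<cdot> A(k, f)\<close>.
\<close>

fun ty_ob :: "('o, 'm) rig_cat \<Rightarrow> ty \<Rightarrow> (nat \<Rightarrow> 'o) \<Rightarrow> 'o"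
  and ty_ar :: "('o, 'm) rig_cat \<Rightarrow> ty \<Rightarrow> (nat \<Rightarrow> 'm) \<Rightarrow> 'm"
where
  "ty_ob C One \<rho> = one_ob C"
| "ty_ob C (Sum A B) \<rho> = tob (add C) (ty_ob C A \<rho>) (ty_ob C B \<rho>)"
| "ty_ob C (Prod A B) \<rho> = tob (mult C) (ty_ob C A \<rho>) (ty_ob C B \<rho>)"
| "ty_ob C (Mu A) \<rho> = mu_ob C (\<lambda>Y. ty_ob C A (case_nat Y \<rho>))
     (\<lambda>h. ty_ar C A (case_nat h (\<lambda>n. idm C (\<rho> n))))"
| "ty_ob C (TVar n) \<rho> = \<rho> n"
| "ty_ar C One f = idm C (one_ob C)"
| "ty_ar C (Sum A B) f = tar (add C) (ty_ar C A f) (ty_ar C B f)"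
| "ty_ar C (Prod A B) f = tar (mult C) (ty_ar C A f) (ty_ar C B f)"
| "ty_ar C (Mu A) f =
     (let Fo = \<lambda>\<rho> Y. ty_ob C A (case_nat Y \<rho>);
          Fa = \<lambda>\<rho> h. ty_ar C A (case_nat h (\<lambda>n. idm C (\<rho> n)));
          \<rho> = (\<lambda>n. src C (f n));
          \<rho>' = (\<lambda>n. tgt C (f n))
      in THE k. k \<in> hom C (mu_ob C (Fo \<rho>) (Fa \<rho>)) (mu_ob C (Fo \<rho>') (Fa \<rho>')) \<and>
           k \<cdot>\<^bsub>C\<^esub> mu_in C (Fo \<rho>) (Fa \<rho>) = mu_in C (Fo \<rho>') (Fa \<rho>') \<cdot>\<^bsub>C\<^esub> ty_ar C A (case_nat k f))"
| "ty_ar C (TVar n) f = f n"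

text \<open>On closed types the environment is irrelevant.\<close>

definition sem_ty :: "('o, 'm) rig_cat \<Rightarrow> ty \<Rightarrow> 'o" where
  "sem_ty C A = ty_ob C A (\<lambda>_. zero_ob C)"

definition fold_ar :: "('o, 'm) rig_cat \<Rightarrow> ty \<Rightarrow> 'm" where
  "fold_ar C A = mu_in C (\<lambda>Y. ty_ob C A (case_nat Y (\<lambda>_. zero_ob C)))
     (\<lambda>h. ty_ar C A (case_nat h (\<lambda>_. idm C (zero_ob C))))"

subsection \<open>Linear contexts\<close>

primrec sem_ctx :: "('o, 'm) rig_cat \<Rightarrow> ctx \<Rightarrow> 'o" where
  "sem_ctx C [] = one_ob C"
| "sem_ctx C (xA # \<Delta>) = sem_ty C (snd xA) \<otimes>\<^sub>o[C] sem_ctx C \<Delta>"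

text \<open>The coherence isomorphism from \<open>\<Delta>1 @ \<Delta>2\<close> to the tensor of \<open>\<Delta>1\<close> and \<open>\<Delta>2\<close>.\<close>

primrec split :: "('o, 'm) rig_cat \<Rightarrow> ctx \<Rightarrow> ctx \<Rightarrow> 'm" where
  "split C [] \<Delta>2 = pinv C (lunit (mult C) (sem_ctx C \<Delta>2))"
| "split C (xA # \<Delta>1) \<Delta>2 =
     pinv C (assc (mult C) (sem_ty C (snd xA)) (sem_ctx C \<Delta>1) (sem_ctx C \<Delta>2))
     \<cdot>\<^bsub>C\<^esub> (idm C (sem_ty C (snd xA)) \<otimes>\<^sub>m[C] split C \<Delta>1 \<Delta>2)"

text \<open>The symmetry from \<open>\<Delta>1, A, B, \<Delta>2\<close> to \<open>\<Delta>1, B, A, \<Delta>2\<close>.\<close>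

primrec exch :: "('o, 'm) rig_cat \<Rightarrow> ctx \<Rightarrow> ty \<Rightarrow> ty \<Rightarrow> ctx \<Rightarrow> 'm" where
  "exch C [] A B \<Delta>2 =
     assc (mult C) (sem_ty C B) (sem_ty C A) (sem_ctx C \<Delta>2)
     \<cdot>\<^bsub>C\<^esub> (symm (mult C) (sem_ty C A) (sem_ty C B) \<otimes>\<^sub>m[C] idm C (sem_ctx C \<Delta>2))
     \<cdot>\<^bsub>C\<^esub> pinv C (assc (mult C) (sem_ty C A) (sem_ty C B) (sem_ctx C \<Delta>2))"
| "exch C (zD # \<Delta>1) A B \<Delta>2 = idm C (sem_ty C (snd zD)) \<otimes>\<^sub>m[C] exch C \<Delta>1 A B \<Delta>2"

subsection \<open>Iso types\<close>

text \<open>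
  The iterated dcpos of Scott continuous maps do not all fit into one HOL type that depends only
  on \<open>'m\<close>. Elements of all of them are therefore represented in the one type below, where a Scott
  continuous map \<open>f\<close> is represented by \<open>Fn (code f)\<close>. This represents \<open>T1 \<rightarrow> T2\<close> properly if
  \<open>code :: (('m, 'd) sem \<Rightarrow> ('m, 'd) sem) \<Rightarrow> 'd\<close> is injective on the Scott continuous maps in
  question, which is what \<open>representable\<close> demands. For a given set of finitely many iso types
  (those in a typing derivation, say) a large enough type \<open>'d\<close> always exists.
\<close>

datatype ('m, 'd) sem = Mor (mor: 'm) | Fn 'd

type_synonym ('m, 'd) coding = "(('m, 'd) sem \<Rightarrow> ('m, 'd) sem) \<Rightarrow> 'd"

definition decode ::
    "('m, 'd) coding \<Rightarrow> ('m, 'd) sem poset \<Rightarrow> ('m, 'd) sem poset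
      \<Rightarrow> ('m, 'd) sem \<Rightarrow> ('m, 'd) sem \<Rightarrow> ('m, 'd) sem" where
  "decode code P Q = inv_into (scott_maps P Q) (\<lambda>f. Fn (code f))"

primrec sem_ity :: "('o, 'm) rig_cat \<Rightarrow> ('m, 'd) coding \<Rightarrow> ity \<Rightarrow> ('m, 'd) sem poset" where
  "sem_ity C code (A \<leftrightarrow> B) =
     (Mor ` hom C (sem_ty C A) (sem_ty C B), \<lambda>x y. le C (mor x) (mor y))"
| "sem_ity C code (Fun T1 T2) =
     (let P = sem_ity C code T1; Q = sem_ity C code T2
      in ((\<lambda>f. Fn (code f)) ` scott_maps P Q,
          \<lambda>x y. \<forall>a\<in>fst P. snd Q (decode code P Q x a) (decode code P Q y a)))"

primrec representable :: "('o, 'm) rig_cat \<Rightarrow> ('m, 'd) coding \<Rightarrow> ity \<Rightarrow> bool" where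
  "representable C code (A \<leftrightarrow> B) = True"
| "representable C code (Fun T1 T2) = (representable C code T1 \<and> representable C code T2 \<and>
     inj_on code (scott_maps (sem_ity C code T1) (sem_ity C code T2)))"

subsection \<open>Terms and isos\<close>

text \<open>
  \<open>interp C code \<Psi> \<Delta> t A F\<close> states that some derivation of \<open>\<Psi>; \<Delta> \<turnstile> t : A\<close> is interpreted by
  \<open>F\<close>, a function of environments \<open>g\<close>, of which only the values on the domain of \<open>\<Psi>\<close> matter;
  \<open>iinterp\<close> is the same for isos. The rules are those of \<^const>\<open>has_type\<close> and \<^const>\<open>has_itype\<close>
  together with the interpretation of the derived judgement. The iso types introduced by
  \<open>in_Lam\<close> and \<open>in_IVar\<close>, hence all iso types in a derivation of a closed term, must be
  representable for it to have an interpretation over \<open>'d\<close>.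
\<close>

type_synonym ('m, 'd) env = "ivar \<Rightarrow> ('m, 'd) sem"

inductive interp :: "('o, 'm) rig_cat \<Rightarrow> ('m, 'd) coding \<Rightarrow>
      ictx \<Rightarrow> ctx \<Rightarrow> trm \<Rightarrow> ty \<Rightarrow> (('m, 'd) env \<Rightarrow> 'm) \<Rightarrow> bool"
  and iinterp :: "('o, 'm) rig_cat \<Rightarrow> ('m, 'd) coding \<Rightarrow>
      ictx \<Rightarrow> iso \<Rightarrow> ity \<Rightarrow> (('m, 'd) env \<Rightarrow> ('m, 'd) sem) \<Rightarrow> bool"
  for C :: "('o, 'm) rig_cat" and code :: "('m, 'd) coding"
where
  in_Unit: "interp C code \<Psi> [] Unit One (\<lambda>g. idm C (one_ob C))"
| in_Var: "closed_ty A \<Longrightarrow>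
    interp C code \<Psi> [(x, A)] (Var x) A (\<lambda>g. runit (mult C) (sem_ty C A))"
| in_Inl: "interp C code \<Psi> \<Delta> t A F \<Longrightarrow> closed_ty B \<Longrightarrow>
    interp C code \<Psi> \<Delta> (Inl t) (Sum A B) (\<lambda>g. inj_l C (sem_ty C A) (sem_ty C B) \<cdot>\<^bsub>C\<^esub> F g)"
| in_Inr: "interp C code \<Psi> \<Delta> t B F \<Longrightarrow> closed_ty A \<Longrightarrow>
    interp C code \<Psi> \<Delta> (Inr t) (Sum A B) (\<lambda>g. inj_r C (sem_ty C A) (sem_ty C B) \<cdot>\<^bsub>C\<^esub> F g)"
| in_Pair: "interp C code \<Psi> \<Delta>1 t1 A F1 \<Longrightarrow> interp C code \<Psi> \<Delta>2 t2 B F2 \<Longrightarrow>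
    distinct (map fst (\<Delta>1 @ \<Delta>2)) \<Longrightarrow>
    interp C code \<Psi> (\<Delta>1 @ \<Delta>2) (Pair t1 t2) (Prod A B)
      (\<lambda>g. (F1 g \<otimes>\<^sub>m[C] F2 g) \<cdot>\<^bsub>C\<^esub> split C \<Delta>1 \<Delta>2)"
| in_Fold: "interp C code \<Psi> \<Delta> t (ty_subst A 0 (Mu A)) F \<Longrightarrow>
    interp C code \<Psi> \<Delta> (Fold t) (Mu A) (\<lambda>g. fold_ar C A \<cdot>\<^bsub>C\<^esub> F g)"
| in_App: "iinterp C code \<Psi> w (A \<leftrightarrow> B) G \<Longrightarrow> interp C code \<Psi> \<Delta> t A F \<Longrightarrow>
    interp C code \<Psi> \<Delta> (App w t) B (\<lambda>g. mor (G g) \<cdot>\<^bsub>C\<^esub> F g)"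
| in_Let: "interp C code \<Psi> \<Delta>1 t1 A F1 \<Longrightarrow> interp C code \<Psi> \<Gamma> (pat_trm p) A P \<Longrightarrow>
    interp C code \<Psi> (\<Delta>2 @ \<Gamma>) t2 B F2 \<Longrightarrow> distinct (map fst (\<Delta>1 @ \<Delta>2)) \<Longrightarrow>
    interp C code \<Psi> (\<Delta>1 @ \<Delta>2) (Let p t1 t2) B
      (\<lambda>g. F2 g \<cdot>\<^bsub>C\<^esub> pinv C (split C \<Delta>2 \<Gamma>)
         \<cdot>\<^bsub>C\<^esub> (idm C (sem_ctx C \<Delta>2) \<otimes>\<^sub>m[C] (pinv C (P g) \<cdot>\<^bsub>C\<^esub> F1 g))
         \<cdot>\<^bsub>C\<^esub> symm (mult C) (sem_ctx C \<Delta>1) (sem_ctx C \<Delta>2) \<cdot>\<^bsub>C\<^esub> split C \<Delta>1 \<Delta>2)"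
| in_Exch: "interp C code \<Psi> (\<Delta>1 @ (x, A) # (y, B) # \<Delta>2) t D F \<Longrightarrow>
    interp C code \<Psi> (\<Delta>1 @ (y, B) # (x, A) # \<Delta>2) t D (\<lambda>g. F g \<cdot>\<^bsub>C\<^esub> exch C \<Delta>1 B A \<Delta>2)"
| in_Clauses: "closed_ty A \<Longrightarrow> closed_ty B
    \<Longrightarrow> (\<And>i. i < length cs \<Longrightarrow> is_val (fst (cs ! i)))
    \<Longrightarrow> (\<And>i. i < length cs \<Longrightarrow> is_expr (snd (cs ! i)))
    \<Longrightarrow> (\<And>i. i < length cs \<Longrightarrow> interp C code \<Psi> (\<Delta> i) (fst (cs ! i)) A (V i))
    \<Longrightarrow> (\<And>i. i < length cs \<Longrightarrow> interp C code \<Psi> (\<Delta> i) (snd (cs ! i)) B (E i))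
    \<Longrightarrow> (\<And>i j. i < length cs \<Longrightarrow> j < length cs \<Longrightarrow> i \<noteq> j \<Longrightarrow> fst (cs ! i) \<bottom> fst (cs ! j))
    \<Longrightarrow> (\<And>i j. i < length cs \<Longrightarrow> j < length cs \<Longrightarrow> i \<noteq> j \<Longrightarrow> snd (cs ! i) \<bottom> snd (cs ! j))
    \<Longrightarrow> iinterp C code \<Psi> (Clauses cs) (A \<leftrightarrow> B)
      (\<lambda>g. Mor (Join C (sem_ty C A) (sem_ty C B)
         ((\<lambda>i. E i g \<cdot>\<^bsub>C\<^esub> pinv C (V i g)) ` {..<length cs})))"
| in_Fix: "iinterp C code (\<Psi>(\<phi> \<mapsto> T)) w T G \<Longrightarrow>
    iinterp C code \<Psi> (Fix \<phi> w) T
      (\<lambda>g. least_fixpoint (sem_ity C code T) (\<lambda>x. G (g(\<phi> := x))))"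
| in_Lam: "representable C code (Fun T1 T2) \<Longrightarrow> closed_ity T1 \<Longrightarrow>
    iinterp C code (\<Psi>(\<phi> \<mapsto> T1)) w T2 G \<Longrightarrow>
    iinterp C code \<Psi> (Lam \<phi> w) (Fun T1 T2)
      (\<lambda>g. Fn (code (restrict (\<lambda>x. G (g(\<phi> := x))) (fst (sem_ity C code T1)))))"
| in_IVar: "representable C code T \<Longrightarrow> \<Psi> \<phi> = Some T \<Longrightarrow> closed_ity T \<Longrightarrow>
    iinterp C code \<Psi> (IVar \<phi>) T (\<lambda>g. g \<phi>)"
| in_IApp: "iinterp C code \<Psi> w1 (Fun T1 T2) G1 \<Longrightarrow> iinterp C code \<Psi> w2 T1 G2 \<Longrightarrow>
    iinterp C code \<Psi> (IApp w1 w2) T2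
      (\<lambda>g. decode code (sem_ity C code T1) (sem_ity C code T2) (G1 g) (G2 g))"

text \<open>
  Only typable terms and isos have an interpretation, and apart from representability nothing else
  is needed for one to exist.
\<close>

lemma interp_has_type:
  "interp C code \<Psi> \<Delta> t A F \<Longrightarrow> has_type \<Psi> \<Delta> t A"
  "iinterp C code \<Psi> w T G \<Longrightarrow> has_itype \<Psi> w T"
proof (induction rule: interp_iinterp.inducts)
  case in_Unit
  then show ?case by (intro ty_Unit)
next
  case in_Var
  then show ?case by (intro ty_Var)
next
  case in_Inl
  then show ?case by (intro ty_Inl)
next
  case in_Inr
  then show ?case by (intro ty_Inr)
next
  case in_Pair
  then show ?case by (intro ty_Pair)
next
  case in_Fold
  then show ?case by (intro ty_Fold)
next
  case in_App
  then show ?case by (intro ty_App)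
next
  case in_Let
  then show ?case by (intro ty_Let)
next
  case in_Exch
  show ?case by (rule ty_Exch[OF in_Exch(2)])
next
  case in_Clauses
  then show ?case by (intro ty_Clauses)
next
  case in_Fix
  then show ?case by (intro ty_Fix)
next
  case in_Lam
  then show ?case by (intro ty_Lam)
next
  case in_IVar
  then show ?case by (intro ty_IVar)
next
  case in_IApp
  then show ?case by (intro ty_IApp)
qed

lemma interp_exists:
  assumes rep: "\<And>T. representable C code T"
  shows "has_type \<Psi> \<Delta> t A \<Longrightarrow> \<exists>F. interp C code \<Psi> \<Delta> t A F"
    and "has_itype \<Psi> w T \<Longrightarrow> \<exists>G. iinterp C code \<Psi> w T G"
proof (induction rule: has_type_has_itype.inducts)
  case ty_Unit
  show ?case by (rule exI, rule in_Unit)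
next
  case ty_Var
  then show ?case by (blast intro: in_Var)
next
  case ty_Inl
  then show ?case by (elim exE) (intro exI, rule in_Inl)
next
  case ty_Inr
  then show ?case by (elim exE) (intro exI, rule in_Inr)
next
  case ty_Pair
  then show ?case by (elim exE) (intro exI, rule in_Pair)
next
  case ty_Fold
  then show ?case by (elim exE) (intro exI, rule in_Fold)
next
  case ty_App
  then show ?case by (elim exE) (intro exI, rule in_App)
next
  case ty_Let
  then show ?case by (elim exE) (intro exI, rule in_Let)
next
  case ty_Exch
  then show ?case by (elim exE) (rule exI, rule in_Exch)
next
  case (ty_Clauses A B cs \<Psi> \<Delta>)
  then obtain V E where V: "\<And>i. i < length cs \<Longrightarrow> interp C code \<Psi> (\<Delta> i) (fst (cs ! i)) A (V i)"
    and E: "\<And>i. i < length cs \<Longrightarrow> interp C code \<Psi> (\<Delta> i) (snd (cs ! i)) B (E i)" by metis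
  show ?case
    by (rule exI, rule in_Clauses[OF ty_Clauses(1-4) V E]) (simp_all add: ty_Clauses)
next
  case ty_Fix
  then show ?case by (elim exE) (intro exI, rule in_Fix)
next
  case ty_Lam
  then show ?case by (elim exE) (rule exI, rule in_Lam[OF rep])
next
  case ty_IVar
  then show ?case by (blast intro: in_IVar rep)
next
  case ty_IApp
  then show ?case by (elim exE) (intro exI, rule in_IApp)
qed

end

theory Submission
  imports Defs
begin

text \<open>
  Types other than iso types are first-order, so the closed values are finite trees and their
  denotations are total, hence nonzero because \<open>0\<close> and \<open>1\<close> are not isomorphic. It remains to show
  that a closed term denotes the value it evaluates to, and that it evaluates to a value if its
  denotation is nonzero. Both are proved with a logical relation between isos and elements of the
  dcpos interpreting their types. At a fixed point adequacy passes to the least upper bound because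
  total maps are maximal in their hom-set, and soundness is by induction on the number of evaluation
  steps.

  The interpretation makes sense because a functor given by a type preserves total maps, which are
  the embeddings, and least upper bounds, so that its initial algebra is the colimit of a chain of
  total maps.
\<close>

section \<open>Inverse categories\<close>

text \<open>The interpretation belongs to derivations, and reduction rewrites isos of higher type
  inside terms. A direct proof of soundness would need independence of the derivation and
  substitution lemmas for every syntactic class. The logical relation compares a closed term with a
  morphism out of the unit, and leaves a semantic substitution lemma for values alone. The two
  directions behave differently at a fixed point. Adequacy constrains only nonzero denotations, so
  it holds for the least element and climbs along the approximants. Soundness fails for the least
  element as soon as something terminates, so it has to speak about the fixed point itself and uses
  that each unfolding costs a step. Linear contexts bring in monoidal coherence: a closing
  substitution is a point of the context, and splitting or exchanging it must act on points as
  expected. For this the symmetry on the unit has to be the identity. Clause sets may fail to be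
  exhaustive, so evaluation can get stuck; failure of matching is therefore tracked semantically, as
  a vanishing composite.\<close>

context category
begin

lemma hom_iff: "f \<in> hom C A B \<longleftrightarrow> src C f = A \<and> tgt C f = B"
  by (simp add: hom_def)

lemma src_idm [simp]: "src C (idm C A) = A" and tgt_idm [simp]: "tgt C (idm C A) = A"
  using idm_hom[of A] by (simp_all add: hom_iff)

lemma src_comp [simp]: "tgt C f = src C g \<Longrightarrow> src C (g \<cdot> f) = src C f"
  and tgt_comp [simp]: "tgt C f = src C g \<Longrightarrow> tgt C (g \<cdot> f) = tgt C g"
  using comp_hom[of f "src C f" "src C g" g "tgt C g"] by (simp_all add: hom_iff)

lemma assoc [simp]: "tgt C f = src C g \<Longrightarrow> tgt C g = src C h \<Longrightarrow> (h \<cdot> g) \<cdot> f = h \<cdot> g \<cdot> f"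
  using comp_assoc[of f "src C f" "src C g" g "src C h" h "tgt C h"] by (simp add: hom_iff)

lemma comp_idm [simp]: "src C f = A \<Longrightarrow> f \<cdot> idm C A = f"
  and idm_comp [simp]: "tgt C f = A \<Longrightarrow> idm C A \<cdot> f = f"
  using idm_right[of f "src C f" "tgt C f"] idm_left[of f "src C f" "tgt C f"]
  by (auto simp: hom_iff)

end

section \<open>Restriction idempotents, total maps and the order on hom-sets\<close>

context restriction_category
begin

lemma src_restr [simp]: "src C (restr C f) = src C f" and tgt_restr [simp]: "tgt C (restr C f) = src C f"
  using restr_hom[of f "src C f" "tgt C f"] by (simp_all add: hom_iff)

lemma comp_restr [simp]: "f \<cdot> restr C f = f"
  using restr1[of f "src C f" "tgt C f"] by (simp add: hom_iff)

lemma restr_commute: "src C f = src C g \<Longrightarrow> restr C f \<cdot> restr C g = restr C g \<cdot> restr C f"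
  using restr2[of f "src C f" "tgt C f" g "tgt C g"] by (simp add: hom_iff)

lemma restr_comp_restr: "src C f = src C g \<Longrightarrow> restr C (f \<cdot> restr C g) = restr C f \<cdot> restr C g"
  using restr3[of f "src C f" "tgt C f" g "tgt C g"] by (simp add: hom_iff)

lemma restr_comp_eq: "tgt C f = src C h \<Longrightarrow> restr C h \<cdot> f = f \<cdot> restr C (h \<cdot> f)"
  using restr4[of f "src C f" "tgt C f" h "tgt C h"] by (simp add: hom_iff)

lemma restr_idm [simp]: "restr C (idm C A) = idm C A"
  using comp_restr[of "idm C A"] by (simp del: comp_restr)

lemma restr_restr [simp]: "restr C (restr C f) = restr C f"
  using restr_comp_restr[of "idm C (src C f)" f] by simp

lemma restr_idem [simp]: "restr C f \<cdot> restr C f = restr C f"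
  using comp_restr[of "restr C f"] by (simp del: comp_restr)

lemma restr_comp_absorb: "tgt C f = src C g \<Longrightarrow> restr C (g \<cdot> f) \<cdot> restr C f = restr C (g \<cdot> f)"
  using restr_comp_restr[of "g \<cdot> f" f] by simp

lemma restr_comp_absorb': "tgt C f = src C g \<Longrightarrow> restr C f \<cdot> restr C (g \<cdot> f) = restr C (g \<cdot> f)"
  using restr_comp_absorb[of f g] restr_commute[of f "g \<cdot> f"] by simp

definition total :: "'b \<Rightarrow> bool" where
  "total f \<longleftrightarrow> restr C f = idm C (src C f)"

lemma total_idm [simp]: "total (idm C A)" by (simp add: total_def)

text \<open>With \<open>g\<close> total, the fourth restriction axiom reads
  \<open>f = f \<cdot> restr C (g \<cdot> f)\<close>; taking restrictions on both sides and
  absorbing gives the equation.\<close>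

lemma restr_total_comp: "tgt C f = src C g \<Longrightarrow> total g \<Longrightarrow> restr C (g \<cdot> f) = restr C f"
  using restr_comp_eq[of f g] restr_comp_absorb'[of f g] restr_comp_restr[of f "g \<cdot> f"]
  by (simp add: total_def)

lemma total_comp: "tgt C f = src C g \<Longrightarrow> total g \<Longrightarrow> total f \<Longrightarrow> total (g \<cdot> f)"
  using restr_total_comp[of f g] by (simp add: total_def)

lemma total_comp_right: "tgt C f = src C g \<Longrightarrow> total (g \<cdot> f) \<Longrightarrow> total f"
  using restr_comp_absorb[of f g] by (simp add: total_def)

lemma le_iff: "le C f g \<longleftrightarrow> g \<cdot> restr C f = f" by (simp add: le_def)

lemma le_refl: "le C f f" by (simp add: le_iff)

lemma le_antisym:
  assumes "src C f = src C g" "le C f g" "le C g f" shows "f = g"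
proof -
  have "f = (f \<cdot> restr C g) \<cdot> restr C f" using assms by (simp add: le_iff del: assoc)
  also have "\<dots> = f \<cdot> (restr C f \<cdot> restr C g)" using assms by (simp add: restr_commute)
  also have "\<dots> = (f \<cdot> restr C f) \<cdot> restr C g" using assms(1) by (simp del: comp_restr)
  also have "\<dots> = g" using assms by (simp add: le_iff)
  finally show ?thesis .
qed

lemma le_restr: "le C f g \<Longrightarrow> src C f = src C g \<Longrightarrow> restr C g \<cdot> restr C f = restr C f"
  using restr_comp_restr[of g f] by (simp add: le_iff)

lemma le_trans:
  assumes "src C f = src C g" "src C g = src C h" "le C f g" "le C g h" shows "le C f h"
proof -
  have "h \<cdot> restr C f = h \<cdot> restr C g \<cdot> restr C f" using le_restr[OF assms(3,1)] by simp
  also have "\<dots> = (h \<cdot> restr C g) \<cdot> restr C f" using assms(1,2) by simp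
  also have "\<dots> = f" using assms(3,4) by (simp add: le_iff)
  finally show ?thesis by (simp add: le_iff)
qed

text \<open>Since \<open>restr C f\<close> is an identity, \<open>g \<cdot> restr C f = f\<close>
  collapses to \<open>g = f\<close>. It is applied to the total denotation of a value that was
  reached from a single approximant.\<close>

lemma le_total: "src C f = src C g \<Longrightarrow> le C f g \<Longrightarrow> total f \<Longrightarrow> f = g"
  unfolding le_iff total_def by (metis comp_idm)

lemma comp_mono_left:
  assumes "tgt C f = src C g" "src C g = src C g'" "le C g g'"
  shows "le C (g \<cdot> f) (g' \<cdot> f)"
proof -
  have "(g' \<cdot> f) \<cdot> restr C (g \<cdot> f) = g' \<cdot> (restr C g \<cdot> f)"
    using assms by (simp add: restr_comp_eq)
  also have "\<dots> = (g' \<cdot> restr C g) \<cdot> f" using assms by simp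
  also have "\<dots> = g \<cdot> f" using assms(3) by (simp only: le_iff)
  finally show ?thesis by (simp only: le_iff)
qed

lemma comp_mono_right:
  assumes "tgt C f = src C g" "tgt C f' = src C g" "src C f = src C f'" "le C f f'"
  shows "le C (g \<cdot> f) (g \<cdot> f')"
proof -
  have "(g \<cdot> f') \<cdot> restr C (g \<cdot> f) = (g \<cdot> f') \<cdot> (restr C f \<cdot> restr C (g \<cdot> f))"
    using assms by (simp add: restr_comp_absorb')
  also have "\<dots> = g \<cdot> ((f' \<cdot> restr C f) \<cdot> restr C (g \<cdot> f))"
    using assms(1-3) by simp
  also have "\<dots> = (g \<cdot> f) \<cdot> restr C (g \<cdot> f)" using assms by (simp add: le_iff del: comp_restr)
  finally show ?thesis by (simp add: le_iff)
qed

end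

section \<open>Partial inverses and their idempotents\<close>

context inverse_category
begin

lemma pinv_props:
  "pinv C f \<in> hom C (tgt C f) (src C f) \<and> pinv C f \<cdot> f = restr C f \<and> f \<cdot> pinv C f = restr C (pinv C f)"
  using theI'[OF pinv_ex1[of f "src C f" "tgt C f"]] by (simp add: pinv_def hom_iff)

lemma src_pinv [simp]: "src C (pinv C f) = tgt C f" and tgt_pinv [simp]: "tgt C (pinv C f) = src C f"
  and pinv_comp_self [simp]: "pinv C f \<cdot> f = restr C f" and comp_pinv_self [simp]: "f \<cdot> pinv C f = restr C (pinv C f)"
  using pinv_props[of f] by (simp_all add: hom_iff)

lemma pinv_unique:
  assumes "src C g = tgt C f" "tgt C g = src C f" "g \<cdot> f = restr C f" "f \<cdot> g = restr C g"
  shows "pinv C f = g"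
proof -
  have "g \<in> hom C (tgt C f) (src C f)" using assms by (simp add: hom_iff)
  then show ?thesis using pinv_ex1[of f "src C f" "tgt C f"] pinv_props[of f] assms(3,4)
    unfolding hom_iff[of f] by metis
qed

lemma pinv_pinv [simp]: "pinv C (pinv C f) = f"
  by (rule pinv_unique) simp_all

lemma pinv_restr [simp]: "pinv C (restr C f) = restr C f"
  by (rule pinv_unique) simp_all

lemma pinv_idm [simp]: "pinv C (idm C A) = idm C A"
  by (rule pinv_unique) simp_all

lemma pinv_comp_reassoc [simp]: "tgt C x = src C f \<Longrightarrow> pinv C f \<cdot> f \<cdot> x = restr C f \<cdot> x"
  using assoc[of x f "pinv C f"] by simp

lemma comp_pinv_reassoc [simp]: "tgt C x = tgt C f \<Longrightarrow> f \<cdot> pinv C f \<cdot> x = restr C (pinv C f) \<cdot> x"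
  using assoc[of x "pinv C f" f] by simp

text \<open>The inner idempotent of each composite is moved outwards by the fourth restriction
  axiom, where it is absorbed.\<close>

lemma pinv_comp [simp]:
  assumes "tgt C f = src C g" shows "pinv C (g \<cdot> f) = pinv C f \<cdot> pinv C g"
proof (rule pinv_unique)
  show "(pinv C f \<cdot> pinv C g) \<cdot> g \<cdot> f = restr C (g \<cdot> f)"
    using assms by (simp add: restr_comp_eq[of f g] restr_comp_absorb')
  have "(g \<cdot> f) \<cdot> pinv C f \<cdot> pinv C g = g \<cdot> restr C (pinv C f) \<cdot> pinv C g"
    using assms by simp
  also have "\<dots> = restr C (pinv C g) \<cdot> restr C (pinv C f \<cdot> pinv C g)"
    using assms by (simp add: restr_comp_eq[of "pinv C g" "pinv C f"])
  finally show "(g \<cdot> f) \<cdot> pinv C f \<cdot> pinv C g = restr C (pinv C f \<cdot> pinv C g)"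
    using assms by (simp add: restr_comp_absorb')
qed (use assms in simp_all)

lemma restr_pinv_comp [simp]: "restr C (pinv C f) \<cdot> f = f"
  using comp_pinv_reassoc[of f f] comp_restr[of f] pinv_comp_self[of f] by metis

text \<open>The partial inverse of an idempotent is idempotent too, so \<open>e\<close> equals
  \<open>e \<cdot> pinv C e \<cdot> pinv C e \<cdot> e\<close>, a product of two restriction
  idempotents.\<close>

lemma idempotent_restr:
  assumes "src C e = tgt C e" "e \<cdot> e = e" shows "restr C e = e"
proof -
  have pp: "pinv C e \<cdot> pinv C e = pinv C e" using pinv_comp[of e e] assms by simp
  have "e = e \<cdot> pinv C e \<cdot> e" by simp
  also have "\<dots> = e \<cdot> (pinv C e \<cdot> pinv C e) \<cdot> e" by (simp only: pp)
  also have "\<dots> = restr C (pinv C e) \<cdot> restr C e" using assms(1) by simp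
  finally have e: "e = restr C (pinv C e) \<cdot> restr C e" .
  have "restr C (restr C (pinv C e) \<cdot> restr C e) = restr C (pinv C e) \<cdot> restr C e"
    using assms(1) restr_comp_restr[of "restr C (pinv C e)" e] by simp
  then show ?thesis using e by simp
qed

lemma pinv_mono:
  assumes "src C f = src C g" "tgt C f = tgt C g" "le C f g" shows "le C (pinv C f) (pinv C g)"
proof -
  have "pinv C g \<cdot> restr C (pinv C f) = pinv C g \<cdot> (g \<cdot> restr C f) \<cdot> pinv C f"
    using assms by (simp add: le_iff)
  also have "\<dots> = (restr C g \<cdot> restr C f) \<cdot> pinv C f" using assms(1,2) by simp
  also have "\<dots> = pinv C f"
    using le_restr[OF assms(3,1)] restr_pinv_comp[of "pinv C f"] by simp
  finally show ?thesis by (simp add: le_iff)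
qed

text \<open>A two-sided inverse satisfies the equations that characterise the partial inverse, so
  \<open>pinv\<close> can stand for it throughout; both maps are total as right factors of
  identities.\<close>

lemma is_iso_total: "is_iso C f \<Longrightarrow> total f" and is_iso_pinv_total: "is_iso C f \<Longrightarrow> total (pinv C f)"
proof -
  assume "is_iso C f"
  then obtain g where g: "src C g = tgt C f" "tgt C g = src C f" "g \<cdot> f = idm C (src C f)"
      "f \<cdot> g = idm C (tgt C f)"
    by (auto simp: is_iso_def hom_iff)
  show f: "total f" using total_comp_right[of f g] g by simp
  have "total g" using total_comp_right[of g f] g by simp
  then have "pinv C f = g" using f g by (intro pinv_unique) (simp_all add: total_def)
  then show "total (pinv C f)" using \<open>total g\<close> by simp
qed

lemma is_iso_cancel [simp]: "is_iso C f \<Longrightarrow> restr C f = idm C (src C f)"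
  "is_iso C f \<Longrightarrow> restr C (pinv C f) = idm C (tgt C f)"
  using is_iso_total[of f] is_iso_pinv_total[of f] by (simp_all add: total_def)

lemma is_isoI: "total f \<Longrightarrow> total (pinv C f) \<Longrightarrow> is_iso C f"
  unfolding is_iso_def total_def by (rule bexI[of _ "pinv C f"]) (simp_all add: hom_iff)

lemma total_embedding: "total f \<Longrightarrow> embedding C f"
  unfolding embedding_def total_def
  by (rule bexI[of _ "pinv C f"]) (simp_all add: hom_iff le_iff)

text \<open>Two maps below a common \<open>h\<close> agree where both are defined, and their partial
  inverses lie below that of \<open>h\<close>. Hence the join axioms apply to directed sets.\<close>

lemma directed_compatible:
  assumes "S \<subseteq> hom C A B" "is_directed (le C) S" shows "compatible C S"
  unfolding compatible_def
proof (intro ballI)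
  have *: "f \<cdot> restr C g = g \<cdot> restr C f"
    if "le C f h" "le C g h" "src C f = src C h" "src C g = src C h" for f g h
  proof -
    have "f \<cdot> restr C g = h \<cdot> restr C f \<cdot> restr C g"
      using that assoc[of "restr C g" "restr C f" h] by (simp add: le_iff)
    also have "\<dots> = h \<cdot> restr C g \<cdot> restr C f" using that restr_commute[of f g] by simp
    also have "\<dots> = g \<cdot> restr C f"
      using that assoc[of "restr C f" "restr C g" h] by (simp add: le_iff)
    finally show ?thesis .
  qed
  fix f g assume fg: "f \<in> S" "g \<in> S"
  then obtain h where h: "h \<in> S" "le C f h" "le C g h" using assms(2) by (auto simp: is_directed_def)
  have t: "src C f = A" "src C g = A" "src C h = A" "tgt C f = B" "tgt C g = B" "tgt C h = B"
    using assms(1) fg h(1) by (auto simp: hom_iff)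
  show "f \<cdot> restr C g = g \<cdot> restr C f \<and>
      pinv C f \<cdot> restr C (pinv C g) = pinv C g \<cdot> restr C (pinv C f)"
    using t h(2,3) by (intro conjI *[of _ h] *[of _ "pinv C h"] pinv_mono) simp_all
qed

lemma lub_unique:
  "is_lub (hom C A B) (le C) S f \<Longrightarrow> is_lub (hom C A B) (le C) S g \<Longrightarrow> f = g"
  by (rule le_antisym) (auto simp: is_lub_def hom_iff)

end

section \<open>Zero maps as empty joins\<close>

context join_inverse_category
begin

lemma Join_eqI:
  "S \<subseteq> hom C A B \<Longrightarrow> compatible C S \<Longrightarrow> is_lub (hom C A B) (le C) S f \<Longrightarrow> Join C A B S = f"
  by (rule lub_unique[OF Join_lub])

lemma zero_lub: "is_lub (hom C A B) (le C) {} (zero C A B)"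
  unfolding zero_def by (rule Join_lub) (simp_all add: compatible_def)

lemma src_zero [simp]: "src C (zero C A B) = A" and tgt_zero [simp]: "tgt C (zero C A B) = B"
  using zero_lub[of A B] by (simp_all add: is_lub_def hom_iff)

lemma zero_le: "src C f = A \<Longrightarrow> tgt C f = B \<Longrightarrow> le C (zero C A B) f"
  using zero_lub[of A B] by (simp add: is_lub_def hom_iff)

lemma comp_zero [simp]: "src C f = B \<Longrightarrow> f \<cdot> zero C A B = zero C A (tgt C f)"
  unfolding zero_def using Join_comp_left[of "{}" A B f "tgt C f"]
  by (simp add: compatible_def hom_iff)

lemma zero_comp [simp]: "tgt C f = A \<Longrightarrow> zero C A B \<cdot> f = zero C (src C f) B"
  unfolding zero_def using Join_comp_right[of "{}" A B f "src C f"]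
  by (simp add: compatible_def hom_iff)

lemma restr_zero [simp]: "restr C (zero C A B) = zero C A A"
  unfolding zero_def using Join_restr[of "{}" A B] by (simp add: compatible_def)

lemma pinv_zero [simp]: "pinv C (zero C A B) = zero C B A"
  by (rule pinv_unique) simp_all

lemma le_zeroD: "src C f = A \<Longrightarrow> tgt C f = B \<Longrightarrow> le C f (zero C A B) \<Longrightarrow> f = zero C A B"
  by (simp add: le_antisym zero_le)

end

section \<open>Tensors and the coherence of the units\<close>

context category
begin

lemma is_iso_iff: "is_iso C f \<longleftrightarrow> (\<exists>g. src C g = tgt C f \<and> tgt C g = src C f \<and>
    g \<cdot> f = idm C (src C f) \<and> f \<cdot> g = idm C (tgt C f))"
  by (auto simp: is_iso_def hom_iff)

lemma iso_epi:
  assumes "is_iso C e" "src C f = tgt C e" "src C g = tgt C e" "f \<cdot> e = g \<cdot> e" shows "f = g"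
proof -
  obtain e' where e': "src C e' = tgt C e" "tgt C e' = src C e" "e \<cdot> e' = idm C (tgt C e)"
    using assms(1) unfolding is_iso_iff by auto
  have "f = (f \<cdot> e) \<cdot> e'" using e' assms(2) by simp
  also have "\<dots> = g" unfolding assms(4) using e' assms(3) by simp
  finally show ?thesis .
qed

lemma iso_mono:
  assumes "is_iso C e" "tgt C f = src C e" "tgt C g = src C e" "e \<cdot> f = e \<cdot> g" shows "f = g"
proof -
  obtain e' where e': "src C e' = tgt C e" "tgt C e' = src C e" "e' \<cdot> e = idm C (src C e)"
    using assms(1) unfolding is_iso_iff by auto
  have "f = (e' \<cdot> e) \<cdot> f" using e' assms(2) by simp
  also have "\<dots> = e' \<cdot> e \<cdot> g" using e'(1,2) assms(2,4) by simp
  also have "\<dots> = (e' \<cdot> e) \<cdot> g" using e'(1,2) assms(3) by simp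
  also have "\<dots> = g" using e' assms(3) by simp
  finally show ?thesis .
qed

lemma is_iso_idm [simp]: "is_iso C (idm C A)"
  unfolding is_iso_def by (rule bexI[of _ "idm C A"]) (simp_all add: hom_iff)

lemma is_iso_comp: "is_iso C f \<Longrightarrow> is_iso C g \<Longrightarrow> tgt C f = src C g \<Longrightarrow> is_iso C (g \<cdot> f)"
proof -
  assume "is_iso C f" "is_iso C g" and t: "tgt C f = src C g"
  then obtain f' g' where f': "src C f' = tgt C f" "tgt C f' = src C f" "f' \<cdot> f = idm C (src C f)"
      "f \<cdot> f' = idm C (tgt C f)"
    and g': "src C g' = tgt C g" "tgt C g' = src C g" "g' \<cdot> g = idm C (src C g)"
      "g \<cdot> g' = idm C (tgt C g)"
    unfolding is_iso_iff by blast
  have "f' \<cdot> g' \<cdot> g \<cdot> f = f' \<cdot> (g' \<cdot> g) \<cdot> f" using f'(1,2) g'(1,2) t by simp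
  moreover have "g \<cdot> f \<cdot> f' \<cdot> g' = g \<cdot> (f \<cdot> f') \<cdot> g'" using f'(1,2) g'(1,2) t by simp
  ultimately show ?thesis unfolding is_iso_def
    by (intro bexI[of _ "f' \<cdot> g'"]) (simp_all add: hom_iff f' g' t)
qed

end

section \<open>Symmetric monoidal structure and its coherence on the unit object\<close>

context symmetric_monoidal
begin

lemma src_tar [simp]: "src C (tar M f g) = tob M (src C f) (src C g)"
  and tgt_tar [simp]: "tgt C (tar M f g) = tob M (tgt C f) (tgt C g)"
  using tar_hom[of f "src C f" "tgt C f" g "src C g" "tgt C g"] by (simp_all add: hom_iff)

lemma tar_comp_tar [simp]: "tgt C f = src C f' \<Longrightarrow> tgt C g = src C g' \<Longrightarrow>
    tar M f' g' \<cdot> tar M f g = tar M (f' \<cdot> f) (g' \<cdot> g)"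
  using tar_comp[of f "src C f" "tgt C f" f' "tgt C f'" g "src C g" "tgt C g" g' "tgt C g'"]
  by (simp add: hom_iff)

lemma tar_comp_reassoc [simp]: "tgt C f = src C f' \<Longrightarrow> tgt C g = src C g' \<Longrightarrow>
    tgt C x = tob M (src C f) (src C g) \<Longrightarrow>
    tar M f' g' \<cdot> tar M f g \<cdot> x = tar M (f' \<cdot> f) (g' \<cdot> g) \<cdot> x"
  using assoc[of x "tar M f g" "tar M f' g'"] by simp

declare tar_idm [simp] assc_iso [simp] lunit_iso [simp] runit_iso [simp]

lemma src_assc [simp]: "src C (assc M A B D) = tob M (tob M A B) D"
  and tgt_assc [simp]: "tgt C (assc M A B D) = tob M A (tob M B D)"
  using assc_hom[of A B D] by (simp_all add: hom_iff)

lemma src_lunit [simp]: "src C (lunit M A) = tob M (tunit M) A"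
  and tgt_lunit [simp]: "tgt C (lunit M A) = A"
  using lunit_hom[of A] by (simp_all add: hom_iff)

lemma src_runit [simp]: "src C (runit M A) = tob M A (tunit M)"
  and tgt_runit [simp]: "tgt C (runit M A) = A"
  using runit_hom[of A] by (simp_all add: hom_iff)

lemma src_symm [simp]: "src C (symm M A B) = tob M A B"
  and tgt_symm [simp]: "tgt C (symm M A B) = tob M B A"
  using symm_hom[of A B] by (simp_all add: hom_iff)

lemma symm_iso [simp]: "is_iso C (symm M A B)"
  unfolding is_iso_def by (rule bexI[of _ "symm M B A"]) (simp_all add: hom_iff symm_inverse)

lemma tar_iso: "is_iso C f \<Longrightarrow> is_iso C g \<Longrightarrow> is_iso C (tar M f g)"
proof -
  assume "is_iso C f" "is_iso C g"
  then obtain f' g' where f': "src C f' = tgt C f" "tgt C f' = src C f" "f' \<cdot> f = idm C (src C f)"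
      "f \<cdot> f' = idm C (tgt C f)"
    and g': "src C g' = tgt C g" "tgt C g' = src C g" "g' \<cdot> g = idm C (src C g)"
      "g \<cdot> g' = idm C (tgt C g)"
    unfolding is_iso_iff by blast
  show ?thesis unfolding is_iso_def
    by (rule bexI[of _ "tar M f' g'"]) (simp_all add: hom_iff f' g')
qed

lemma assc_natural: "assc M (tgt C f) (tgt C g) (tgt C h) \<cdot> tar M (tar M f g) h =
    tar M f (tar M g h) \<cdot> assc M (src C f) (src C g) (src C h)"
  by (rule assc_nat) (simp_all add: hom_iff)

lemma lunit_natural: "lunit M (tgt C f) \<cdot> tar M (idm C (tunit M)) f = f \<cdot> lunit M (src C f)"
  by (rule lunit_nat) (simp add: hom_iff)

lemma runit_natural: "runit M (tgt C f) \<cdot> tar M f (idm C (tunit M)) = f \<cdot> runit M (src C f)"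
  by (rule runit_nat) (simp add: hom_iff)

lemma symm_natural: "symm M (tgt C f) (tgt C g) \<cdot> tar M f g = tar M g f \<cdot> symm M (src C f) (src C g)"
  by (rule symm_nat) (simp_all add: hom_iff)

text \<open>The unitor is a natural isomorphism from tensoring with the unit to the identity
  functor, so tensoring with the unit is faithful.\<close>

lemma tar_unit_left_cancel:
  assumes "src C f = src C g" "tgt C f = tgt C g"
    "tar M (idm C (tunit M)) f = tar M (idm C (tunit M)) g"
  shows "f = g"
proof (rule iso_epi[OF lunit_iso])
  have "f \<cdot> lunit M (src C f) = lunit M (tgt C f) \<cdot> tar M (idm C (tunit M)) f"
    by (rule lunit_natural[symmetric])
  also have "\<dots> = lunit M (tgt C g) \<cdot> tar M (idm C (tunit M)) g" by (simp only: assms(2,3))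
  also have "\<dots> = g \<cdot> lunit M (src C f)" by (simp only: lunit_natural assms(1))
  finally show "f \<cdot> lunit M (src C f) = g \<cdot> lunit M (src C f)" .
qed (simp_all add: assms(1))

lemma tar_unit_right_cancel:
  assumes "src C f = src C g" "tgt C f = tgt C g"
    "tar M f (idm C (tunit M)) = tar M g (idm C (tunit M))"
  shows "f = g"
proof (rule iso_epi[OF runit_iso])
  have "f \<cdot> runit M (src C f) = runit M (tgt C f) \<cdot> tar M f (idm C (tunit M))"
    by (rule runit_natural[symmetric])
  also have "\<dots> = runit M (tgt C g) \<cdot> tar M g (idm C (tunit M))" by (simp only: assms(2,3))
  also have "\<dots> = g \<cdot> runit M (src C f)" by (simp only: runit_natural assms(1))
  finally show "f \<cdot> runit M (src C f) = g \<cdot> runit M (src C f)" .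
qed (simp_all add: assms(1))

text \<open>Kelly's argument: the pentagon and the triangle determine the left unitor on the unit.\<close>

lemma lunit_unit_eq_runit_unit: "lunit M (tunit M) = runit M (tunit M)"
proof -
  let ?I = "tunit M" let ?i = "idm C ?I" let ?l = "lunit M ?I" let ?r = "runit M ?I"
  let ?II = "tob M ?I ?I" let ?a = "assc M ?I ?I ?I"
  let ?X = "assc M ?I ?II ?I \<cdot> tar M ?a ?i"
  have tri: "tar M ?i ?l \<cdot> ?a = tar M ?r ?i" by (rule triangle)
  have "tar M ?i (lunit M ?II \<cdot> ?a) \<cdot> ?X
      = tar M ?i (lunit M ?II) \<cdot> (tar M ?i ?a \<cdot> assc M ?I ?II ?I \<cdot> tar M ?a ?i)"
    by simp
  also have "\<dots> = tar M ?i (lunit M ?II) \<cdot> assc M ?I ?I ?II \<cdot> assc M ?II ?I ?I"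
    by (simp only: pentagon)
  also have "\<dots> = (tar M ?i (lunit M ?II) \<cdot> assc M ?I ?I ?II) \<cdot> assc M ?II ?I ?I"
    by simp
  also have "\<dots> = tar M ?r (tar M ?i ?i) \<cdot> assc M ?II ?I ?I"
    by (simp only: triangle tar_idm)
  also have "\<dots> = ?a \<cdot> tar M (tar M ?r ?i) ?i"
    using assc_natural[of ?r ?i ?i] by simp
  also have "\<dots> = ?a \<cdot> tar M (tar M ?i ?l \<cdot> ?a) ?i" by (simp only: tri)
  also have "\<dots> = (?a \<cdot> tar M (tar M ?i ?l) ?i) \<cdot> tar M ?a ?i" by simp
  also have "\<dots> = (tar M ?i (tar M ?l ?i) \<cdot> assc M ?I ?II ?I) \<cdot> tar M ?a ?i"
    using assc_natural[of ?i ?l ?i] by simp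
  also have "\<dots> = tar M ?i (tar M ?l ?i) \<cdot> ?X" by simp
  finally have "tar M ?i (lunit M ?II \<cdot> ?a) = tar M ?i (tar M ?l ?i)"
    by (rule iso_epi[rotated -1]) (auto intro!: is_iso_comp tar_iso)
  \<comment> \<open>Faithfulness removes the outer tensor factor. Naturality of the unitor at
    \<open>?l\<close> then turns \<open>lunit M ?II\<close> into \<open>tar M ?i ?l\<close>, and the
    triangle compares the two unitors.\<close>
  then have 1: "lunit M ?II \<cdot> ?a = tar M ?l ?i"
    by (rule tar_unit_left_cancel[rotated -1]) simp_all
  have "?l \<cdot> tar M ?i ?l = ?l \<cdot> lunit M ?II"
    using lunit_natural[of ?l] by simp
  then have "tar M ?i ?l = lunit M ?II" by (rule iso_mono[rotated -1]) simp_all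
  with 1 tri have "tar M ?l ?i = tar M ?r ?i" by simp
  then show ?thesis by (rule tar_unit_right_cancel[rotated -1]) simp_all
qed

text \<open>Conjugating the symmetry by the unitor gives an endomorphism \<open>z\<close> of the
  unit whose square is the identity, and the unit laws let \<open>z\<close> slip into either tensor
  factor. The hexagon equates one braiding past a pair, worth one \<open>z\<close>, with two
  successive braidings, worth two. So \<open>z\<close> equals its own square. Otherwise permuting
  closed values in a context would leave a twist behind.\<close>

lemma symm_unit_unit: "symm M (tunit M) (tunit M) = idm C (tob M (tunit M) (tunit M))"
proof -
  let ?I = "tunit M" let ?i = "idm C ?I" let ?l = "lunit M ?I" let ?s = "symm M ?I ?I"
  let ?II = "tob M ?I ?I" let ?a = "assc M ?I ?I ?I"
  have r: "runit M ?I = ?l" by (simp add: lunit_unit_eq_runit_unit)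
  have tri: "tar M ?i ?l \<cdot> ?a = tar M ?l ?i" using triangle[of ?I ?I] by (simp add: r)
  obtain l' where l': "src C l' = ?I" "tgt C l' = ?II" "l' \<cdot> ?l = idm C ?II" "?l \<cdot> l' = ?i"
    using lunit_iso[of ?I] unfolding is_iso_iff by auto
  define z where "z = ?l \<cdot> ?s \<cdot> l'"
  have z: "src C z = ?I" "tgt C z = ?I" by (simp_all add: z_def l')
  have zl: "z \<cdot> ?l = ?l \<cdot> ?s" by (simp add: z_def l')
  have zl': "z \<cdot> ?l \<cdot> x = ?l \<cdot> ?s \<cdot> x" if "tgt C x = ?II" for x
    using that assoc[of x ?l z] z zl by simp
  have ss: "?s \<cdot> ?s = idm C ?II" by (rule symm_inverse)
  have "z \<cdot> z \<cdot> ?l = (z \<cdot> ?l) \<cdot> ?s" using z by (simp add: zl zl')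
  also have "\<dots> = ?l" using z by (simp add: zl' ss)
  finally have "(z \<cdot> z) \<cdot> ?l = ?i \<cdot> ?l" using z by simp
  then have zz: "z \<cdot> z = ?i" by (rule iso_epi[rotated -1]) (simp_all add: z)
  have zL: "?l \<cdot> tar M ?i z = z \<cdot> ?l" and zR: "?l \<cdot> tar M z ?i = z \<cdot> ?l"
    using lunit_natural[of z] runit_natural[of z] z by (simp_all add: r)
  have "?l \<cdot> tar M ?i ?l \<cdot> (?a \<cdot> symm M ?I ?II \<cdot> ?a)
      = ?l \<cdot> (tar M ?i ?l \<cdot> ?a) \<cdot> symm M ?I ?II \<cdot> ?a" by simp
  also have "\<dots> = ?l \<cdot> (tar M ?l ?i \<cdot> symm M ?I ?II) \<cdot> ?a" by (simp add: tri)
  also have "\<dots> = ?l \<cdot> (?s \<cdot> tar M ?i ?l) \<cdot> ?a" using symm_natural[of ?i ?l] by simp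
  also have "\<dots> = ?l \<cdot> ?s \<cdot> tar M ?l ?i" by (simp add: tri)
  finally have L: "?l \<cdot> tar M ?i ?l \<cdot> (?a \<cdot> symm M ?I ?II \<cdot> ?a) = z \<cdot> ?l \<cdot> tar M ?l ?i"
    by (simp add: zl')
  have "?l \<cdot> tar M ?i ?l \<cdot> (?a \<cdot> symm M ?I ?II \<cdot> ?a)
      = ?l \<cdot> tar M ?i ?l \<cdot> (tar M ?i ?s \<cdot> ?a \<cdot> tar M ?s ?i)" by (simp only: hexagon)
  also have "\<dots> = ?l \<cdot> tar M ?i (?l \<cdot> ?s) \<cdot> ?a \<cdot> tar M ?s ?i" by simp
  also have "\<dots> = (?l \<cdot> tar M ?i z) \<cdot> (tar M ?i ?l \<cdot> ?a) \<cdot> tar M ?s ?i"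
    using z by (simp add: zl)
  also have "\<dots> = z \<cdot> ?l \<cdot> tar M (z \<cdot> ?l) ?i" unfolding zL tri using z by (simp add: zl zl')
  also have "\<dots> = z \<cdot> (?l \<cdot> tar M z ?i) \<cdot> tar M ?l ?i" using z by simp
  also have "\<dots> = (z \<cdot> z) \<cdot> ?l \<cdot> tar M ?l ?i" unfolding zR using z by simp
  also have "\<dots> = ?l \<cdot> tar M ?l ?i" by (simp add: zz)
  finally have "z \<cdot> (?l \<cdot> tar M ?l ?i) = ?i \<cdot> (?l \<cdot> tar M ?l ?i)" using L by simp
  then have "z = ?i"
    by (rule iso_epi[rotated -1]) (auto intro!: is_iso_comp tar_iso simp: z)
  then have "?l \<cdot> ?s = ?l \<cdot> idm C ?II" using zl by simp
  then show ?thesis by (rule iso_mono[rotated -1]) simp_all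
qed

end

section \<open>The two tensors against restrictions and zero maps; disjointness of the
  injections\<close>

context join_inverse_rig_category
begin

declare mult_restr [simp] add_restr [simp]

lemma pinv_mult [simp]: "pinv C (f \<otimes>\<^sub>m[C] g) = pinv C f \<otimes>\<^sub>m[C] pinv C g"
  by (rule pinv_unique) simp_all

lemma pinv_add [simp]: "pinv C (tar (add C) f g) = tar (add C) (pinv C f) (pinv C g)"
  by (rule pinv_unique) simp_all

lemma mult_zero_left [simp]:
  "zero C A B \<otimes>\<^sub>m[C] g = zero C (A \<otimes>\<^sub>o[C] src C g) (B \<otimes>\<^sub>o[C] tgt C g)"
  using mult_Join_left[of "{}" A B g "src C g" "tgt C g"]
  by (simp add: zero_def compatible_def hom_iff)

lemma mult_zero_right [simp]:
  "g \<otimes>\<^sub>m[C] zero C A B = zero C (src C g \<otimes>\<^sub>o[C] A) (tgt C g \<otimes>\<^sub>o[C] B)"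
  using mult_Join_right[of "{}" A B g "src C g" "tgt C g"]
  by (simp add: zero_def compatible_def hom_iff)

lemma total_mult: "total f \<Longrightarrow> total g \<Longrightarrow> total (f \<otimes>\<^sub>m[C] g)"
  by (simp add: total_def)

lemma to_zero_ob: "tgt C f = zero_ob C \<Longrightarrow> f = zero C (src C f) (zero_ob C)"
  using zero_ob_ep_zero unfolding ep_zero_def hom_iff by (metis src_zero tgt_zero)

lemma from_zero_ob: "src C f = zero_ob C \<Longrightarrow> f = zero C (zero_ob C) (tgt C f)"
  using zero_ob_ep_zero unfolding ep_zero_def hom_iff by (metis src_zero tgt_zero)

lemma src_inj_l [simp]: "src C (inj_l C A B) = A"
  and tgt_inj_l [simp]: "tgt C (inj_l C A B) = tob (add C) A B"
  by (simp_all add: inj_l_def)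

lemma src_inj_r [simp]: "src C (inj_r C A B) = B"
  and tgt_inj_r [simp]: "tgt C (inj_r C A B) = tob (add C) A B"
  by (simp_all add: inj_r_def)

declare inj_l_total [simp] inj_r_total [simp]

text \<open>Inverts a commuting square along its two invertible sides. Naturality of the unitors and
  associators is used in this form, because contexts and injections are built from their partial
  inverses.\<close>

lemma pinv_natural:
  assumes "is_iso C e" "is_iso C e'" "e' \<cdot> g = f \<cdot> e" "tgt C g = src C e'" "src C f = tgt C e"
  shows "g \<cdot> pinv C e = pinv C e' \<cdot> f"
proof -
  have sg: "src C g = src C e" "tgt C f = tgt C e'"
    using assms(3-5) src_comp[of g e'] src_comp[of e f] tgt_comp[of g e'] tgt_comp[of e f] by auto
  have "g \<cdot> pinv C e = pinv C e' \<cdot> (e' \<cdot> g) \<cdot> pinv C e" using assms(1,2,4,5) sg by simp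
  also have "\<dots> = pinv C e' \<cdot> f" unfolding assms(3) using assms(1,2,4,5) sg by simp
  finally show ?thesis .
qed

lemma add_comp_inj_l: "src C f = A \<Longrightarrow> src C g = B \<Longrightarrow>
    tar (add C) f g \<cdot> inj_l C A B = inj_l C (tgt C f) (tgt C g) \<cdot> f"
  using pinv_natural[OF _ _ P.runit_natural[of f], symmetric] by (simp add: inj_l_def)

lemma add_comp_inj_r: "src C f = A \<Longrightarrow> src C g = B \<Longrightarrow>
    tar (add C) f g \<cdot> inj_r C A B = inj_r C (tgt C f) (tgt C g) \<cdot> g"
  using pinv_natural[OF _ _ P.lunit_natural[of g], symmetric] by (simp add: inj_r_def)

text \<open>The isomorphism can be inserted between \<open>f\<close> and \<open>g\<close>, and the
  only map from a given object to the zero object is a zero map.\<close>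

lemma zero_through_iso_zero:
  assumes "is_iso C e" "src C e = X" "tgt C e = zero_ob C" "src C g = X" "tgt C f = X"
  shows "g \<cdot> f = zero C (src C f) (tgt C g)"
proof -
  have "g \<cdot> f = g \<cdot> pinv C e \<cdot> (e \<cdot> f)" using assms by simp
  also have "e \<cdot> f = zero C (src C f) (zero_ob C)" using to_zero_ob[of "e \<cdot> f"] assms by simp
  finally show ?thesis using assms by simp
qed

text \<open>After unfolding the injections, the middle is the sum of a map into the zero object and
  a map out of it. This factors through the sum of two zero objects, which the unitor identifies
  with the zero object.\<close>

lemma inj_r_inj_l [simp]: "pinv C (inj_r C A B) \<cdot> inj_l C A B = zero C A B"
proof -
  let ?Z = "zero_ob C"
  let ?f = "tar (add C) (zero C A ?Z) (idm C ?Z)" and ?g = "tar (add C) (idm C ?Z) (zero C ?Z B)"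
  have "?g \<cdot> ?f = zero C (src C ?f) (tgt C ?g)"
    by (rule zero_through_iso_zero[of "lunit (add C) ?Z" "tob (add C) ?Z ?Z"]) simp_all
  then have "tar (add C) (zero C A ?Z) (zero C ?Z B)
      = zero C (tob (add C) A ?Z) (tob (add C) ?Z B)" by simp
  then show ?thesis by (simp add: inj_l_def inj_r_def)
qed

lemma inj_l_inj_r [simp]: "pinv C (inj_l C A B) \<cdot> inj_r C A B = zero C B A"
proof -
  have "pinv C (pinv C (inj_r C A B) \<cdot> inj_l C A B) = pinv C (zero C A B)"
    by (simp only: inj_r_inj_l)
  then show ?thesis by (simp del: inj_r_inj_l)
qed

lemma inj_disjoint_reassoc [simp]:
  "tgt C x = A \<Longrightarrow> pinv C (inj_r C A B) \<cdot> inj_l C A B \<cdot> x = zero C (src C x) B"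
  "tgt C x = B \<Longrightarrow> pinv C (inj_l C A B) \<cdot> inj_r C A B \<cdot> x = zero C (src C x) A"
  using assoc[of x "inj_l C A B" "pinv C (inj_r C A B)"]
    assoc[of x "inj_r C A B" "pinv C (inj_l C A B)"] by simp_all

end

section \<open>Scott continuous maps\<close>

text \<open>The condition of \<open>scott_maps\<close> without extensionality, so that plain lambda
  terms qualify and only their values on the carrier matter.\<close>

definition scott_cont :: "'a poset \<Rightarrow> 'b poset \<Rightarrow> ('a \<Rightarrow> 'b) \<Rightarrow> bool" where
  "scott_cont P Q f \<longleftrightarrow> f ` fst P \<subseteq> fst Q \<and>
     (\<forall>S x. S \<subseteq> fst P \<and> is_directed (snd P) S \<and> is_lub (fst P) (snd P) S x \<longrightarrow>
       is_lub (fst Q) (snd Q) (f ` S) (f x))"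

text \<open>Pointed dcpos relative to a carrier: the hom-sets are subsets of one HOL type, and so
  are the coded function spaces, hence a type class would not fit.\<close>

locale pcpo =
  fixes P :: "'a poset"
  assumes refl: "x \<in> fst P \<Longrightarrow> snd P x x"
    and trans: "x \<in> fst P \<Longrightarrow> y \<in> fst P \<Longrightarrow> z \<in> fst P \<Longrightarrow> snd P x y \<Longrightarrow> snd P y z \<Longrightarrow> snd P x z"
    and antisym: "x \<in> fst P \<Longrightarrow> y \<in> fst P \<Longrightarrow> snd P x y \<Longrightarrow> snd P y x \<Longrightarrow> x = y"
    and directed_lub: "S \<subseteq> fst P \<Longrightarrow> is_directed (snd P) S \<Longrightarrow> \<exists>x. is_lub (fst P) (snd P) S x"
    and least: "\<exists>x\<in>fst P. \<forall>y\<in>fst P. snd P x y"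

lemma scott_contD: "scott_cont P Q f \<Longrightarrow> S \<subseteq> fst P \<Longrightarrow> is_directed (snd P) S \<Longrightarrow>
    is_lub (fst P) (snd P) S x \<Longrightarrow> is_lub (fst Q) (snd Q) (f ` S) (f x)"
  by (auto simp: scott_cont_def)

lemma scott_cont_closed: "scott_cont P Q f \<Longrightarrow> x \<in> fst P \<Longrightarrow> f x \<in> fst Q"
  by (auto simp: scott_cont_def)

lemma scott_contI: "(\<And>x. x \<in> fst P \<Longrightarrow> f x \<in> fst Q) \<Longrightarrow>
    (\<And>S x. S \<subseteq> fst P \<Longrightarrow> is_directed (snd P) S \<Longrightarrow> is_lub (fst P) (snd P) S x \<Longrightarrow>
      is_lub (fst Q) (snd Q) (f ` S) (f x)) \<Longrightarrow> scott_cont P Q f"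
  by (auto simp: scott_cont_def)

lemma scott_maps_iff: "f \<in> scott_maps P Q \<longleftrightarrow> f \<in> extensional (fst P) \<and> scott_cont P Q f"
  by (auto simp: scott_maps_def scott_cont_def PiE_def Pi_def)

lemma scott_cont_cong:
  assumes "\<And>x. x \<in> fst P \<Longrightarrow> f x = g x" shows "scott_cont P Q f \<longleftrightarrow> scott_cont P Q g"
proof -
  have "f ` S = g ` S" if "S \<subseteq> fst P" for S using assms that by (force intro!: image_cong)
  moreover have "x \<in> fst P" if "is_lub (fst P) (snd P) S x" for S x using that by (simp add: is_lub_def)
  ultimately show ?thesis using assms unfolding scott_cont_def by (metis order_refl)
qed

lemma restrict_scott_maps: "scott_cont P Q f \<Longrightarrow> restrict f (fst P) \<in> scott_maps P Q"
  using scott_cont_cong[of P "restrict f (fst P)" f Q] by (simp add: scott_maps_iff)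

lemma directed_nonempty: "is_directed r S \<Longrightarrow> S \<noteq> {}"
  by (simp add: is_directed_def)

lemma directed_upper: "is_directed r S \<Longrightarrow> x \<in> S \<Longrightarrow> y \<in> S \<Longrightarrow> \<exists>z\<in>S. r x z \<and> r y z"
  by (simp add: is_directed_def)

lemma lub_in: "is_lub D r S x \<Longrightarrow> x \<in> D"
  and lub_upper: "is_lub D r S x \<Longrightarrow> s \<in> S \<Longrightarrow> r s x"
  and lub_least: "is_lub D r S x \<Longrightarrow> y \<in> D \<Longrightarrow> (\<And>s. s \<in> S \<Longrightarrow> r s y) \<Longrightarrow> r x y"
  by (auto simp: is_lub_def)

lemma is_lubI: "x \<in> D \<Longrightarrow> (\<And>s. s \<in> S \<Longrightarrow> r s x) \<Longrightarrow>
    (\<And>y. y \<in> D \<Longrightarrow> (\<And>s. s \<in> S \<Longrightarrow> r s y) \<Longrightarrow> r x y) \<Longrightarrow> is_lub D r S x"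
  by (auto simp: is_lub_def)

context pcpo
begin

lemma lub_unique: "is_lub (fst P) (snd P) S x \<Longrightarrow> is_lub (fst P) (snd P) S y \<Longrightarrow> x = y"
  by (rule antisym) (auto simp: is_lub_def)

lemma scott_cont_const: "x \<in> fst P \<Longrightarrow> scott_cont Q P (\<lambda>_. x)"
  by (rule scott_contI) (auto simp: is_lub_def is_directed_def refl)

text \<open>A pair of comparable elements is directed with the larger one as its least upper bound,
  so continuity contains monotonicity.\<close>

lemma scott_cont_mono:
  assumes "scott_cont P Q f" "x \<in> fst P" "y \<in> fst P" "snd P x y" shows "snd Q (f x) (f y)"
proof -
  have "is_lub (fst P) (snd P) {x, y} y" "is_directed (snd P) {x, y}"
    using assms refl by (auto simp: is_lub_def is_directed_def)
  then show ?thesis using assms scott_contD[of P Q f "{x, y}" y] by (auto simp: is_lub_def)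
qed

lemma directed_image:
  assumes "scott_cont P Q f" "S \<subseteq> fst P" "is_directed (snd P) S" shows "is_directed (snd Q) (f ` S)"
proof -
  have mono: "snd Q (f x) (f y)" if "x \<in> S" "y \<in> S" "snd P x y" for x y
    using that assms(2) by (intro scott_cont_mono[OF assms(1)]) auto
  show ?thesis using assms(3) unfolding is_directed_def by (simp add: mono) (meson mono)
qed

lemma scott_cont_comp:
  assumes "scott_cont P Q f" "scott_cont Q R g" shows "scott_cont P R (\<lambda>x. g (f x))"
proof (rule scott_contI)
  fix S x assume S: "S \<subseteq> fst P" "is_directed (snd P) S" "is_lub (fst P) (snd P) S x"
  have "is_lub (fst R) (snd R) (g ` f ` S) (g (f x))"
    using assms S scott_cont_closed[OF assms(1)]
    by (intro scott_contD[OF assms(2)] scott_contD[OF assms(1)] directed_image) auto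
  then show "is_lub (fst R) (snd R) ((\<lambda>x. g (f x)) ` S) (g (f x))" by (simp add: image_image)
qed (use assms in \<open>auto dest: scott_cont_closed\<close>)

end

text \<open>Separate continuity gives joint continuity. By directedness a bound on the diagonal
  values \<open>h (f s) (k s)\<close> also bounds the mixed values \<open>h (f s) (k s')\<close>;
  the least upper bound is then taken in one argument at a time.\<close>

lemma scott_cont_bin:
  assumes X: "pcpo X" and P: "pcpo P" and Q: "pcpo Q" and R: "pcpo R"
    and h1: "\<And>a. a \<in> fst P \<Longrightarrow> scott_cont Q R (h a)"
    and h2: "\<And>b. b \<in> fst Q \<Longrightarrow> scott_cont P R (\<lambda>a. h a b)"
    and f: "scott_cont X P f" and k: "scott_cont X Q k"
  shows "scott_cont X R (\<lambda>x. h (f x) (k x))"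
proof (rule scott_contI)
  interpret X: pcpo X by fact
  interpret P: pcpo P by fact
  interpret Q: pcpo Q by fact
  interpret R: pcpo R by fact
  have in_R: "h a b \<in> fst R" if "a \<in> fst P" "b \<in> fst Q" for a b
    using h1[OF that(1)] that(2) by (rule scott_cont_closed)
  note fX = scott_cont_closed[OF f] and kX = scott_cont_closed[OF k]
  show "h (f x) (k x) \<in> fst R" if "x \<in> fst X" for x using that by (intro in_R fX kX)
  have mono: "snd R (h a b) (h a' b')"
    if "a \<in> fst P" "a' \<in> fst P" "b \<in> fst Q" "b' \<in> fst Q" "snd P a a'" "snd Q b b'" for a a' b b'
    using that R.trans[of "h a b" "h a' b" "h a' b'"] P.scott_cont_mono[OF h2[of b], of a a']
      Q.scott_cont_mono[OF h1[of a'], of b b'] in_R by blast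
  fix S x assume S: "S \<subseteq> fst X" "is_directed (snd X) S" "is_lub (fst X) (snd X) S x"
  have x: "x \<in> fst X" by (rule lub_in[OF S(3)])
  have flub: "is_lub (fst P) (snd P) (f ` S) (f x)" and klub: "is_lub (fst Q) (snd Q) (k ` S) (k x)"
    using S by (auto intro: scott_contD[OF f] scott_contD[OF k])
  have fdir: "is_directed (snd P) (f ` S)" and kdir: "is_directed (snd Q) (k ` S)"
    using S by (auto intro: X.directed_image[OF f] X.directed_image[OF k])
  show "is_lub (fst R) (snd R) ((\<lambda>x. h (f x) (k x)) ` S) (h (f x) (k x))"
  proof (rule is_lubI)
    show "h (f x) (k x) \<in> fst R" using x by (intro in_R fX kX)
    show "snd R s (h (f x) (k x))" if "s \<in> (\<lambda>x. h (f x) (k x)) ` S" for s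
      using that S(1) x by (auto intro!: mono fX kX lub_upper[OF flub] lub_upper[OF klub])
    fix b assume b: "b \<in> fst R" and ub: "\<And>s. s \<in> (\<lambda>x. h (f x) (k x)) ` S \<Longrightarrow> snd R s b"
    have 1: "snd R (h (f s) (k s')) b" if s: "s \<in> S" "s' \<in> S" for s s'
    proof -
      obtain z where z: "z \<in> S" "snd X s z" "snd X s' z" using directed_upper[OF S(2) s] by auto
      have "snd R (h (f s) (k s')) (h (f z) (k z))" using s z S(1)
        by (intro mono fX kX X.scott_cont_mono[OF f] X.scott_cont_mono[OF k]) auto
      moreover have "snd R (h (f z) (k z)) b" using ub z(1) by blast
      ultimately show ?thesis using s z(1) S(1) b
        by (meson R.trans in_R fX kX subsetD)
    qed
    have 2: "snd R (h (f s) (k x)) b" if s: "s \<in> S" for s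
    proof -
      have "is_lub (fst R) (snd R) (h (f s) ` k ` S) (h (f s) (k x))"
        using s S(1) by (intro scott_contD[OF h1 _ kdir klub]) (auto intro: fX kX)
      then show ?thesis by (rule lub_least[OF _ b]) (use 1 s in auto)
    qed
    have "is_lub (fst R) (snd R) ((\<lambda>a. h a (k x)) ` f ` S) (h (f x) (k x))"
      using S(1) x by (intro scott_contD[OF h2 _ fdir flub]) (auto intro: fX kX)
    then show "snd R (h (f x) (k x)) b" by (rule lub_least[OF _ b]) (use 2 in auto)
  qed
qed

context pcpo
begin

definition bot :: 'a where "bot = (SOME x. x \<in> fst P \<and> (\<forall>y\<in>fst P. snd P x y))"

lemma bot_in: "bot \<in> fst P" and bot_least: "y \<in> fst P \<Longrightarrow> snd P bot y"
  using someI_ex[of "\<lambda>x. x \<in> fst P \<and> (\<forall>y\<in>fst P. snd P x y)"] least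
  unfolding bot_def by blast+

text \<open>Kleene's construction. The last fact concerns prefixed points, which is stronger than
  the leastness in the definition and is what comparing fixed points for different parameters
  needs.\<close>

lemma least_fixpoint:
  assumes f: "scott_cont P P f"
  defines "c \<equiv> \<lambda>i. (f ^^ i) bot"
  shows iterates_in: "c i \<in> fst P" and iterates_Suc: "snd P (c i) (c (Suc i))"
    and iterates_directed: "is_directed (snd P) (range c)"
    and least_fixpoint_lub: "is_lub (fst P) (snd P) (range c) (least_fixpoint P f)"
    and least_fixpoint_in: "least_fixpoint P f \<in> fst P"
    and least_fixpoint_eq: "f (least_fixpoint P f) = least_fixpoint P f"
    and least_fixpoint_least: "z \<in> fst P \<Longrightarrow> snd P (f z) z \<Longrightarrow> snd P (least_fixpoint P f) z"
proof -
  have cS: "c (Suc i) = f (c i)" for i by (simp add: c_def)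
  show c_in: "c i \<in> fst P" for i
    by (induction i) (auto simp: c_def bot_in scott_cont_closed[OF f])
  show c_Suc: "snd P (c i) (c (Suc i))" for i
  proof (induction i)
    case 0 then show ?case using c_in[of 1] by (simp add: c_def bot_least)
  next
    case (Suc i) then show ?case
      unfolding cS[of "Suc i"] using c_in cS by (metis scott_cont_mono[OF f])
  qed
  have c_mono: "snd P (c i) (c j)" if "i \<le> j" for i j
    using that by (induction j rule: dec_induct) (auto intro: refl c_in trans[OF c_in c_in c_in _ c_Suc])
  show dir: "is_directed (snd P) (range c)"
    unfolding is_directed_def
  proof (intro conjI ballI)
    fix x y assume "x \<in> range c" "y \<in> range c"
    then obtain i j where "x = c i" "y = c j" by auto
    then show "\<exists>z\<in>range c. snd P x z \<and> snd P y z"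
      using c_mono[of i "max i j"] c_mono[of j "max i j"] by auto
  qed auto
  obtain d where d: "is_lub (fst P) (snd P) (range c) d" using directed_lub[OF _ dir] c_in by blast
  have "is_lub (fst P) (snd P) (f ` range c) (f d)"
    using c_in by (intro scott_contD[OF f _ dir d]) auto
  \<comment> \<open>Applying \<open>f\<close> drops only the initial iterate, which is the least
    element, so the bound does not change.\<close>
  moreover have "is_lub (fst P) (snd P) (f ` range c) d"
  proof (rule is_lubI)
    show "d \<in> fst P" by (rule lub_in[OF d])
    show "snd P s d" if "s \<in> f ` range c" for s using that lub_upper[OF d] by (auto simp flip: cS)
    fix y assume y: "y \<in> fst P" "\<And>s. s \<in> f ` range c \<Longrightarrow> snd P s y"
    show "snd P d y"
    proof (rule lub_least[OF d y(1)])
      fix s assume "s \<in> range c"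
      then obtain i where "s = c i" by auto
      then show "snd P s y" using y by (cases i) (auto simp: cS c_def bot_least)
    qed
  qed
  ultimately have fd: "f d = d" by (rule lub_unique)
  have dleast: "snd P d z" if z: "z \<in> fst P" "snd P (f z) z" for z
  proof (rule lub_least[OF d z(1)])
    have "snd P (c i) z" for i
    proof (induction i)
      case 0 then show ?case using z by (simp add: c_def bot_least)
    next
      case (Suc i)
      have "snd P (f (c i)) (f z)" by (rule scott_cont_mono[OF f c_in z(1) Suc])
      then show ?case unfolding cS using z c_in scott_cont_closed[OF f] trans by blast
    qed
    then show "snd P s z" if "s \<in> range c" for s using that by auto
  qed
  have lfp: "least_fixpoint P f = d"
    unfolding least_fixpoint_def
  proof (rule the_equality)
    show *: "d \<in> fst P \<and> f d = d \<and> (\<forall>y\<in>fst P. f y = y \<longrightarrow> snd P d y)"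
      using lub_in[OF d] fd dleast refl by auto
    show "x = d" if "x \<in> fst P \<and> f x = x \<and> (\<forall>y\<in>fst P. f y = y \<longrightarrow> snd P x y)" for x
      using that * antisym by blast
  qed
  show "is_lub (fst P) (snd P) (range c) (least_fixpoint P f)" using d lfp by simp
  show "least_fixpoint P f \<in> fst P" using lub_in[OF d] lfp by simp
  show "f (least_fixpoint P f) = least_fixpoint P f" using fd lfp by simp
  show "snd P (least_fixpoint P f) z" if "z \<in> fst P" "snd P (f z) z" using dleast that lfp by simp
qed

end

text \<open>Let \<open>m\<close> be the least upper bound of the fixed points along
  \<open>S\<close>. Fixed points are monotone in the parameter, so it is enough that
  \<open>m\<close> is a prefixed point of \<open>h x\<close>.\<close>

lemma scott_cont_least_fixpoint:
  assumes X: "pcpo X" and P: "pcpo P"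
    and h1: "\<And>y. y \<in> fst X \<Longrightarrow> scott_cont P P (h y)"
    and h2: "\<And>a. a \<in> fst P \<Longrightarrow> scott_cont X P (\<lambda>y. h y a)"
  shows "scott_cont X P (\<lambda>y. least_fixpoint P (h y))"
proof (rule scott_contI)
  interpret X: pcpo X by fact
  interpret P: pcpo P by fact
  let ?l = "\<lambda>y. least_fixpoint P (h y)"
  note l_in = P.least_fixpoint_in[OF h1]
  show "?l x \<in> fst P" if "x \<in> fst X" for x using that by (rule l_in)
  have mono: "snd P (?l y) (?l y')" if y: "y \<in> fst X" "y' \<in> fst X" "snd X y y'" for y y'
  proof (rule P.least_fixpoint_least[OF h1])
    have "snd P (h y (?l y')) (h y' (?l y'))"
      using y by (intro X.scott_cont_mono[OF h2]) (auto intro: l_in)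
    then show "snd P (h y (?l y')) (?l y')" using P.least_fixpoint_eq[OF h1] y by simp
  qed (use y l_in in auto)
  fix S x assume S: "S \<subseteq> fst X" "is_directed (snd X) S" "is_lub (fst X) (snd X) S x"
  have x: "x \<in> fst X" by (rule lub_in[OF S(3)])
  have dir: "is_directed (snd P) (?l ` S)"
    using S(1,2) unfolding is_directed_def by simp (meson mono subsetD)
  obtain m where m: "is_lub (fst P) (snd P) (?l ` S) m"
    using P.directed_lub[OF _ dir] S(1) l_in by blast
  have m_in: "m \<in> fst P" by (rule lub_in[OF m])
  \<comment> \<open>By continuity of \<open>h s\<close> it suffices to bound
    \<open>h s (?l s')\<close>. Raising both parameters to a common \<open>z\<close> bounds it by
    \<open>h z (?l z)\<close>, which is a fixed point again.\<close>
  have 1: "snd P (h s m) m" if s: "s \<in> S" for s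
  proof -
    have "is_lub (fst P) (snd P) (h s ` ?l ` S) (h s m)"
      using s S(1) by (intro scott_contD[OF h1 _ dir m]) (auto intro: l_in)
    then show ?thesis
    proof (rule lub_least[OF _ m_in])
      fix t assume "t \<in> h s ` ?l ` S"
      then obtain s' where s': "s' \<in> S" "t = h s (?l s')" by auto
      obtain z where z: "z \<in> S" "snd X s z" "snd X s' z" using directed_upper[OF S(2) s s'(1)] by auto
      have X: "s \<in> fst X" "s' \<in> fst X" "z \<in> fst X" using s s' z S(1) by auto
      have "snd P (h s (?l s')) (h s (?l z))"
        using X z by (intro P.scott_cont_mono[OF h1] mono l_in)
      moreover have "snd P (h s (?l z)) (h z (?l z))"
        using X z by (intro X.scott_cont_mono[OF h2] l_in)
      moreover have "h z (?l z) = ?l z" using P.least_fixpoint_eq[OF h1] X by simp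
      moreover have "snd P (?l z) m" using z by (intro lub_upper[OF m]) auto
      moreover have "h s (?l s') \<in> fst P" "h s (?l z) \<in> fst P" "?l z \<in> fst P"
        using X l_in scott_cont_closed[OF h1] by auto
      ultimately show "snd P t m" unfolding s'(2) using m_in P.trans by metis
    qed
  qed
  have "is_lub (fst P) (snd P) ((\<lambda>y. h y m) ` S) (h x m)"
    by (rule scott_contD[OF h2[OF m_in] S])
  then have "snd P (h x m) m" by (rule lub_least[OF _ m_in]) (use 1 in auto)
  then have lm: "snd P (?l x) m" by (rule P.least_fixpoint_least[OF h1[OF x] m_in])
  show "is_lub (fst P) (snd P) (?l ` S) (?l x)"
  proof (rule is_lubI)
    show "?l x \<in> fst P" using x by (rule l_in)
    show "snd P s (?l x)" if "s \<in> ?l ` S" for s using that S(1) x lub_upper[OF S(3)] mono by auto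
    fix y assume y: "y \<in> fst P" "\<And>s. s \<in> ?l ` S \<Longrightarrow> snd P s y"
    have "snd P m y" using y by (rule lub_least[OF m])
    then show "snd P (?l x) y" using lm P.trans l_in[OF x] m_in y(1) by blast
  qed
qed

text \<open>Least upper bounds commute with each other. The index set is arbitrary rather than
  directed, so this covers the join of a clause set as well as directed suprema of maps.\<close>

lemma scott_cont_pointwise_lub:
  assumes X: "pcpo X" and P: "pcpo P" and f: "\<And>i. i \<in> I \<Longrightarrow> scott_cont X P (f i)"
    and F: "\<And>x. x \<in> fst X \<Longrightarrow> is_lub (fst P) (snd P) ((\<lambda>i. f i x) ` I) (F x)"
  shows "scott_cont X P F"
proof (rule scott_contI)
  interpret X: pcpo X by fact
  interpret P: pcpo P by fact
  have f_in: "f i x \<in> fst P" if "i \<in> I" "x \<in> fst X" for i x using that by (intro scott_cont_closed[OF f])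
  have F_in: "F x \<in> fst P" if "x \<in> fst X" for x by (rule lub_in[OF F[OF that]])
  have F_le: "snd P (f i x) (F x)" if "i \<in> I" "x \<in> fst X" for i x using that by (intro lub_upper[OF F]) auto
  show "F x \<in> fst P" if "x \<in> fst X" for x using that by (rule F_in)
  fix S x assume S: "S \<subseteq> fst X" "is_directed (snd X) S" "is_lub (fst X) (snd X) S x"
  have x: "x \<in> fst X" by (rule lub_in[OF S(3)])
  show "is_lub (fst P) (snd P) (F ` S) (F x)"
  proof (rule is_lubI[OF F_in[OF x]])
    fix t assume "t \<in> F ` S"
    then obtain s where s: "s \<in> S" "t = F s" by auto
    have sX: "s \<in> fst X" using s S by auto
    show "snd P t (F x)" unfolding s(2)
    proof (rule lub_least[OF F[OF sX] F_in[OF x]])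
      fix u assume "u \<in> (\<lambda>i. f i s) ` I"
      then obtain i where i: "i \<in> I" "u = f i s" by auto
      show "snd P u (F x)" unfolding i(2)
        by (rule P.trans[OF f_in[OF i(1) sX] f_in[OF i(1) x] F_in[OF x]
          X.scott_cont_mono[OF f[OF i(1)] sX x lub_upper[OF S(3) s(1)]] F_le[OF i(1) x]])
    qed
  next
    fix y assume y: "y \<in> fst P" "\<And>t. t \<in> F ` S \<Longrightarrow> snd P t y"
    show "snd P (F x) y"
    proof (rule lub_least[OF F[OF x] y(1)])
      fix u assume "u \<in> (\<lambda>i. f i x) ` I"
      then obtain i where i: "i \<in> I" "u = f i x" by auto
      show "snd P u y" unfolding i(2)
      proof (rule lub_least[OF scott_contD[OF f[OF i(1)] S] y(1)])
        fix v assume "v \<in> f i ` S"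
        then obtain s where s: "s \<in> S" "v = f i s" by auto
        have sX: "s \<in> fst X" using s S by auto
        show "snd P v y" unfolding s(2)
          by (rule P.trans[OF f_in[OF i(1) sX] F_in[OF sX] y(1) F_le[OF i(1) sX]]) (use y(2) s in auto)
      qed
    qed
  qed
qed

text \<open>The dcpo of Scott continuous maps inside the single type \<open>sem\<close>. Injectivity
  of \<open>code\<close> makes it a faithful copy, in which \<open>dec\<close> plays the part of
  application.\<close>

locale coded_maps =
  fixes P Q :: "('m, 'd) sem poset" and code :: "('m, 'd) coding"
  assumes pcpo_P: "pcpo P" and pcpo_Q: "pcpo Q" and inj: "inj_on code (scott_maps P Q)"
begin

sublocale P: pcpo P by (rule pcpo_P)
sublocale Q: pcpo Q by (rule pcpo_Q)

abbreviation "dec \<equiv> decode code P Q"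

definition maps :: "('m, 'd) sem poset" where
  "maps = ((\<lambda>f. Fn (code f)) ` scott_maps P Q, \<lambda>x y. \<forall>a\<in>fst P. snd Q (dec x a) (dec y a))"

lemma decode_code: "f \<in> scott_maps P Q \<Longrightarrow> dec (Fn (code f)) = f"
  unfolding decode_def using inj by (intro inv_into_f_f) (auto simp: inj_on_def)

lemma code_decode: "x \<in> fst maps \<Longrightarrow> Fn (code (dec x)) = x"
  and decode_in: "x \<in> fst maps \<Longrightarrow> dec x \<in> scott_maps P Q"
  by (auto simp: maps_def decode_code)

lemma decode_cont: "x \<in> fst maps \<Longrightarrow> scott_cont P Q (dec x)"
  using decode_in by (auto simp: scott_maps_iff)

lemma code_in: "f \<in> scott_maps P Q \<Longrightarrow> Fn (code f) \<in> fst maps"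
  by (simp add: maps_def)

lemma maps_eqI:
  assumes "x \<in> fst maps" "y \<in> fst maps" "\<And>a. a \<in> fst P \<Longrightarrow> dec x a = dec y a" shows "x = y"
proof -
  have "dec x = dec y"
    using assms decode_in[OF assms(1)] decode_in[OF assms(2)]
    by (auto simp: scott_maps_iff intro: extensionalityI)
  then show ?thesis using code_decode assms(1,2) by metis
qed

lemma decode_le: "snd maps x y \<Longrightarrow> a \<in> fst P \<Longrightarrow> snd Q (dec x a) (dec y a)"
  by (simp add: maps_def)

lemma dec_fst: "x \<in> fst maps \<Longrightarrow> a \<in> fst P \<Longrightarrow> dec x a \<in> fst Q"
  by (rule scott_cont_closed[OF decode_cont])

lemma pointwise_directed:
  "is_directed (snd maps) S \<Longrightarrow> a \<in> fst P \<Longrightarrow> is_directed (snd Q) ((\<lambda>s. dec s a) ` S)"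
  unfolding is_directed_def using decode_le by fast

text \<open>Scott continuous maps are closed under pointwise directed suprema. The pointwise
  description stays in the conclusion because application has to commute with least upper bounds of
  maps.\<close>

lemma pointwise_lub:
  assumes S: "S \<subseteq> fst maps" and dir: "is_directed (snd maps) S"
  shows "\<exists>x. is_lub (fst maps) (snd maps) S x \<and>
    (\<forall>a\<in>fst P. is_lub (fst Q) (snd Q) ((\<lambda>s. dec s a) ` S) (dec x a))"
proof -
  have "\<forall>a\<in>fst P. \<exists>y. is_lub (fst Q) (snd Q) ((\<lambda>s. dec s a) ` S) y"
    using S dec_fst by (intro ballI Q.directed_lub[OF _ pointwise_directed[OF dir]]) auto
  then obtain F where F: "\<And>a. a \<in> fst P \<Longrightarrow> is_lub (fst Q) (snd Q) ((\<lambda>s. dec s a) ` S) (F a)"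
    by metis
  have F_le: "snd Q (dec s a) (F a)" if "a \<in> fst P" "s \<in> S" for a s
    using F[OF that(1)] by (rule lub_upper) (use that in auto)
  have cont: "scott_cont P Q F"
    by (rule scott_cont_pointwise_lub[OF pcpo_P pcpo_Q _ F]) (use S in \<open>auto intro: decode_cont\<close>)
  define x :: "('m, 'd) sem" where "x = Fn (code (restrict F (fst P)))"
  have x_in: "x \<in> fst maps" unfolding x_def by (intro code_in restrict_scott_maps cont)
  have dx: "dec x a = F a" if "a \<in> fst P" for a
    unfolding x_def using that by (simp add: decode_code restrict_scott_maps cont)
  have "is_lub (fst maps) (snd maps) S x"
  proof (rule is_lubI[OF x_in])
    show "snd maps s x" if "s \<in> S" for s using that F_le dx by (auto simp: maps_def)
    fix y assume y: "y \<in> fst maps" "\<And>s. s \<in> S \<Longrightarrow> snd maps s y"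
    have "snd Q (dec x a) (dec y a)" if a: "a \<in> fst P" for a
      unfolding dx[OF a] using a y(2) by (intro lub_least[OF F[OF a] dec_fst[OF y(1)]]) (auto intro: decode_le)
    then show "snd maps x y" by (simp add: maps_def)
  qed
  then show ?thesis using F dx by auto
qed

lemma pcpo_maps: "pcpo maps"
proof
  show "snd maps x x" if "x \<in> fst maps" for x
    unfolding maps_def using that dec_fst by (auto intro: Q.refl)
  show "snd maps x z" if "x \<in> fst maps" "y \<in> fst maps" "z \<in> fst maps" "snd maps x y" "snd maps y z" for x y z
    unfolding maps_def snd_conv
  proof
    fix a assume a: "a \<in> fst P"
    show "snd Q (dec x a) (dec z a)"
      by (rule Q.trans[OF dec_fst[OF that(1) a] dec_fst[OF that(2) a] dec_fst[OF that(3) a]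
        decode_le[OF that(4) a] decode_le[OF that(5) a]])
  qed
  show "x = y" if "x \<in> fst maps" "y \<in> fst maps" "snd maps x y" "snd maps y x" for x y
    by (rule maps_eqI[OF that(1,2)], rule Q.antisym)
      (simp_all add: dec_fst that decode_le[OF that(3)] decode_le[OF that(4)])
  show "\<exists>x. is_lub (fst maps) (snd maps) S x" if "S \<subseteq> fst maps" "is_directed (snd maps) S" for S
    using pointwise_lub[OF that] by blast
  let ?b = "restrict (\<lambda>_. Q.bot) (fst P)"
  have b: "?b \<in> scott_maps P Q" by (intro restrict_scott_maps Q.scott_cont_const Q.bot_in)
  show "\<exists>x\<in>fst maps. \<forall>y\<in>fst maps. snd maps x y"
  proof (intro bexI ballI)
    show "snd maps (Fn (code ?b)) y" if "y \<in> fst maps" for y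
      unfolding maps_def snd_conv using that b by (auto simp: decode_code Q.bot_least dec_fst)
  qed (rule code_in[OF b])
qed

lemma decode_lub:
  assumes "S \<subseteq> fst maps" "is_directed (snd maps) S" "is_lub (fst maps) (snd maps) S x" "a \<in> fst P"
  shows "is_lub (fst Q) (snd Q) ((\<lambda>s. dec s a) ` S) (dec x a)"
proof -
  obtain y where y: "is_lub (fst maps) (snd maps) S y"
    "\<forall>a\<in>fst P. is_lub (fst Q) (snd Q) ((\<lambda>s. dec s a) ` S) (dec y a)"
    using pointwise_lub[OF assms(1,2)] by blast
  have "x = y" by (rule pcpo.lub_unique[OF pcpo_maps assms(3) y(1)])
  then show ?thesis using y(2) assms(4) by simp
qed

lemma decode_cont_left: "a \<in> fst P \<Longrightarrow> scott_cont maps Q (\<lambda>x. dec x a)"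
  by (rule scott_contI) (auto intro: dec_fst decode_lub)

lemma decode_bot: "a \<in> fst P \<Longrightarrow> dec (pcpo.bot maps) a = Q.bot"
proof -
  assume a: "a \<in> fst P"
  interpret M: pcpo maps by (rule pcpo_maps)
  let ?b = "restrict (\<lambda>_. Q.bot) (fst P)"
  have b: "?b \<in> scott_maps P Q" by (intro restrict_scott_maps Q.scott_cont_const Q.bot_in)
  have "snd maps M.bot (Fn (code ?b))" by (intro M.bot_least code_in b)
  then have "snd Q (dec M.bot a) Q.bot" using decode_le[of _ _ a] a b by (fastforce simp: decode_code)
  then show ?thesis using a by (intro Q.antisym Q.bot_least dec_fst M.bot_in Q.bot_in)
qed

text \<open>Currying, the semantic counterpart of \<open>Lam\<close>: the order of the function
  space is pointwise, so continuity in the parameter can be checked at each argument.\<close>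

lemma cont_code:
  assumes X: "pcpo X"
    and g1: "\<And>y. y \<in> fst X \<Longrightarrow> scott_cont P Q (g y)"
    and g2: "\<And>a. a \<in> fst P \<Longrightarrow> scott_cont X Q (\<lambda>y. g y a)"
  shows "scott_cont X maps (\<lambda>y. Fn (code (restrict (g y) (fst P))))" (is "scott_cont X maps ?G")
proof -
  interpret X: pcpo X by fact
  have in_maps: "?G y \<in> fst maps" if "y \<in> fst X" for y
    using that by (intro code_in restrict_scott_maps g1)
  have dG: "dec (?G y) a = g y a" if "y \<in> fst X" "a \<in> fst P" for y a
    using that by (simp add: decode_code restrict_scott_maps g1)
  show ?thesis
  proof (rule scott_contI[OF in_maps])
    fix S x assume S: "S \<subseteq> fst X" "is_directed (snd X) S" "is_lub (fst X) (snd X) S x"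
    have x: "x \<in> fst X" by (rule lub_in[OF S(3)])
    have le_iff: "snd maps (?G y) z \<longleftrightarrow> (\<forall>a\<in>fst P. snd Q (g y a) (dec z a))" if "y \<in> fst X" for y z
      unfolding maps_def snd_conv using dG[OF that] by simp
    show "is_lub (fst maps) (snd maps) (?G ` S) (?G x)"
    proof (rule is_lubI[OF in_maps[OF x]])
      fix t assume "t \<in> ?G ` S"
      then obtain s where s: "s \<in> S" "t = ?G s" by auto
      then have sX: "s \<in> fst X" using S by auto
      have "snd Q (g s a) (g x a)" if "a \<in> fst P" for a
        using X.scott_cont_mono[OF g2[OF that] sX x lub_upper[OF S(3) s(1)]] .
      then show "snd maps t (?G x)" unfolding s(2) le_iff[OF sX] using dG[OF x] by simp
    next
      fix z assume z: "z \<in> fst maps" "\<And>s. s \<in> ?G ` S \<Longrightarrow> snd maps s z"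
      show "snd maps (?G x) z" unfolding le_iff[OF x]
      proof
        fix a assume a: "a \<in> fst P"
        show "snd Q (g x a) (dec z a)"
        proof (rule lub_least[OF scott_contD[OF g2[OF a] S] dec_fst[OF z(1) a]])
          fix t assume "t \<in> (\<lambda>y. g y a) ` S"
          then obtain s where s: "s \<in> S" "t = g s a" by auto
          then have "snd maps (?G s) z" "s \<in> fst X" using z(2)[of "?G s"] S by auto
          then show "snd Q t (dec z a)" using a le_iff s(2) by auto
        qed
      qed
    qed
  qed
qed

end

section \<open>Continuity of the tensors and colimits of chains of embeddings\<close>

lemma directed_chain:
  assumes "\<And>x. x \<in> range s \<Longrightarrow> r x x" "\<And>m n::nat. m \<le> n \<Longrightarrow> r (s m) (s n)"
  shows "is_directed r (range s)"
  unfolding is_directed_def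
proof (intro conjI ballI)
  fix x y assume "x \<in> range s" "y \<in> range s"
  then obtain m n where "x = s m" "y = s n" by auto
  then show "\<exists>z\<in>range s. r x z \<and> r y z"
    using assms(2)[of m "max m n"] assms(2)[of n "max m n"] by auto
qed auto

context inverse_category
begin

text \<open>The regularity equations of inverse semigroups: both composites are idempotent, hence
  restriction idempotents. As the equations mention no restriction, every functor preserves them and
  with them partial inverses.\<close>

lemma pinv_eqI:
  assumes t: "src C g = tgt C f" "tgt C g = src C f" and f: "f \<cdot> g \<cdot> f = f" and g: "g \<cdot> f \<cdot> g = g"
  shows "pinv C f = g"
proof -
  have *: "restr C x = y \<cdot> x"
    if "src C y = tgt C x" "tgt C y = src C x" "x \<cdot> y \<cdot> x = x" "y \<cdot> x \<cdot> y = y" for x y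
  proof -
    have e: "restr C (y \<cdot> x) = y \<cdot> x" using that by (intro idempotent_restr) simp_all
    have "restr C x = restr C (x \<cdot> restr C (y \<cdot> x))" using that by (simp add: e)
    also have "\<dots> = restr C x \<cdot> restr C (y \<cdot> x)" using that by (simp add: restr_comp_restr)
    also have "\<dots> = restr C (y \<cdot> x)" using that by (simp add: restr_comp_absorb')
    finally show ?thesis using e by simp
  qed
  show ?thesis using *[of g f] *[of f g] assms by (intro pinv_unique) simp_all
qed

lemma restr_le_idm: "le C (restr C f) (idm C (src C f))"
  by (simp add: le_iff)

end

context dcpo_join_inverse_rig_category
begin

definition homP :: "'a \<Rightarrow> 'a \<Rightarrow> 'b poset" where "homP A B = (hom C A B, le C)"

lemma homP_simps [simp]: "fst (homP A B) = hom C A B" "snd (homP A B) = le C"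
  by (simp_all add: homP_def)

lemma pcpo_homP: "pcpo (homP A B)"
proof
  show "\<exists>x\<in>fst (homP A B). \<forall>y\<in>fst (homP A B). snd (homP A B) x y"
    by (rule bexI[of _ "zero C A B"]) (auto simp: hom_iff zero_le)
  show "snd (homP A B) x z" if "x \<in> fst (homP A B)" "y \<in> fst (homP A B)" "z \<in> fst (homP A B)"
      "snd (homP A B) x y" "snd (homP A B) y z" for x y z
    using that le_trans[of x y z] by (simp add: hom_iff)
qed (auto simp: hom_iff le_refl intro: le_antisym hom_dcpo)

lemma comp_cont_right: "src C g = B \<Longrightarrow> scott_cont (homP A B) (homP A (tgt C g)) (\<lambda>f. g \<cdot> f)"
  by (rule scott_contI) (simp_all add: hom_iff comp_continuous_right[of _ A B _ g "tgt C g"])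

lemma comp_cont_left: "tgt C f = A \<Longrightarrow> scott_cont (homP A B) (homP (src C f) B) (\<lambda>g. g \<cdot> f)"
  by (rule scott_contI) (simp_all add: hom_iff comp_continuous_left[of _ A B _ f "src C f"])

lemma mult_mono_left: "src C f = src C f' \<Longrightarrow> le C f f' \<Longrightarrow> le C (f \<otimes>\<^sub>m[C] g) (f' \<otimes>\<^sub>m[C] g)"
  by (simp add: le_iff)

lemma add_mono:
  "src C f = src C f' \<Longrightarrow> le C f f' \<Longrightarrow> src C g = src C g' \<Longrightarrow> le C g g' \<Longrightarrow>
    le C (tar (add C) f g) (tar (add C) f' g')"
  by (simp add: le_iff)

lemma directed_image_hom:
  assumes "S \<subseteq> hom C A B" "is_directed (le C) S"
    "\<And>f f'. f \<in> hom C A B \<Longrightarrow> f' \<in> hom C A B \<Longrightarrow> le C f f' \<Longrightarrow> le C (F f) (F f')"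
  shows "is_directed (le C) (F ` S)"
  using assms unfolding is_directed_def by simp (meson subsetD)

text \<open>A directed set is compatible, so its least upper bound is its join, and the tensor
  preserves joins.\<close>

lemma mult_cont_left:
  "scott_cont (homP A B) (homP (A \<otimes>\<^sub>o[C] src C g) (B \<otimes>\<^sub>o[C] tgt C g)) (\<lambda>f. f \<otimes>\<^sub>m[C] g)"
proof (rule scott_contI)
  fix S x assume S: "S \<subseteq> fst (homP A B)" "is_directed (snd (homP A B)) S"
    "is_lub (fst (homP A B)) (snd (homP A B)) S x"
  then have S': "S \<subseteq> hom C A B" "is_directed (le C) S" by simp_all
  note comp = directed_compatible[OF S']
  have dir: "is_directed (le C) ((\<lambda>f. f \<otimes>\<^sub>m[C] g) ` S)"
    by (rule directed_image_hom[OF S']) (simp add: mult_mono_left hom_iff)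
  have sub: "(\<lambda>f. f \<otimes>\<^sub>m[C] g) ` S \<subseteq> hom C (A \<otimes>\<^sub>o[C] src C g) (B \<otimes>\<^sub>o[C] tgt C g)"
    using S' by (auto simp: hom_iff)
  have "Join C A B S = x" using S by (intro Join_eqI comp) simp_all
  then show "is_lub (fst (homP (A \<otimes>\<^sub>o[C] src C g) (B \<otimes>\<^sub>o[C] tgt C g)))
      (snd (homP (A \<otimes>\<^sub>o[C] src C g) (B \<otimes>\<^sub>o[C] tgt C g))) ((\<lambda>f. f \<otimes>\<^sub>m[C] g) ` S) (x \<otimes>\<^sub>m[C] g)"
    using Join_lub[OF sub directed_compatible[OF sub dir]]
      mult_Join_left[OF S'(1) comp, of g "src C g" "tgt C g"] by (simp add: hom_iff)
qed (simp add: hom_iff)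

text \<open>Joint epicity of the injections reduces the equation that defines the order to the two
  summands, and totality of the injections identifies the restrictions there with those of
  \<open>f\<close> and \<open>g\<close>.\<close>

lemma add_leI:
  assumes "src C u = tob (add C) (src C f) (src C g)" "tgt C u = tob (add C) (tgt C f) (tgt C g)"
    and l: "le C (inj_l C (tgt C f) (tgt C g) \<cdot> f) (u \<cdot> inj_l C (src C f) (src C g))"
    and r: "le C (inj_r C (tgt C f) (tgt C g) \<cdot> g) (u \<cdot> inj_r C (src C f) (src C g))"
  shows "le C (tar (add C) f g) u"
proof -
  have tl: "restr C (inj_l C (tgt C f) (tgt C g) \<cdot> f) = restr C f"
    and tr: "restr C (inj_r C (tgt C f) (tgt C g) \<cdot> g) = restr C g"
    by (simp_all add: restr_total_comp total_def)
  have "u \<cdot> tar (add C) (restr C f) (restr C g) = tar (add C) f g"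
    by (rule inj_jointly_epic[of _ "src C f" "src C g" "tob (add C) (tgt C f) (tgt C g)"])
      (use assms(1,2) l r in \<open>simp_all add: hom_iff add_comp_inj_l add_comp_inj_r le_iff tl tr\<close>)
  then show ?thesis by (simp add: le_iff)
qed

text \<open>Join preservation is an axiom for the product tensor only. For the sum, an upper bound
  is tested along the two injections, where continuity of composition applies.\<close>

lemma add_cont_left:
  "scott_cont (homP A B) (homP (tob (add C) A (src C g)) (tob (add C) B (tgt C g)))
    (\<lambda>f. tar (add C) f g)"
proof (rule scott_contI)
  fix S x assume S: "S \<subseteq> fst (homP A B)" "is_directed (snd (homP A B)) S"
    "is_lub (fst (homP A B)) (snd (homP A B)) S x"
  have Sh: "src C f = A" "tgt C f = B" if "f \<in> S" for f using that S(1) by (auto simp: hom_iff)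
  have x: "src C x = A" "tgt C x = B" using lub_in[OF S(3)] by (auto simp: hom_iff)
  obtain f0 where f0: "f0 \<in> S" using directed_nonempty[OF S(2)] by auto
  show "is_lub (fst (homP (tob (add C) A (src C g)) (tob (add C) B (tgt C g))))
      (snd (homP (tob (add C) A (src C g)) (tob (add C) B (tgt C g))))
      ((\<lambda>f. tar (add C) f g) ` S) (tar (add C) x g)"
  proof (rule is_lubI, goal_cases)
    case 1 then show ?case by (simp add: hom_iff x)
  next
    case (2 s)
    then show ?case using lub_upper[OF S(3)] Sh x by (auto intro!: add_mono le_refl)
  next
    case (3 u)
    then have u: "src C u = tob (add C) A (src C g)" "tgt C u = tob (add C) B (tgt C g)"
      and ub: "\<And>f. f \<in> S \<Longrightarrow> le C (tar (add C) f g) u" by (auto simp: hom_iff)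
    have ubl: "le C (inj_l C B (tgt C g) \<cdot> f) (u \<cdot> inj_l C A (src C g))"
      and ubr: "le C (inj_r C B (tgt C g) \<cdot> g) (u \<cdot> inj_r C A (src C g))" if f: "f \<in> S" for f
      using comp_mono_left[OF _ _ ub[OF f], of "inj_l C A (src C g)"]
        comp_mono_left[OF _ _ ub[OF f], of "inj_r C A (src C g)"] Sh[OF f] u
      by (simp_all add: add_comp_inj_l add_comp_inj_r)
    have lub: "is_lub (hom C A (tob (add C) B (tgt C g))) (le C)
        ((\<lambda>f. inj_l C B (tgt C g) \<cdot> f) ` S) (inj_l C B (tgt C g) \<cdot> x)"
      using scott_contD[OF comp_cont_right S, of "inj_l C B (tgt C g)"] by simp
    have "le C (inj_l C B (tgt C g) \<cdot> x) (u \<cdot> inj_l C A (src C g))"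
      by (rule lub_least[OF lub]) (auto simp: hom_iff u ubl)
    then have "le C (tar (add C) x g) u" using ubr[OF f0] x u by (intro add_leI) simp_all
    then show ?case by simp
  qed
qed (simp add: hom_iff)

lemma comp_cont:
  assumes "pcpo X" "scott_cont X (homP B D) g" "scott_cont X (homP A B) f"
  shows "scott_cont X (homP A D) (\<lambda>x. g x \<cdot> f x)"
proof (rule scott_cont_bin[OF assms(1) pcpo_homP pcpo_homP pcpo_homP _ _ assms(2,3)])
  show "scott_cont (homP A B) (homP A D) ((\<cdot>) a)" if "a \<in> fst (homP B D)" for a
    using comp_cont_right[of a B A] that by (simp add: hom_iff)
  show "scott_cont (homP B D) (homP A D) (\<lambda>a. a \<cdot> b)" if "b \<in> fst (homP A B)" for b
    using comp_cont_left[of b B D] that by (simp add: hom_iff)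
qed

text \<open>Continuity in the right argument is obtained from the left one by conjugating with the
  symmetry.\<close>

lemma tensor_cont:
  assumes M: "symmetric_monoidal C M"
    and left: "\<And>A B g. scott_cont (homP A B) (homP (tob M A (src C g)) (tob M B (tgt C g))) (\<lambda>f. tar M f g)"
    and X: "pcpo X" and f: "scott_cont X (homP A A') f" and g: "scott_cont X (homP B B') g"
  shows "scott_cont X (homP (tob M A B) (tob M A' B')) (\<lambda>x. tar M (f x) (g x))"
proof (rule scott_cont_bin[OF X pcpo_homP pcpo_homP pcpo_homP _ _ f g])
  interpret M: symmetric_monoidal C M by (rule M)
  note const = pcpo.scott_cont_const[OF pcpo_homP]
  show "scott_cont (homP B B') (homP (tob M A B) (tob M A' B')) (tar M a)" if "a \<in> fst (homP A A')" for a
  proof -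
    have a: "src C a = A" "tgt C a = A'" using that by (auto simp: hom_iff)
    have "scott_cont (homP B B') (homP (tob M A B) (tob M B' A')) (\<lambda>b. tar M b a \<cdot> symm M A B)"
      using left[of B B' a, unfolded a] by (rule comp_cont[OF pcpo_homP]) (auto intro!: const simp: hom_iff a)
    then have "scott_cont (homP B B') (homP (tob M A B) (tob M A' B'))
        (\<lambda>b. symm M B' A' \<cdot> tar M b a \<cdot> symm M A B)"
      by (rule comp_cont[OF pcpo_homP, rotated]) (auto intro!: const simp: hom_iff)
    moreover have "symm M B' A' \<cdot> tar M b a \<cdot> symm M A B = tar M a b" if "b \<in> fst (homP B B')" for b
    proof -
      have b: "src C b = B" "tgt C b = B'" using that by (auto simp: hom_iff)
      have "symm M B' A' \<cdot> tar M b a \<cdot> symm M A B = (symm M B' A' \<cdot> tar M b a) \<cdot> symm M A B"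
        using a b by simp
      also have "\<dots> = tar M a b \<cdot> symm M B A \<cdot> symm M A B" using M.symm_natural[of b a] a b by simp
      finally show ?thesis using a b by (simp add: M.symm_inverse)
    qed
    ultimately show ?thesis
      using scott_cont_cong[of "homP B B'" "\<lambda>b. symm M B' A' \<cdot> tar M b a \<cdot> symm M A B" "tar M a"] by blast
  qed
  show "scott_cont (homP A A') (homP (tob M A B) (tob M A' B')) (\<lambda>a. tar M a b)" if "b \<in> fst (homP B B')" for b
    using left[of A A' b] that by (simp add: hom_iff)
qed

lemmas mult_cont = tensor_cont[OF T.symmetric_monoidal_axioms mult_cont_left]
  and add_cont = tensor_cont[OF P.symmetric_monoidal_axioms add_cont_left]

end

section \<open>Colimits of chains of total maps as limits of idempotents\<close>

locale cocone_chain = dcpo_join_inverse_rig_category +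
  fixes X :: "nat \<Rightarrow> 'a" and e :: "nat \<Rightarrow> 'b" and L :: 'a and c :: "nat \<Rightarrow> 'b"
  assumes src_e [simp]: "src C (e n) = X n" and tgt_e [simp]: "tgt C (e n) = X (Suc n)"
    and src_c [simp]: "src C (c n) = X n" and tgt_c [simp]: "tgt C (c n) = L"
    and cocone: "c (Suc n) \<cdot> e n = c n"
begin

text \<open>Write \<open>c n\<close> as \<open>c (Suc n) \<cdot> e n\<close> and \<open>d n\<close>
  as \<open>d (Suc n) \<cdot> e n\<close>. Each composite is then the next one with the idempotent
  \<open>restr C (pinv C (e n))\<close> inserted, so the sequence increases.\<close>

lemma cocone_chain_mono:
  assumes d: "\<And>n. src C (d n) = X n" "\<And>n. tgt C (d n) = W" "\<And>n. d (Suc n) \<cdot> e n = d n"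
    and "m \<le> n"
  shows "le C (d m \<cdot> pinv C (c m)) (d n \<cdot> pinv C (c n))"
  using \<open>m \<le> n\<close>
proof (induction n rule: dec_induct)
  case base then show ?case by (rule le_refl)
next
  case (step n)
  have "pinv C (c n) = pinv C (c (Suc n) \<cdot> e n)" by (simp only: cocone)
  then have pc: "pinv C (c n) = pinv C (e n) \<cdot> pinv C (c (Suc n))" by (simp del: comp_pinv_self)
  have "d n \<cdot> pinv C (c n) = (d (Suc n) \<cdot> e n) \<cdot> pinv C (e n) \<cdot> pinv C (c (Suc n))"
    by (simp only: pc d(3))
  also have "\<dots> = d (Suc n) \<cdot> restr C (pinv C (e n)) \<cdot> pinv C (c (Suc n))" by (simp add: d(1,2))
  also have "le C \<dots> (d (Suc n) \<cdot> idm C (X (Suc n)) \<cdot> pinv C (c (Suc n)))"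
    using restr_le_idm[of "pinv C (e n)"]
    by (intro comp_mono_right comp_mono_left) (simp_all add: d(1,2))
  finally have "le C (d n \<cdot> pinv C (c n)) (d (Suc n) \<cdot> pinv C (c (Suc n)))" by simp
  from le_trans[OF _ _ step.IH this] show ?case by (simp add: d(1,2))
qed

lemma cocone_chain_directed:
  assumes d: "\<And>n. src C (d n) = X n" "\<And>n. tgt C (d n) = W" "\<And>n. d (Suc n) \<cdot> e n = d n"
  shows "is_directed (le C) (range (\<lambda>n. d n \<cdot> pinv C (c n)))"
  by (rule directed_chain) (auto intro: le_refl cocone_chain_mono[OF d])

text \<open>The mediating map is the limit of \<open>d n \<cdot> pinv C (c n)\<close>, a sequence
  that becomes constant from index \<open>m\<close> on when precomposed with \<open>c m\<close>. The
  premise \<open>dc\<close> holds for total legs and also for \<open>d = c\<close>, the case that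
  compares the limit of the idempotents with the identity.\<close>

lemma cocone_chain_lub:
  assumes d: "\<And>n. src C (d n) = X n" "\<And>n. tgt C (d n) = W" "\<And>n. d (Suc n) \<cdot> e n = d n"
    and dc: "\<And>n. (d n \<cdot> pinv C (c n)) \<cdot> c n = d n"
  shows "\<exists>u. is_lub (hom C L W) (le C) (range (\<lambda>n. d n \<cdot> pinv C (c n))) u \<and> (\<forall>n. u \<cdot> c n = d n)"
proof -
  let ?s = "\<lambda>n. d n \<cdot> pinv C (c n)"
  have sub: "range ?s \<subseteq> hom C L W" by (auto simp: hom_iff d)
  note dir = cocone_chain_directed[OF d]
  obtain u where u: "is_lub (hom C L W) (le C) (range ?s) u" using hom_dcpo[OF sub dir] by auto
  have below: "?s n \<cdot> c m = d m" if "m \<le> n" for m n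
    using that
  proof (induction m rule: inc_induct)
    case base
    show ?case by (rule dc)
  next
    case (step m)
    have "?s n \<cdot> c m = ?s n \<cdot> c (Suc m) \<cdot> e m" by (simp only: cocone)
    also have "\<dots> = (?s n \<cdot> c (Suc m)) \<cdot> e m" by (simp add: d)
    also have "\<dots> = d m" by (simp only: step.IH d(3))
    finally show ?case .
  qed
  have "u \<cdot> c m = d m" for m
  proof (rule lub_unique)
    show "is_lub (hom C (X m) W) (le C) ((\<lambda>s. s \<cdot> c m) ` range ?s) (u \<cdot> c m)"
      by (rule comp_continuous_left[OF sub dir u]) (simp add: hom_iff)
    show "is_lub (hom C (X m) W) (le C) ((\<lambda>s. s \<cdot> c m) ` range ?s) (d m)"
    proof (rule is_lubI)
      show "d m \<in> hom C (X m) W" by (simp add: hom_iff d)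
      fix t assume "t \<in> (\<lambda>s. s \<cdot> c m) ` range ?s"
      then obtain n where n: "t = ?s n \<cdot> c m" by auto
      have "le C (?s n \<cdot> c m) (?s (max m n) \<cdot> c m)"
        by (intro comp_mono_left cocone_chain_mono[OF d]) (simp_all add: d)
      then show "le C t (d m)" using below[of m "max m n"] by (simp only: n max.cobounded1)
    next
      fix y assume ub: "\<And>s. s \<in> (\<lambda>s. s \<cdot> c m) ` range ?s \<Longrightarrow> le C s y"
      have "le C (?s m \<cdot> c m) y" by (rule ub) blast
      then show "le C (d m) y" by (simp only: below[OF order_refl])
    qed
  qed
  then show ?thesis using u by blast
qed

end

text \<open>
  Embeddings are exactly the total maps, with the partial inverse as projection, so a cocone is
  colimiting as soon as the idempotents of its total legs have the identity as least upper bound.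
\<close>

locale chain_cocone = cocone_chain +
  assumes total_c: "total (c n)"
    and lub_idm: "is_lub (hom C L L) (le C) (range (\<lambda>n. c n \<cdot> pinv C (c n))) (idm C L)"
begin

text \<open>By continuity \<open>u\<close> is the least upper bound of
  \<open>u \<cdot> c n \<cdot> pinv C (c n)\<close>, which depends only on the composites of
  \<open>u\<close> with the legs.\<close>

lemma jointly_epic:
  assumes "src C u = L" "src C v = L" "tgt C u = tgt C v" "\<And>n. u \<cdot> c n = v \<cdot> c n"
  shows "u = v"
proof -
  have lub: "is_lub (hom C L (tgt C w)) (le C) ((\<lambda>s. w \<cdot> s) ` range (\<lambda>n. c n \<cdot> pinv C (c n))) w"
    if "src C w = L" for w
  proof -
    have "is_lub (hom C L (tgt C w)) (le C) ((\<lambda>s. w \<cdot> s) ` range (\<lambda>n. c n \<cdot> pinv C (c n))) (w \<cdot> idm C L)"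
      by (rule comp_continuous_right[OF _ cocone_chain_directed[of c L] lub_idm])
        (use that in \<open>auto simp: hom_iff cocone simp del: comp_pinv_self\<close>)
    then show ?thesis using that by simp
  qed
  have "u \<cdot> c n \<cdot> pinv C (c n) = v \<cdot> c n \<cdot> pinv C (c n)" for n
    using assms(4)[of n] assms(1,2) assoc[of "pinv C (c n)" "c n" u] assoc[of "pinv C (c n)" "c n" v]
    by (simp del: comp_pinv_self comp_pinv_reassoc)
  then have "(\<lambda>s. u \<cdot> s) ` range (\<lambda>n. c n \<cdot> pinv C (c n)) =
      (\<lambda>s. v \<cdot> s) ` range (\<lambda>n. c n \<cdot> pinv C (c n))" by (simp only: image_image)
  then show ?thesis using lub[of u] lub[of v] assms(1-3) by (simp add: lub_unique)
qed

lemma mediating: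
  assumes "\<And>n. src C (d n) = X n" "\<And>n. tgt C (d n) = W" "\<And>n. d (Suc n) \<cdot> e n = d n"
  shows "\<exists>u. u \<in> hom C L W \<and> (\<forall>n. u \<cdot> c n = d n)"
proof -
  have "(d n \<cdot> pinv C (c n)) \<cdot> c n = d n" for n using total_c[of n] by (simp add: total_def assms(1,2))
  from cocone_chain_lub[OF assms this] obtain u where
    u: "is_lub (hom C L W) (le C) (range (\<lambda>n. d n \<cdot> pinv C (c n))) u" "\<forall>n. u \<cdot> c n = d n" by (elim exE conjE)
  then show ?thesis using lub_in[OF u(1)] by (intro exI conjI)
qed

end

context dcpo_join_inverse_rig_category
begin

text \<open>The universal property is used twice. A cocone into \<open>X n\<close> whose leg at
  \<open>n\<close> is the identity gives \<open>c n\<close> a left inverse, hence makes it total.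
  Uniqueness for the cocone \<open>c\<close> itself identifies the limit of the idempotents with the
  identity.\<close>

lemma colimit_chain_cocone:
  assumes e: "\<And>n. src C (e n) = X n" "\<And>n. tgt C (e n) = X (Suc n)" "\<And>n. total (e n)"
  shows "\<exists>L c. chain_cocone C X e L c"
proof -
  have ed: "pinv C (e m) \<cdot> e m = idm C (X m)" for m using e(1,3)[of m] by (simp add: total_def)
  obtain L c where L: "omega_colimit C X e L c"
    using omega_colimits[of e X] total_embedding e by (auto simp: hom_iff)
  then have c: "src C (c n) = X n" "tgt C (c n) = L" "c (Suc n) \<cdot> e n = c n" for n
    by (auto simp: omega_colimit_def omega_cocone_def hom_iff)
  have univ: "\<exists>!u. u \<in> hom C L Y \<and> (\<forall>n. u \<cdot> c n = d n)"
    if "\<And>n. src C (d n) = X n" "\<And>n. tgt C (d n) = Y" "\<And>n. d (Suc n) \<cdot> e n = d n" for Y d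
    using L that by (simp add: omega_colimit_def omega_cocone_def hom_iff)
  have total_c: "total (c n)" for n
  proof -
    \<comment> \<open>Legs of a cocone with vertex \<open>X n\<close>: stages above \<open>n\<close>
      are projected down by the partial inverses of the links, stages below are carried up by the
      links, and stage \<open>n\<close> gets the identity.\<close>
    define down where "down = rec_nat (idm C (X n)) (\<lambda>k f. f \<cdot> pinv C (e (n + k)))"
    define up where "up = rec_nat (idm C (X n)) (\<lambda>k f. f \<cdot> e (n - Suc k))"
    have down: "down 0 = idm C (X n)" "\<And>k. down (Suc k) = down k \<cdot> pinv C (e (n + k))"
      by (simp_all add: down_def)
    have up: "up 0 = idm C (X n)" "\<And>k. up (Suc k) = up k \<cdot> e (n - Suc k)"
      by (simp_all add: up_def)
    have down_t: "src C (down k) = X (n + k) \<and> tgt C (down k) = X n" for k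
      by (induction k) (simp_all add: down e)
    have up_t: "src C (up k) = X (n - k) \<and> tgt C (up k) = X n" if "k \<le> n" for k
      using that by (induction k) (simp_all add: up e Suc_diff_Suc)
    define d where "d m = (if n \<le> m then down (m - n) else up (n - m))" for m
    have "d (Suc m) \<cdot> e m = d m" for m
    proof (cases "n \<le> m")
      case True
      then have "d (Suc m) = down (m - n) \<cdot> pinv C (e m)" by (simp add: d_def Suc_diff_le down)
      then have "d (Suc m) \<cdot> e m = down (m - n) \<cdot> (pinv C (e m) \<cdot> e m)"
        using True by (simp add: e down_t)
      then show ?thesis using True down_t[of "m - n"] unfolding ed by (simp add: d_def)
    next
      case False
      then have "d (Suc m) = up (n - Suc m)" by (auto simp: d_def up down)
      moreover have "d m = up (Suc (n - Suc m))" using False by (simp add: d_def Suc_diff_Suc)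
      moreover have "n - Suc (n - Suc m) = m" using False by simp
      ultimately show ?thesis by (simp add: up)
    qed
    note dc = this
    have dt: "src C (d m) = X m" "tgt C (d m) = X n" for m
      using down_t[of "m - n"] up_t[of "n - m"] by (simp_all add: d_def)
    obtain u where "u \<in> hom C L (X n)" "u \<cdot> c n = d n"
      using univ[OF dt dc] by blast
    moreover have "d n = idm C (X n)" by (simp add: d_def down)
    ultimately show ?thesis by (intro total_comp_right[of "c n" u]) (simp_all add: hom_iff c(1,2))
  qed
  interpret cocone_chain C X e L c by unfold_locales (simp_all only: e c)
  obtain u where u: "is_lub (hom C L L) (le C) (range (\<lambda>n. c n \<cdot> pinv C (c n))) u"
    and uc: "\<And>n. u \<cdot> c n = c n"
    using cocone_chain_lub[OF c] by auto
  have "idm C L \<cdot> c m = c m" for m by (simp add: c(2))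
  then have "u = idm C L"
    using univ[OF c] lub_in[OF u] idm_hom[of L] uc by blast
  then have "chain_cocone C X e L c" using u c e total_c by unfold_locales simp_all
  then show ?thesis by blast
qed

end

text \<open>Continuity is stated for endomorphisms because it is applied to the idempotents of a
  cocone, whose limit is the identity.\<close>

locale continuous_endofunctor = dcpo_join_inverse_rig_category +
  fixes Fo :: "'a \<Rightarrow> 'a" and Fa :: "'b \<Rightarrow> 'b"
  assumes src_Fa [simp]: "src C (Fa f) = Fo (src C f)" and tgt_Fa [simp]: "tgt C (Fa f) = Fo (tgt C f)"
    and Fa_idm [simp]: "Fa (idm C A) = idm C (Fo A)"
    and Fa_comp: "tgt C f = src C g \<Longrightarrow> Fa (g \<cdot> f) = Fa g \<cdot> Fa f"
    and Fa_cont: "scott_cont (homP A A) (homP (Fo A) (Fo A)) Fa"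
begin

lemma pinv_Fa [simp]: "pinv C (Fa f) = Fa (pinv C f)"
proof (rule pinv_eqI)
  show "Fa f \<cdot> Fa (pinv C f) \<cdot> Fa f = Fa f" "Fa (pinv C f) \<cdot> Fa f \<cdot> Fa (pinv C f) = Fa (pinv C f)"
    by (simp_all flip: Fa_comp)
qed simp_all

text \<open>A total map has its partial inverse as a left inverse, and functors preserve left
  inverses.\<close>

lemma total_Fa: "total f \<Longrightarrow> total (Fa f)"
proof -
  assume "total f"
  then have "Fa (pinv C f) \<cdot> Fa f = idm C (Fo (src C f))" by (simp add: total_def flip: Fa_comp)
  then show ?thesis using total_comp_right[of "Fa f" "Fa (pinv C f)"] by simp
qed

text \<open>The colimit of the iterates on the zero object. Continuity makes the image of the
  colimiting cocone a \<open>chain_cocone\<close> again, hence a colimit of the shifted chain, and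
  the structure map mediates between the two.\<close>

lemma ex_initial_algebra: "\<exists>Ma. initial_algebra C Fo Fa Ma"
proof -
  let ?Z = "zero_ob C"
  define X where "X n = (Fo ^^ n) ?Z" for n
  \<comment> \<open>The initial link leaves the zero object, whose identity is itself a zero map;
    this makes the link total.\<close>
  define e where "e n = (Fa ^^ n) (zero C ?Z (Fo ?Z))" for n
  have X: "X 0 = ?Z" "X (Suc n) = Fo (X n)" for n by (simp_all add: X_def)
  have eS: "e (Suc n) = Fa (e n)" for n by (simp add: e_def)
  have e: "src C (e n) = X n \<and> tgt C (e n) = X (Suc n) \<and> total (e n)" for n
  proof (induction n)
    case 0
    show ?case using to_zero_ob[of "idm C ?Z"] by (simp add: e_def X_def total_def)
  next
    case (Suc n) then show ?case by (simp add: eS X total_Fa)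
  qed
  obtain L c where "chain_cocone C X e L c" using colimit_chain_cocone[of e X] e by auto
  then interpret c: chain_cocone C X e L c .
  let ?r = "\<lambda>n. c n \<cdot> pinv C (c n)"
  have Fr: "Fa (?r n) = Fa (c n) \<cdot> pinv C (Fa (c n))" for n
    by (simp only: pinv_Fa) (simp add: Fa_comp del: comp_pinv_self)
  have "range ?r \<subseteq> hom C L L" by (auto simp: hom_iff simp del: comp_pinv_self)
  then have "is_lub (hom C (Fo L) (Fo L)) (le C) (Fa ` range ?r) (Fa (idm C L))"
    using scott_contD[OF Fa_cont, of "range ?r" L "idm C L"]
      c.cocone_chain_directed[of c L] c.lub_idm c.cocone
    by (simp del: comp_pinv_self)
  then have lub: "is_lub (hom C (Fo L) (Fo L)) (le C)
      (range (\<lambda>n. Fa (c n) \<cdot> pinv C (Fa (c n)))) (idm C (Fo L))"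
    by (simp only: image_image Fr) simp
  interpret Fc: chain_cocone C "\<lambda>n. X (Suc n)" "\<lambda>n. Fa (e n)" "Fo L" "\<lambda>n. Fa (c n)"
    using lub c.total_c by unfold_locales (simp_all add: X c.cocone total_Fa e flip: Fa_comp)
  have "c (Suc (Suc n)) \<cdot> Fa (e n) = c (Suc n)" for n using c.cocone[of "Suc n"] by (simp add: eS)
  then obtain a where a: "a \<in> hom C (Fo L) L" "\<And>n. a \<cdot> Fa (c n) = c (Suc n)"
    using Fc.mediating[of "\<lambda>n. c (Suc n)" L] by auto
  have at: "src C a = Fo L" "tgt C a = L" using a(1) by (auto simp: hom_iff)
  have "\<exists>!h. h \<in> hom C L Y \<and> h \<cdot> a = b \<cdot> Fa h" if "b \<in> hom C (Fo Y) Y" for Y b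
  proof -
    have b: "src C b = Fo Y" "tgt C b = Y" using that by (auto simp: hom_iff)
    \<comment> \<open>The cocone induced by the algebra \<open>b\<close>. Every algebra morphism
      satisfies this recursion on the legs, so it yields existence as well as uniqueness.\<close>
    define d where "d = rec_nat (zero C ?Z Y) (\<lambda>_ f. b \<cdot> Fa f)"
    have d: "d 0 = zero C ?Z Y" "d (Suc n) = b \<cdot> Fa (d n)" for n by (simp_all add: d_def)
    have dt: "src C (d n) = X n \<and> tgt C (d n) = Y" for n
      by (induction n) (simp_all add: d X b)
    have dc: "d (Suc n) \<cdot> e n = d n" for n
    proof (induction n)
      case 0
      show ?case using from_zero_ob[of "d (Suc 0) \<cdot> e 0"] dt[of "Suc 0"] e[of 0] by (simp add: d X)
    next
      case (Suc n)
      have "d (Suc (Suc n)) \<cdot> e (Suc n) = b \<cdot> Fa (d (Suc n) \<cdot> e n)"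
        using dt e b by (simp add: d(2)[of "Suc n"] eS Fa_comp X)
      also have "\<dots> = d (Suc n)" by (simp only: Suc) (simp only: d(2))
      finally show ?case .
    qed
    obtain h where h: "h \<in> hom C L Y" "\<And>n. h \<cdot> c n = d n"
      using c.mediating[of d Y] dt dc by auto
    have ht: "src C h = L" "tgt C h = Y" using h(1) by (auto simp: hom_iff)
    have "h \<cdot> a = b \<cdot> Fa h"
    proof (rule Fc.jointly_epic)
      fix n
      have "(h \<cdot> a) \<cdot> Fa (c n) = h \<cdot> a \<cdot> Fa (c n)" by (simp add: ht at)
      also have "\<dots> = b \<cdot> Fa (h \<cdot> c n)" by (simp only: a h d)
      also have "\<dots> = (b \<cdot> Fa h) \<cdot> Fa (c n)" by (simp add: Fa_comp ht b)
      finally show "(h \<cdot> a) \<cdot> Fa (c n) = (b \<cdot> Fa h) \<cdot> Fa (c n)" .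
    qed (simp_all add: ht at b)
    moreover have "h' = h" if h': "h' \<in> hom C L Y" "h' \<cdot> a = b \<cdot> Fa h'" for h'
    proof (rule c.jointly_epic)
      have ht': "src C h' = L" "tgt C h' = Y" using h'(1) by (auto simp: hom_iff)
      show "h' \<cdot> c n = h \<cdot> c n" for n
      proof (induction n)
        case 0
        show ?case using from_zero_ob[of "h' \<cdot> c 0"] from_zero_ob[of "h \<cdot> c 0"] ht ht' by (simp add: X)
      next
        case (Suc n)
        have "h' \<cdot> c (Suc n) = h' \<cdot> a \<cdot> Fa (c n)" by (simp only: a)
        also have "\<dots> = (h' \<cdot> a) \<cdot> Fa (c n)" by (simp add: ht' at)
        also have "\<dots> = b \<cdot> Fa (h' \<cdot> c n)" unfolding h'(2) by (simp add: ht' b Fa_comp)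
        also have "\<dots> = h \<cdot> c (Suc n)" unfolding Suc h(2) d(2) ..
        finally show ?case .
      qed
      show "src C h' = L" "src C h = L" "tgt C h' = tgt C h" using ht ht' by simp_all
    qed
    ultimately show ?thesis using h(1) by blast
  qed
  then show ?thesis using a(1) unfolding initial_algebra_def by blast
qed

lemma initial_algebra_mu: "initial_algebra C Fo Fa (mu_ob C Fo Fa, mu_in C Fo Fa)"
  unfolding mu_ob_def mu_in_def using someI_ex[OF ex_initial_algebra] by simp

lemma src_mu_in [simp]: "src C (mu_in C Fo Fa) = Fo (mu_ob C Fo Fa)"
  and tgt_mu_in [simp]: "tgt C (mu_in C Fo Fa) = mu_ob C Fo Fa"
  using initial_algebra_mu by (simp_all add: initial_algebra_def hom_iff)

lemma mu_ex1: "src C b = Fo X \<Longrightarrow> tgt C b = X \<Longrightarrow>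
    \<exists>!h. h \<in> hom C (mu_ob C Fo Fa) X \<and> h \<cdot> mu_in C Fo Fa = b \<cdot> Fa h"
  using initial_algebra_mu by (simp add: initial_algebra_def hom_iff)

lemma mu_unique:
  assumes "src C b = Fo (tgt C b)" "src C h = mu_ob C Fo Fa" "src C h' = mu_ob C Fo Fa"
    "tgt C h = tgt C b" "tgt C h' = tgt C b"
    "h \<cdot> mu_in C Fo Fa = b \<cdot> Fa h" "h' \<cdot> mu_in C Fo Fa = b \<cdot> Fa h'"
  shows "h = h'"
proof -
  have "h \<in> hom C (mu_ob C Fo Fa) (tgt C b)" "h' \<in> hom C (mu_ob C Fo Fa) (tgt C b)"
    using assms by (simp_all add: hom_iff)
  then show ?thesis using mu_ex1[OF assms(1) refl] assms(6,7) by blast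
qed

text \<open>Lambek's argument: initiality gives a map \<open>h\<close> into the algebra
  \<open>Fa ?a\<close>, and \<open>?a \<cdot> h\<close> is an algebra endomorphism of the initial
  algebra.\<close>

lemma is_iso_mu_in: "is_iso C (mu_in C Fo Fa)"
proof -
  let ?M = "mu_ob C Fo Fa" and ?a = "mu_in C Fo Fa"
  obtain h where h: "h \<in> hom C ?M (Fo ?M)" "h \<cdot> ?a = Fa ?a \<cdot> Fa h"
    using mu_ex1[of "Fa ?a" "Fo ?M"] by auto
  have ht: "src C h = ?M" "tgt C h = Fo ?M" using h(1) by (auto simp: hom_iff)
  have "(?a \<cdot> h) \<cdot> ?a = ?a \<cdot> Fa (?a \<cdot> h)" using ht h(2) by (simp add: Fa_comp)
  then have "?a \<cdot> h = idm C ?M"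
    by - (rule mu_unique[of ?a], simp_all add: ht)
  moreover from this have "h \<cdot> ?a = idm C (Fo ?M)"
    unfolding h(2) using ht by (simp flip: Fa_comp)
  ultimately show ?thesis unfolding is_iso_iff using ht by auto
qed

end

section \<open>Types as functors\<close>

lemma scott_cont_id: "scott_cont P P (\<lambda>x. x)"
  by (rule scott_contI) simp_all

context dcpo_join_inverse_rig_category
begin

text \<open>The invariant of the induction over types. Continuity is joint in all entries of the
  environment, along a parameter poset \<open>X\<close>, because the \<open>Mu\<close> case takes a
  fixed point in one entry while the others vary. A formula fixes the type of \<open>X\<close>; the
  induction only uses the given \<open>X\<close> and hom-sets, so morphisms serve as its
  elements.\<close>

definition functorial :: "ty \<Rightarrow> bool" where
  "functorial A \<longleftrightarrow>
     (\<forall>f. src C (ty_ar C A f) = ty_ob C A (\<lambda>n. src C (f n)) \<and>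
        tgt C (ty_ar C A f) = ty_ob C A (\<lambda>n. tgt C (f n))) \<and>
     (\<forall>\<rho>. ty_ar C A (\<lambda>n. idm C (\<rho> n)) = idm C (ty_ob C A \<rho>)) \<and>
     (\<forall>f g. (\<forall>n. tgt C (f n) = src C (g n)) \<longrightarrow>
        ty_ar C A (\<lambda>n. g n \<cdot> f n) = ty_ar C A g \<cdot> ty_ar C A f) \<and>
     (\<forall>X F \<rho> \<rho>'. pcpo (X :: 'b poset) \<longrightarrow> (\<forall>n. scott_cont X (homP (\<rho> n) (\<rho>' n)) (F n)) \<longrightarrow>
        scott_cont X (homP (ty_ob C A \<rho>) (ty_ob C A \<rho>')) (\<lambda>x. ty_ar C A (\<lambda>n. F n x)))"

lemma case_nat_comp: "(\<lambda>n. h (case_nat x f n)) = case_nat (h x) (\<lambda>n. h (f n))"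
  by (auto split: nat.split)

lemma case_nat_comp2: "(\<lambda>n. h (case_nat x f n) (case_nat y g n)) = case_nat (h x y) (\<lambda>n. h (f n) (g n))"
  by (auto split: nat.split)

lemma case_nat_app: "(\<lambda>n. case_nat f g n x) = case_nat (f x) (\<lambda>n. g n x)"
  by (auto split: nat.split)

abbreviation "ob A \<rho> \<equiv> \<lambda>Y. ty_ob C A (case_nat Y \<rho>)"
abbreviation "ar A \<rho> \<equiv> \<lambda>h. ty_ar C A (case_nat h (\<lambda>n. idm C (\<rho> n)))"
abbreviation "inn A \<rho> \<equiv> mu_in C (ob A \<rho>) (ar A \<rho>)"

lemma functorial_endofunctor:
  assumes "functorial A" shows "continuous_endofunctor C (ob A \<rho>) (ar A \<rho>)"
proof -
  note F = assms[unfolded functorial_def]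
  show ?thesis
  proof unfold_locales
    show "src C (ar A \<rho> f) = ob A \<rho> (src C f)" for f
      using F by (simp add: case_nat_comp cong del: nat.case_cong_weak)
    show "tgt C (ar A \<rho> f) = ob A \<rho> (tgt C f)" for f
      using F by (simp add: case_nat_comp cong del: nat.case_cong_weak)
    have "(\<lambda>n. idm C (case_nat Y \<rho> n)) = case_nat (idm C Y) (\<lambda>n. idm C (\<rho> n))" for Y
      by (rule case_nat_comp)
    then show "ar A \<rho> (idm C Y) = idm C (ob A \<rho> Y)" for Y using F by metis
    show "ar A \<rho> (g \<cdot> f) = ar A \<rho> g \<cdot> ar A \<rho> f" if "tgt C f = src C g" for f g
    proof -
      have "ty_ar C A (\<lambda>n. case_nat g (\<lambda>n. idm C (\<rho> n)) n \<cdot> case_nat f (\<lambda>n. idm C (\<rho> n)) n) =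
          ar A \<rho> g \<cdot> ar A \<rho> f"
        using F that by (simp split: nat.split)
      then show ?thesis by (simp add: case_nat_comp2 cong del: nat.case_cong_weak)
    qed
    show "scott_cont (homP Y Y) (homP (ob A \<rho> Y) (ob A \<rho> Y)) (ar A \<rho>)" for Y
    proof -
      interpret Y: pcpo "homP Y Y" by (rule pcpo_homP)
      have "scott_cont (homP Y Y) (homP (case_nat Y \<rho> n) (case_nat Y \<rho> n))
          (case_nat (\<lambda>h. h) (\<lambda>n _. idm C (\<rho> n)) n)" for n
        by (cases n) (auto intro!: pcpo.scott_cont_const[OF pcpo_homP] scott_cont_id simp: hom_iff)
      then have "scott_cont (homP Y Y) (homP (ob A \<rho> Y) (ob A \<rho> Y))
          (\<lambda>x. ty_ar C A (\<lambda>n. case_nat (\<lambda>h. h) (\<lambda>n _. idm C (\<rho> n)) n x))"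
        using F pcpo_homP by blast
      then show ?thesis by (simp only: case_nat_app)
    qed
  qed
qed

text \<open>The equation for the action \<open>k\<close> on \<open>f\<close> has \<open>k\<close>
  under \<open>A\<close> as well. Splitting \<open>A(k, f)\<close> as \<open>A(id, f)\<close> after
  \<open>A(k, id)\<close> turns it into the equation for the algebra
  \<open>inn \<cdot> A(id, f)\<close>, which initiality solves uniquely; identities and composites
  follow from uniqueness. For continuity the solution is rewritten as a least fixed point depending
  on a parameter.\<close>

lemma functorial_Mu:
  assumes A: "functorial A" shows "functorial (Mu A)"
proof -
  interpret E: continuous_endofunctor C "ob A \<rho>" "ar A \<rho>" for \<rho>
    by (rule functorial_endofunctor[OF A])
  note F = A[unfolded functorial_def]
  let ?M = "\<lambda>\<rho>. ty_ob C (Mu A) \<rho>" and ?s = "\<lambda>f n. src C (f n)" and ?t = "\<lambda>f n. tgt C (f n)"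
  have case_ar: "ty_ar C A (case_nat h f) = ty_ar C A (case_nat (idm C (tgt C h)) f) \<cdot> ar A (?s f) h"
    for h f
  proof -
    have "ty_ar C A (\<lambda>n. case_nat (idm C (tgt C h)) f n \<cdot> case_nat h (\<lambda>n. idm C (src C (f n))) n) =
        ty_ar C A (case_nat (idm C (tgt C h)) f) \<cdot> ar A (?s f) h"
      using F by (simp split: nat.split)
    then show ?thesis by (simp add: case_nat_comp2 cong del: nat.case_cong_weak)
  qed
  have case_t: "src C (ty_ar C A (case_nat h f)) = ob A (?s f) (src C h)"
    "tgt C (ty_ar C A (case_nat h f)) = ob A (?t f) (tgt C h)" for h f
    using F by (simp_all add: case_nat_comp)
  have case_comp: "ty_ar C A (case_nat (h' \<cdot> h) (\<lambda>n. f' n \<cdot> f n)) = ty_ar C A (case_nat h' f') \<cdot> ty_ar C A (case_nat h f)"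
    if "tgt C h = src C h'" "\<And>n. tgt C (f n) = src C (f' n)" for h h' f f'
  proof -
    have "ty_ar C A (\<lambda>n. case_nat h' f' n \<cdot> case_nat h f n) = ty_ar C A (case_nat h' f') \<cdot> ty_ar C A (case_nat h f)"
      using F that by (simp split: nat.split)
    then show ?thesis by (simp add: case_nat_comp2)
  qed
  have M: "?M \<rho> = mu_ob C (ob A \<rho>) (ar A \<rho>)" for \<rho> by simp
  let ?solves = "\<lambda>f k. src C k = ?M (?s f) \<and> tgt C k = ?M (?t f) \<and>
      k \<cdot> inn A (?s f) = inn A (?t f) \<cdot> ty_ar C A (case_nat k f)"
  have step: "inn A (?t f) \<cdot> ty_ar C A (case_nat k f) =
      (inn A (?t f) \<cdot> ty_ar C A (case_nat (idm C (?M (?t f))) f)) \<cdot> ar A (?s f) k"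
    if "tgt C k = ?M (?t f)" for k f
    unfolding case_ar[of k f] using that by (simp add: case_t)
  have solution_ex: "\<exists>k. ?solves f k" for f
  proof -
    let ?b = "inn A (?t f) \<cdot> ty_ar C A (case_nat (idm C (?M (?t f))) f)"
    have b: "src C ?b = ob A (?s f) (?M (?t f))" "tgt C ?b = ?M (?t f)" by (simp_all add: case_t)
    obtain k where k: "k \<in> hom C (mu_ob C (ob A (?s f)) (ar A (?s f))) (?M (?t f))"
      "k \<cdot> inn A (?s f) = ?b \<cdot> ar A (?s f) k"
      using E.mu_ex1[OF b] by blast
    then have "src C k = ?M (?s f)" "tgt C k = ?M (?t f)" by (simp_all add: hom_iff)
    then show ?thesis using k(2) step[of k f] by metis
  qed
  have solution_eq: "k = k'" if "?solves f k" "?solves f k'" for f k k'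
    by (rule E.mu_unique[of "inn A (?t f) \<cdot> ty_ar C A (case_nat (idm C (?M (?t f))) f)" "?s f"])
      (use that step[of k f] step[of k' f] in \<open>simp_all add: case_t\<close>)
  have ar_Mu: "?solves f (ty_ar C (Mu A) f)" for f
  proof -
    have "ty_ar C (Mu A) f = (THE k. ?solves f k)"
      by (simp add: Let_def hom_iff conj_assoc)
    moreover have "\<exists>!k. ?solves f k" using solution_ex[of f] solution_eq[of _ f] by blast
    ultimately show ?thesis using theI'[of "?solves f"] by simp
  qed
  have eq_Mu: "ty_ar C (Mu A) f = k" if "?solves f k" for f k
    using solution_eq[of _ f] ar_Mu that by blast
  show ?thesis unfolding functorial_def
  proof (intro conjI allI impI)
    show "src C (ty_ar C (Mu A) f) = ?M (?s f)" "tgt C (ty_ar C (Mu A) f) = ?M (?t f)" for f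
      using ar_Mu[of f] by blast+
    show "ty_ar C (Mu A) (\<lambda>n. idm C (\<rho> n)) = idm C (?M \<rho>)" for \<rho>
      by (rule eq_Mu) simp
    show "ty_ar C (Mu A) (\<lambda>n. g n \<cdot> f n) = ty_ar C (Mu A) g \<cdot> ty_ar C (Mu A) f"
      if t: "\<forall>n. tgt C (f n) = src C (g n)" for f g
    proof (rule eq_Mu)
      define k where "k = ty_ar C (Mu A) f"
      define l where "l = ty_ar C (Mu A) g"
      have k: "src C k = ?M (?s f)" "tgt C k = ?M (?s g)"
          "k \<cdot> inn A (?s f) = inn A (?s g) \<cdot> ty_ar C A (case_nat k f)"
        and l: "src C l = ?M (?s g)" "tgt C l = ?M (?t g)"
          "l \<cdot> inn A (?s g) = inn A (?t g) \<cdot> ty_ar C A (case_nat l g)"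
        using ar_Mu[of f] ar_Mu[of g] t unfolding k_def l_def
        by (simp_all del: ty_ob.simps ty_ar.simps cong del: nat.case_cong_weak)
      have "(l \<cdot> k) \<cdot> inn A (?s f) = l \<cdot> (k \<cdot> inn A (?s f))" using k(1,2) l(1,2) by simp
      also have "\<dots> = (l \<cdot> inn A (?s g)) \<cdot> ty_ar C A (case_nat k f)"
        unfolding k(3) using k(1,2) l(1,2) t by (simp add: case_t)
      also have "\<dots> = inn A (?t g) \<cdot> ty_ar C A (case_nat (l \<cdot> k) (\<lambda>n. g n \<cdot> f n))"
        unfolding l(3) using k(1,2) l(1,2) t by (simp add: case_t case_comp)
      finally have "(l \<cdot> k) \<cdot> inn A (?s f) =
          inn A (?t g) \<cdot> ty_ar C A (case_nat (l \<cdot> k) (\<lambda>n. g n \<cdot> f n))" .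
      then show "?solves (\<lambda>n. g n \<cdot> f n) (ty_ar C (Mu A) g \<cdot> ty_ar C (Mu A) f)"
        unfolding k_def[symmetric] l_def[symmetric] using k(1,2) l(1,2) t
        by (simp cong del: nat.case_cong_weak)
    qed
    fix X :: "'b poset" and G and \<rho> \<rho>' :: "nat \<Rightarrow> 'a"
    assume X: "pcpo X" and G: "\<forall>n. scott_cont X (homP (\<rho> n) (\<rho>' n)) (G n)"
    interpret X: pcpo X by fact
    let ?H = "homP (?M \<rho>) (?M \<rho>')"
    \<comment> \<open>The structure maps are invertible, so the fixed points of this operator are
      the solutions of the defining equation; by uniqueness the least one is the action on
      morphisms.\<close>
    let ?\<Phi> = "\<lambda>x k. inn A \<rho>' \<cdot> ty_ar C A (case_nat k (\<lambda>n. G n x)) \<cdot> pinv C (inn A \<rho>)"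
    have G_in: "src C (G n x) = \<rho> n" "tgt C (G n x) = \<rho>' n" if "x \<in> fst X" for n x
      using scott_cont_closed[OF G[rule_format] that] by (auto simp: hom_iff)
    have comp: "scott_cont Y ?H (\<lambda>y. inn A \<rho>' \<cdot> f y \<cdot> pinv C (inn A \<rho>))"
      if "pcpo Y" "scott_cont Y (homP (ob A \<rho> (?M \<rho>)) (ob A \<rho>' (?M \<rho>'))) f" for f and Y :: "'b poset"
      using that by (intro comp_cont pcpo.scott_cont_const[OF pcpo_homP]) (simp_all add: hom_iff)
    have \<Phi>1: "scott_cont ?H ?H (?\<Phi> x)" if x: "x \<in> fst X" for x
    proof (rule comp[OF pcpo_homP])
      have "scott_cont ?H (homP (case_nat (?M \<rho>) \<rho> n) (case_nat (?M \<rho>') \<rho>' n))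
          (case_nat (\<lambda>h. h) (\<lambda>n _. G n x) n)" for n
        using G_in[OF x]
        by (cases n) (auto intro!: pcpo.scott_cont_const[OF pcpo_homP] scott_cont_id simp: hom_iff)
      then have "scott_cont ?H (homP (ob A \<rho> (?M \<rho>)) (ob A \<rho>' (?M \<rho>')))
          (\<lambda>k. ty_ar C A (\<lambda>n. case_nat (\<lambda>h. h) (\<lambda>n _. G n x) n k))"
        using F pcpo_homP by blast
      then show "scott_cont ?H (homP (ob A \<rho> (?M \<rho>)) (ob A \<rho>' (?M \<rho>')))
          (\<lambda>k. ty_ar C A (case_nat k (\<lambda>n. G n x)))" by (simp only: case_nat_app)
    qed
    have \<Phi>2: "scott_cont X ?H (\<lambda>x. ?\<Phi> x k)" if k: "k \<in> fst ?H" for k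
    proof (rule comp[OF X])
      have "scott_cont X (homP (case_nat (?M \<rho>) \<rho> n) (case_nat (?M \<rho>') \<rho>' n))
          (case_nat (\<lambda>_. k) G n)" for n
        using G k by (cases n) (auto intro!: pcpo.scott_cont_const[OF pcpo_homP])
      then have "scott_cont X (homP (ob A \<rho> (?M \<rho>)) (ob A \<rho>' (?M \<rho>')))
          (\<lambda>x. ty_ar C A (\<lambda>n. case_nat (\<lambda>_. k) G n x))"
        using F X by blast
      then show "scott_cont X (homP (ob A \<rho> (?M \<rho>)) (ob A \<rho>' (?M \<rho>')))
          (\<lambda>x. ty_ar C A (case_nat k (\<lambda>n. G n x)))" by (simp only: case_nat_app)
    qed
    have eq: "least_fixpoint ?H (?\<Phi> x) = ty_ar C (Mu A) (\<lambda>n. G n x)" if x: "x \<in> fst X" for x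
    proof (rule eq_Mu[symmetric])
      interpret H: pcpo ?H by (rule pcpo_homP)
      let ?k = "least_fixpoint ?H (?\<Phi> x)"
      have k: "src C ?k = ?M \<rho>" "tgt C ?k = ?M \<rho>'"
        using H.least_fixpoint_in[OF \<Phi>1[OF x]] by (simp_all only: homP_simps hom_iff)
      have cancel: "?\<Phi> x k \<cdot> inn A \<rho> = inn A \<rho>' \<cdot> ty_ar C A (case_nat k (\<lambda>n. G n x))"
        if "src C k = ?M \<rho>" "tgt C k = ?M \<rho>'" for k
        using that E.is_iso_mu_in[of \<rho>] G_in[OF x] by (simp add: case_t cong del: nat.case_cong_weak)
      have "?k \<cdot> inn A \<rho> = ?\<Phi> x ?k \<cdot> inn A \<rho>"
        by (simp only: H.least_fixpoint_eq[OF \<Phi>1[OF x]])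
      also have "\<dots> = inn A \<rho>' \<cdot> ty_ar C A (case_nat ?k (\<lambda>n. G n x))"
        by (rule cancel[OF k])
      finally have "?k \<cdot> inn A \<rho> = inn A \<rho>' \<cdot> ty_ar C A (case_nat ?k (\<lambda>n. G n x))" .
      moreover have "?solves (\<lambda>n. G n x) k"
        if "src C k = ?M \<rho>" "tgt C k = ?M \<rho>'"
          "k \<cdot> inn A \<rho> = inn A \<rho>' \<cdot> ty_ar C A (case_nat k (\<lambda>n. G n x))" for k
        using that G_in[OF x] by (simp cong del: nat.case_cong_weak)
      ultimately show "?solves (\<lambda>n. G n x) ?k" using k by blast
    qed
    have "scott_cont X ?H (\<lambda>x. least_fixpoint ?H (?\<Phi> x)) \<longleftrightarrow>
        scott_cont X ?H (\<lambda>x. ty_ar C (Mu A) (\<lambda>n. G n x))"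
      by (rule scott_cont_cong) (rule eq)
    then show "scott_cont X ?H (\<lambda>x. ty_ar C (Mu A) (\<lambda>n. G n x))"
      using scott_cont_least_fixpoint[OF X pcpo_homP \<Phi>1 \<Phi>2] by blast
  qed
qed

lemma functorial: "functorial A"
proof (induction A)
  case One
  show ?case unfolding functorial_def by (auto intro!: pcpo.scott_cont_const[OF pcpo_homP] simp: hom_iff)
next
  case (Sum A B) then show ?case unfolding functorial_def by (auto intro!: add_cont)
next
  case (Prod A B) then show ?case unfolding functorial_def by (auto intro!: mult_cont)
next
  case (Mu A) then show ?case by (rule functorial_Mu)
next
  case (TVar n) then show ?case unfolding functorial_def by auto
qed

lemma src_ty_ar [simp]: "src C (ty_ar C A f) = ty_ob C A (\<lambda>n. src C (f n))"
  and tgt_ty_ar [simp]: "tgt C (ty_ar C A f) = ty_ob C A (\<lambda>n. tgt C (f n))"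
  and ty_ar_idm [simp]: "ty_ar C A (\<lambda>n. idm C (\<rho> n)) = idm C (ty_ob C A \<rho>)"
  using functorial[of A] by (simp_all add: functorial_def)

section \<open>Lifting and substitution of types\<close>

lemma case_nat_shift: "(\<lambda>n. case_nat Y \<rho> (if n < Suc k then n else Suc n)) =
    case_nat Y (\<lambda>n. \<rho> (if n < k then n else Suc n))"
  by (auto split: nat.split)

lemma ty_lift_sem:
  "ty_ob C (ty_lift A k) \<rho> = ty_ob C A (\<lambda>n. \<rho> (if n < k then n else Suc n))"
  "ty_ar C (ty_lift A k) f = ty_ar C A (\<lambda>n. f (if n < k then n else Suc n))"
proof (induction A arbitrary: k \<rho> f)
  case (Mu A)
  case 1 show ?case by (simp add: Mu case_nat_shift)
  case 2 show ?case by (simp add: Mu case_nat_shift Let_def)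
qed simp_all

text \<open>The environment that undoes the elimination of index \<open>k\<close> in
  \<open>ty_subst\<close>: later entries move up by one to make room for \<open>x\<close>.\<close>

definition insert_at :: "nat \<Rightarrow> 'x \<Rightarrow> (nat \<Rightarrow> 'x) \<Rightarrow> nat \<Rightarrow> 'x" where
  "insert_at k x \<rho> n = (if n < k then \<rho> n else if n = k then x else \<rho> (n - 1))"

lemma insert_at_0: "insert_at 0 x \<rho> = case_nat x \<rho>"
  by (auto simp: insert_at_def split: nat.split)

lemma insert_at_case_nat: "insert_at (Suc k) x (case_nat Y \<rho>) = case_nat Y (insert_at k x \<rho>)"
  by (rule ext) (auto simp: insert_at_def split: nat.split)

lemma insert_at_comp: "(\<lambda>n. h (insert_at k x \<rho> n)) = insert_at k (h x) (\<lambda>n. h (\<rho> n))"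
  by (auto simp: insert_at_def)

lemma ty_lift_0_sem: "ty_ob C (ty_lift B 0) (case_nat Y \<rho>) = ty_ob C B \<rho>"
  "ty_ar C (ty_lift B 0) (case_nat h f) = ty_ar C B f"
  by (simp_all add: ty_lift_sem)

text \<open>Objects and actions share one induction, because the object of \<open>Mu A\<close> is
  chosen from both parts of its functor. The case \<open>k = 0\<close> types \<open>fold_ar\<close>
  at the unfolded type.\<close>

lemma ty_subst_sem:
  "ty_ob C (ty_subst A k B) \<rho> = ty_ob C A (insert_at k (ty_ob C B \<rho>) \<rho>)"
  "ty_ar C (ty_subst A k B) f = ty_ar C A (insert_at k (ty_ar C B f) f)"
proof (induction A arbitrary: k B \<rho> f)
  case (Mu A)
  case 1
  have "(\<lambda>h. ty_ar C (ty_subst A (Suc k) (ty_lift B 0)) (case_nat h (\<lambda>n. idm C (\<rho> n)))) =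
      ar A (insert_at k (ty_ob C B \<rho>) \<rho>)" for \<rho>
    by (simp add: Mu ty_lift_0_sem insert_at_case_nat insert_at_comp)
  then show ?case by (simp add: Mu(1) ty_lift_0_sem insert_at_case_nat)
  case 2
  have "(\<lambda>h. ty_ar C (ty_subst A (Suc k) (ty_lift B 0)) (case_nat h (\<lambda>n. idm C (\<rho> n)))) =
      ar A (insert_at k (ty_ob C B \<rho>) \<rho>)" for \<rho>
    by (simp add: Mu ty_lift_0_sem insert_at_case_nat insert_at_comp)
  then show ?case by (simp add: Mu ty_lift_0_sem insert_at_case_nat insert_at_comp Let_def)
next
  case (TVar n)
  case 1 show ?case by (simp add: insert_at_def)
  case 2 show ?case by (simp add: insert_at_def)
qed simp_all

lemma src_fold_ar [simp]: "src C (fold_ar C A) = sem_ty C (ty_subst A 0 (Mu A))"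
  and tgt_fold_ar [simp]: "tgt C (fold_ar C A) = sem_ty C (Mu A)"
  and is_iso_fold_ar [simp]: "is_iso C (fold_ar C A)"
proof -
  interpret E: continuous_endofunctor C "ob A \<rho>" "ar A \<rho>" for \<rho>
    by (rule functorial_endofunctor[OF functorial])
  have f: "fold_ar C A = inn A (\<lambda>_. zero_ob C)" by (simp add: fold_ar_def)
  show "src C (fold_ar C A) = sem_ty C (ty_subst A 0 (Mu A))"
    by (simp add: f sem_ty_def ty_subst_sem insert_at_0)
  show "tgt C (fold_ar C A) = sem_ty C (Mu A)" by (simp add: f sem_ty_def)
  show "is_iso C (fold_ar C A)" unfolding f by (rule E.is_iso_mu_in)
qed

lemma sem_ty_simps [simp]:
  "sem_ty C One = one_ob C"
  "sem_ty C (Sum A B) = tob (add C) (sem_ty C A) (sem_ty C B)"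
  "sem_ty C (Prod A B) = sem_ty C A \<otimes>\<^sub>o[C] sem_ty C B"
  by (simp_all add: sem_ty_def)

end

section \<open>Iso types and orthogonality\<close>

context dcpo_join_inverse_rig_category
begin

text \<open>Partial inversion is monotone and its own inverse, hence an order isomorphism between
  hom-sets.\<close>

lemma pinv_cont: "scott_cont (homP A B) (homP B A) (pinv C)"
proof (rule scott_contI)
  fix S x assume S: "S \<subseteq> fst (homP A B)" "is_directed (snd (homP A B)) S"
    and lub: "is_lub (fst (homP A B)) (snd (homP A B)) S x"
  have Sh: "src C s = A" "tgt C s = B" if "s \<in> S" for s using that S(1) by (auto simp: hom_iff)
  have xh: "src C x = A" "tgt C x = B" using lub_in[OF lub] by (auto simp: hom_iff)
  show "is_lub (fst (homP B A)) (snd (homP B A)) (pinv C ` S) (pinv C x)"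
  proof (rule is_lubI)
    show "pinv C x \<in> fst (homP B A)" by (simp add: hom_iff xh)
    show "snd (homP B A) t (pinv C x)" if "t \<in> pinv C ` S" for t
      using that lub_upper[OF lub] Sh xh by (auto intro!: pinv_mono)
    fix y assume y: "y \<in> fst (homP B A)" "\<And>t. t \<in> pinv C ` S \<Longrightarrow> snd (homP B A) t y"
    have yh: "src C y = B" "tgt C y = A" using y(1) by (auto simp: hom_iff)
    have "le C s (pinv C y)" if "s \<in> S" for s
      using pinv_mono[of "pinv C s" y] y(2)[of "pinv C s"] that Sh[OF that] yh by simp
    then have "le C x (pinv C y)"
      using lub_least[OF lub, of "pinv C y"] yh by (simp add: hom_iff)
    then show "snd (homP B A) (pinv C x) y" using pinv_mono[of x "pinv C y"] xh yh by simp
  qed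
qed (simp add: hom_iff)

lemma Join_cont:
  assumes X: "pcpo X" and f: "\<And>i. i \<in> I \<Longrightarrow> scott_cont X (homP A B) (f i)"
    and comp: "\<And>x. x \<in> fst X \<Longrightarrow> compatible C ((\<lambda>i. f i x) ` I)"
  shows "scott_cont X (homP A B) (\<lambda>x. Join C A B ((\<lambda>i. f i x) ` I))"
proof (rule scott_cont_pointwise_lub[OF X pcpo_homP f])
  fix x assume x: "x \<in> fst X"
  have "(\<lambda>i. f i x) ` I \<subseteq> hom C A B" using scott_cont_closed[OF f x] by auto
  then show "is_lub (fst (homP A B)) (snd (homP A B)) ((\<lambda>i. f i x) ` I) (Join C A B ((\<lambda>i. f i x) ` I))"
    using Join_lub comp[OF x] by simp
qed

text \<open>For different indices both compatibility equations read zero equals zero: orthogonality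
  of the \<open>v\<close> separates the domains of the composites, orthogonality of the
  \<open>f\<close> their ranges.\<close>

lemma compatible_orthogonal:
  assumes f: "\<And>i. i \<in> I \<Longrightarrow> src C (f i) = X i \<and> tgt C (f i) = B"
    and v: "\<And>i. i \<in> I \<Longrightarrow> src C (v i) = X i \<and> tgt C (v i) = A"
    and fo: "\<And>i j. i \<in> I \<Longrightarrow> j \<in> I \<Longrightarrow> i \<noteq> j \<Longrightarrow> pinv C (f i) \<cdot> f j = zero C (X j) (X i)"
    and vo: "\<And>i j. i \<in> I \<Longrightarrow> j \<in> I \<Longrightarrow> i \<noteq> j \<Longrightarrow> pinv C (v i) \<cdot> v j = zero C (X j) (X i)"
  shows "compatible C ((\<lambda>i. f i \<cdot> pinv C (v i)) ` I)"
proof -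
  \<comment> \<open>The restriction of \<open>f' \<cdot> pinv C v'\<close> absorbs the idempotent
    \<open>v' \<cdot> pinv C v'\<close>, and this meets \<open>pinv C v\<close> in the vanishing
    composite.\<close>
  have *: "(f \<cdot> pinv C v) \<cdot> restr C (f' \<cdot> pinv C v') = zero C (tgt C v) (tgt C f)"
    if "src C f = src C v" "src C f' = src C v'" "tgt C v' = tgt C v"
      "pinv C v \<cdot> v' = zero C (src C v') (src C v)" for f v f' v'
  proof -
    have "restr C (f' \<cdot> pinv C v') = restr C (pinv C v') \<cdot> restr C (f' \<cdot> pinv C v')"
      using that by (simp add: restr_comp_absorb')
    then have "(f \<cdot> pinv C v) \<cdot> restr C (f' \<cdot> pinv C v') =
        (f \<cdot> pinv C v) \<cdot> restr C (pinv C v') \<cdot> restr C (f' \<cdot> pinv C v')" by simp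
    also have "\<dots> = f \<cdot> ((pinv C v \<cdot> v') \<cdot> pinv C v') \<cdot> restr C (f' \<cdot> pinv C v')"
      using that(1-3) by simp
    also have "\<dots> = zero C (tgt C v) (tgt C f)" unfolding that(4) using that(1-3) by simp
    finally show ?thesis .
  qed
  show ?thesis unfolding compatible_def
  proof (intro ballI)
    fix a b assume "a \<in> (\<lambda>i. f i \<cdot> pinv C (v i)) ` I" "b \<in> (\<lambda>i. f i \<cdot> pinv C (v i)) ` I"
    then obtain i j where i: "i \<in> I" "a = f i \<cdot> pinv C (v i)" and j: "j \<in> I" "b = f j \<cdot> pinv C (v j)"
      by auto
    show "a \<cdot> restr C b = b \<cdot> restr C a \<and>
        pinv C a \<cdot> restr C (pinv C b) = pinv C b \<cdot> restr C (pinv C a)"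
    proof (cases "i = j")
      case False
      note t = f[OF i(1)] f[OF j(1)] v[OF i(1)] v[OF j(1)]
      have "pinv C a = v i \<cdot> pinv C (f i)" "pinv C b = v j \<cdot> pinv C (f j)" using t i j by simp_all
      then show ?thesis
        using *[of "f i" "v i" "f j" "v j"] *[of "f j" "v j" "f i" "v i"]
          *[of "v i" "f i" "v j" "f j"] *[of "v j" "f j" "v i" "f i"]
          fo[OF i(1) j(1) False] fo[OF j(1) i(1)] vo[OF i(1) j(1) False] vo[OF j(1) i(1)] False t i j
        by (simp del: assoc)
    qed (use i j in simp)
  qed
qed

lemma lub_Mor: "is_lub H r S f \<Longrightarrow> is_lub (Mor ` H) (\<lambda>x y. r (mor x) (mor y)) (Mor ` S) (Mor f)"
  by (simp add: is_lub_def)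

lemma lub_mor: "is_lub (Mor ` H) (\<lambda>x y. r (mor x) (mor y)) S x \<Longrightarrow> is_lub H r (mor ` S) (mor x)"
  by (auto simp: is_lub_def)

lemma Mor_cont:
  assumes "scott_cont X (homP (sem_ty C A) (sem_ty C B)) f"
  shows "scott_cont X (sem_ity C code (A \<leftrightarrow> B)) (\<lambda>x. Mor (f x))"
proof (rule scott_contI)
  show "Mor (f x) \<in> fst (sem_ity C code (A \<leftrightarrow> B))" if "x \<in> fst X" for x
    using scott_cont_closed[OF assms that] by simp
  show "is_lub (fst (sem_ity C code (A \<leftrightarrow> B))) (snd (sem_ity C code (A \<leftrightarrow> B)))
      ((\<lambda>x. Mor (f x)) ` S) (Mor (f x))"
    if "S \<subseteq> fst X" "is_directed (snd X) S" "is_lub (fst X) (snd X) S x" for S x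
    using lub_Mor[OF scott_contD[OF assms that]] by (simp add: image_image)
qed

lemma mor_cont: "scott_cont (sem_ity C code (A \<leftrightarrow> B)) (homP (sem_ty C A) (sem_ty C B)) mor"
  by (rule scott_contI) (auto intro: lub_mor)

lemma pcpo_Iso: "pcpo (sem_ity C code (A \<leftrightarrow> B))"
proof -
  interpret H: pcpo "homP (sem_ty C A) (sem_ty C B)" by (rule pcpo_homP)
  let ?P = "sem_ity C code (A \<leftrightarrow> B)"
  show ?thesis
  proof
    show "snd ?P x x" if "x \<in> fst ?P" for x using that H.refl by auto
    show "snd ?P x z" if "x \<in> fst ?P" "y \<in> fst ?P" "z \<in> fst ?P" "snd ?P x y" "snd ?P y z" for x y z
      using that H.trans[of "mor x" "mor y" "mor z"] by auto
    show "x = y" if "x \<in> fst ?P" "y \<in> fst ?P" "snd ?P x y" "snd ?P y x" for x y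
      using that H.antisym[of "mor x" "mor y"] by auto
    show "\<exists>x\<in>fst ?P. \<forall>y\<in>fst ?P. snd ?P x y" using H.bot_in H.bot_least by auto
    show "\<exists>x. is_lub (fst ?P) (snd ?P) S x" if S: "S \<subseteq> fst ?P" "is_directed (snd ?P) S" for S
    proof -
      have "mor ` S \<subseteq> hom C (sem_ty C A) (sem_ty C B)" using S by auto
      moreover have "is_directed (le C) (mor ` S)" using S(2) by (auto simp: is_directed_def)
      ultimately obtain f where "is_lub (hom C (sem_ty C A) (sem_ty C B)) (le C) (mor ` S) f"
        using hom_dcpo by blast
      then have "is_lub (fst ?P) (snd ?P) S (Mor f)" by (auto simp: is_lub_def)
      then show ?thesis by blast
    qed
  qed
qed

lemma coded_maps_Fun:
  assumes "pcpo (sem_ity C code T1)" "pcpo (sem_ity C code T2)" "representable C code (Fun T1 T2)"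
  shows "coded_maps (sem_ity C code T1) (sem_ity C code T2) code"
  using assms by (simp add: coded_maps_def)

lemma sem_Fun:
  assumes "coded_maps (sem_ity C code T1) (sem_ity C code T2) code"
  shows "sem_ity C code (Fun T1 T2) = coded_maps.maps (sem_ity C code T1) (sem_ity C code T2) code"
  by (simp add: coded_maps.maps_def[OF assms] Let_def)

lemma pcpo_sem_ity: "representable C code T \<Longrightarrow> pcpo (sem_ity C code T)"
proof (induction T)
  case (Fun T1 T2)
  have coded: "coded_maps (sem_ity C code T1) (sem_ity C code T2) code"
    using Fun by (intro coded_maps_Fun) simp_all
  show ?case unfolding sem_Fun[OF coded] by (rule coded_maps.pcpo_maps[OF coded])
qed (rule pcpo_Iso)

lemma coded_maps_sem_ity:
  "representable C code (Fun T1 T2) \<Longrightarrow> coded_maps (sem_ity C code T1) (sem_ity C code T2) code"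
  by (rule coded_maps_Fun) (simp_all add: pcpo_sem_ity)

end

lemma iinterp_representable: "iinterp C code \<Psi> w T G \<Longrightarrow> representable C code T"
  using interp_iinterp.inducts(2)[of C code \<Psi> w T G "\<lambda>_ _ _ _ _. True" "\<lambda>_ _ T _. representable C code T"]
  by simp

context dcpo_join_inverse_rig_category
begin

lemma src_split [simp]: "src C (split C \<Delta>1 \<Delta>2) = sem_ctx C (\<Delta>1 @ \<Delta>2)"
  and tgt_split [simp]: "tgt C (split C \<Delta>1 \<Delta>2) = sem_ctx C \<Delta>1 \<otimes>\<^sub>o[C] sem_ctx C \<Delta>2"
  by (induction \<Delta>1) simp_all

lemma is_iso_pinv: "is_iso C f \<Longrightarrow> is_iso C (pinv C f)"
  by (rule is_isoI) (simp_all add: is_iso_total is_iso_pinv_total)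

lemma is_iso_split [simp]: "is_iso C (split C \<Delta>1 \<Delta>2)"
  by (induction \<Delta>1) (auto intro!: is_iso_comp is_iso_pinv T.tar_iso)

lemma src_exch: "src C (exch C \<Delta>1 A B \<Delta>2) = sem_ctx C (\<Delta>1 @ (x, A) # (y, B) # \<Delta>2)"
  and tgt_exch: "tgt C (exch C \<Delta>1 A B \<Delta>2) = sem_ctx C (\<Delta>1 @ (x, B) # (y, A) # \<Delta>2)"
  by (induction \<Delta>1) simp_all

lemma is_iso_exch [simp]: "is_iso C (exch C \<Delta>1 A B \<Delta>2)"
  by (induction \<Delta>1) (auto intro!: is_iso_comp is_iso_pinv T.tar_iso)

text \<open>
  \<open>factors t A f\<close> exposes the outermost constructors of \<open>t\<close> in a denotation \<open>f\<close> of \<open>t\<close>: up to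
  precomposition, which also absorbs exchange and the bound term of a \<open>Let\<close>, \<open>f\<close> is built from
  denotations of the immediate subterms.
\<close>

inductive factors :: "trm \<Rightarrow> ty \<Rightarrow> 'b \<Rightarrow> bool" where
  "tgt C f = sem_ty C A \<Longrightarrow> factors Unit A f"
| "tgt C f = sem_ty C A \<Longrightarrow> factors (Var x) A f"
| "tgt C f = sem_ty C A \<Longrightarrow> factors (App w t) A f"
| "factors t A f \<Longrightarrow> tgt C f = sem_ty C A \<Longrightarrow> tgt C x = src C f \<Longrightarrow>
    factors (Inl t) (Sum A B) (inj_l C (sem_ty C A) (sem_ty C B) \<cdot> f \<cdot> x)"
| "factors t B f \<Longrightarrow> tgt C f = sem_ty C B \<Longrightarrow> tgt C x = src C f \<Longrightarrow>
    factors (Inr t) (Sum A B) (inj_r C (sem_ty C A) (sem_ty C B) \<cdot> f \<cdot> x)"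
| "factors t (ty_subst A 0 (Mu A)) f \<Longrightarrow> tgt C f = sem_ty C (ty_subst A 0 (Mu A)) \<Longrightarrow>
    tgt C x = src C f \<Longrightarrow> factors (Fold t) (Mu A) (fold_ar C A \<cdot> f \<cdot> x)"
| "factors t1 A f1 \<Longrightarrow> factors t2 B f2 \<Longrightarrow> tgt C f1 = sem_ty C A \<Longrightarrow> tgt C f2 = sem_ty C B \<Longrightarrow>
    tgt C x = src C f1 \<otimes>\<^sub>o[C] src C f2 \<Longrightarrow> factors (Pair t1 t2) (Prod A B) ((f1 \<otimes>\<^sub>m[C] f2) \<cdot> x)"
| "factors t B f \<Longrightarrow> tgt C f = sem_ty C B \<Longrightarrow> tgt C x = src C f \<Longrightarrow> factors (Let p u t) B (f \<cdot> x)"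

inductive_cases factors_Inl: "factors (Inl t) A f"
inductive_cases factors_Inr: "factors (Inr t) A f"
inductive_cases factors_Pair: "factors (Pair t u) A f"
inductive_cases factors_Fold: "factors (Fold t) A f"
inductive_cases factors_Let: "factors (Let p u t) A f"

lemma factors_precomp: "factors t A f \<Longrightarrow> tgt C y = src C f \<Longrightarrow> factors t A (f \<cdot> y)"
  by (erule factors.cases) (auto intro: factors.intros)

text \<open>Orthogonality is decided where the two injections differ, and these are disjoint. The
  constructors around that place are total maps, which cancel against their partial inverses, or
  tensors, which carry the zero outwards. The components away from that place may have unrelated
  denotations, as they come from different derivations.\<close>

lemma orth_zero: "t \<bottom> u \<Longrightarrow> factors t A f \<Longrightarrow> factors u A g \<Longrightarrow>
    pinv C g \<cdot> f = zero C (src C f) (src C g)"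
proof (induction arbitrary: A f g rule: orth.induct)
  case (orth_lr t1 t2) then show ?case by (auto elim!: factors_Inl factors_Inr)
next
  case (orth_rl t1 t2) then show ?case by (auto elim!: factors_Inl factors_Inr)
next
  case (orth_Inl t1 t2)
  from orth_Inl.prems show ?case
  proof (elim factors_Inl, goal_cases)
    case (1 A1 f1 x1 B1 A2 f2 x2 B2)
    then have "pinv C f2 \<cdot> f1 \<cdot> x1 = (pinv C f2 \<cdot> f1) \<cdot> x1" by simp
    also have "\<dots> = zero C (src C x1) (src C f2)" using orth_Inl.IH[of A1 f1 f2] 1 by simp
    finally show ?case using 1 by simp
  qed
next
  case (orth_Inr t1 t2)
  from orth_Inr.prems show ?case
  proof (elim factors_Inr, goal_cases)
    case (1 B1 f1 x1 A1 B2 f2 x2 A2)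
    then have "pinv C f2 \<cdot> f1 \<cdot> x1 = (pinv C f2 \<cdot> f1) \<cdot> x1" by simp
    also have "\<dots> = zero C (src C x1) (src C f2)" using orth_Inr.IH[of B1 f1 f2] 1 by simp
    finally show ?case using 1 by simp
  qed
next
  case (orth_PairL t1 t2 t)
  from orth_PairL.prems show ?case
  proof (elim factors_Pair, goal_cases)
    case (1 A1 f1 B1 h1 x1 A2 f2 B2 h2 x2)
    then show ?case using orth_PairL.IH[of A1 f1 f2] by simp
  qed
next
  case (orth_PairR t1 t2 t)
  from orth_PairR.prems show ?case
  proof (elim factors_Pair, goal_cases)
    case (1 A1 f1 B1 h1 x1 A2 f2 B2 h2 x2)
    then show ?case using orth_PairR.IH[of B1 h1 h2] by simp
  qed
next
  case (orth_Fold t1 t2)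
  from orth_Fold.prems show ?case
  proof (elim factors_Fold, goal_cases)
    case (1 A1 f1 x1 A2 f2 x2)
    then have "pinv C f2 \<cdot> f1 \<cdot> x1 = (pinv C f2 \<cdot> f1) \<cdot> x1" by simp
    also have "\<dots> = zero C (src C x1) (src C f2)"
      using orth_Fold.IH[of "ty_subst A1 0 (Mu A1)" f1 f2] 1 by simp
    finally show ?case using 1 by simp
  qed
next
  case (orth_Let t1 t2 p t)
  from orth_Let.prems show ?case
  proof (elim factors_Let, goal_cases)
    case (1 f1 x1 f2 x2)
    then have "pinv C f2 \<cdot> f1 \<cdot> x1 = (pinv C f2 \<cdot> f1) \<cdot> x1" by simp
    also have "\<dots> = zero C (src C x1) (src C f2)" using orth_Let.IH[of A f1 f2] 1 by simp
    finally show ?case using 1 by simp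
  qed
qed

end

section \<open>Continuity of the interpretation\<close>

context dcpo_join_inverse_rig_category
begin

definition rep_ctx :: "('b, 'd) coding \<Rightarrow> ictx \<Rightarrow> bool" where
  "rep_ctx code \<Psi> \<longleftrightarrow> (\<forall>\<phi> T. \<Psi> \<phi> = Some T \<longrightarrow> representable C code T)"

definition valid_env :: "('b, 'd) coding \<Rightarrow> ictx \<Rightarrow> ('b, 'd) env \<Rightarrow> bool" where
  "valid_env code \<Psi> g \<longleftrightarrow> (\<forall>\<phi> T. \<Psi> \<phi> = Some T \<longrightarrow> g \<phi> \<in> fst (sem_ity C code T))"

definition cont_env :: "('b, 'd) coding \<Rightarrow> ictx \<Rightarrow> ('b, 'd) sem poset \<Rightarrow>
    (('b, 'd) sem \<Rightarrow> ('b, 'd) env) \<Rightarrow> bool" where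
  "cont_env code \<Psi> X \<gamma> \<longleftrightarrow>
     (\<forall>\<phi> T. \<Psi> \<phi> = Some T \<longrightarrow> scott_cont X (sem_ity C code T) (\<lambda>x. \<gamma> x \<phi>))"

text \<open>Continuity on the product dcpo of environments, tested along families of environments
  over a pcpo \<open>X\<close>. This spares a representation of the product, and binding a variable
  just extends the family by one coordinate.\<close>

definition cont_in :: "('b, 'd) coding \<Rightarrow> ictx \<Rightarrow> 'x poset \<Rightarrow> (('b, 'd) env \<Rightarrow> 'x) \<Rightarrow> bool" where
  "cont_in code \<Psi> Q F \<longleftrightarrow>
     (\<forall>X \<gamma>. pcpo X \<longrightarrow> cont_env code \<Psi> X \<gamma> \<longrightarrow> scott_cont X Q (\<lambda>x. F (\<gamma> x)))"

lemma cont_inD: "cont_in code \<Psi> Q F \<Longrightarrow> pcpo X \<Longrightarrow> cont_env code \<Psi> X \<gamma> \<Longrightarrow> scott_cont X Q (\<lambda>x. F (\<gamma> x))"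
  unfolding cont_in_def by blast

lemma cont_env_const: "rep_ctx code \<Psi> \<Longrightarrow> valid_env code \<Psi> g \<Longrightarrow> cont_env code \<Psi> X (\<lambda>_. g)"
  by (simp add: rep_ctx_def valid_env_def cont_env_def pcpo.scott_cont_const pcpo_sem_ity)

lemma cont_env_update: "cont_env code \<Psi> X \<gamma> \<Longrightarrow> scott_cont X (sem_ity C code T) f \<Longrightarrow>
    cont_env code (\<Psi>(\<phi> \<mapsto> T)) X (\<lambda>x. (\<gamma> x)(\<phi> := f x))"
  by (simp add: cont_env_def)

lemma rep_ctx_update: "rep_ctx code \<Psi> \<Longrightarrow> representable C code T \<Longrightarrow> rep_ctx code (\<Psi>(\<phi> \<mapsto> T))"
  by (simp add: rep_ctx_def)

lemma valid_env_update: "valid_env code \<Psi> g \<Longrightarrow> x \<in> fst (sem_ity C code T) \<Longrightarrow>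
    valid_env code (\<Psi>(\<phi> \<mapsto> T)) (g(\<phi> := x))"
  by (simp add: valid_env_def)

lemma cont_env_valid: "cont_env code \<Psi> X \<gamma> \<Longrightarrow> x \<in> fst X \<Longrightarrow> valid_env code \<Psi> (\<gamma> x)"
  by (auto simp: cont_env_def valid_env_def dest: scott_cont_closed)

lemma cont_in_closed:
  assumes "cont_in code \<Psi> Q F" "rep_ctx code \<Psi>" "valid_env code \<Psi> g" shows "F g \<in> fst Q"
proof -
  \<comment> \<open>Membership follows from continuity of a constant family over any inhabited pcpo;
    this one exists for every \<open>code\<close>.\<close>
  let ?X = "sem_ity C code (One \<leftrightarrow> One)"
  interpret X: pcpo ?X by (rule pcpo_Iso)
  have "scott_cont ?X Q (\<lambda>_. F g)"
    using cont_inD[OF assms(1) X.pcpo_axioms cont_env_const[OF assms(2,3)]] by simp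
  then show ?thesis using X.bot_in by (rule scott_cont_closed)
qed

lemma cont_in_const: "f \<in> hom C A B \<Longrightarrow> cont_in code \<Psi> (homP A B) (\<lambda>_. f)"
  unfolding cont_in_def by (simp add: pcpo.scott_cont_const[OF pcpo_homP])

lemma cont_inI: "(\<And>X \<gamma>. pcpo X \<Longrightarrow> cont_env code \<Psi> X \<gamma> \<Longrightarrow> scott_cont X Q (\<lambda>x. F (\<gamma> x))) \<Longrightarrow>
    cont_in code \<Psi> Q F"
  by (simp add: cont_in_def)

lemma cont_in_comp:
  assumes G: "cont_in code \<Psi> (homP B D) G" and F: "cont_in code \<Psi> (homP A B) F"
  shows "cont_in code \<Psi> (homP A D) (\<lambda>g. G g \<cdot> F g)"
  by (rule cont_inI, rule comp_cont[OF _ cont_inD[OF G] cont_inD[OF F]])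

lemma cont_in_mult:
  assumes F: "cont_in code \<Psi> (homP A A') F" and G: "cont_in code \<Psi> (homP B B') G"
  shows "cont_in code \<Psi> (homP (A \<otimes>\<^sub>o[C] B) (A' \<otimes>\<^sub>o[C] B')) (\<lambda>g. F g \<otimes>\<^sub>m[C] G g)"
  by (rule cont_inI, rule mult_cont[OF _ cont_inD[OF F] cont_inD[OF G]])

lemma cont_in_pinv:
  assumes F: "cont_in code \<Psi> (homP A B) F" shows "cont_in code \<Psi> (homP B A) (\<lambda>g. pinv C (F g))"
  by (rule cont_inI, rule pcpo.scott_cont_comp[OF _ cont_inD[OF F] pinv_cont])

lemma cont_in_mor:
  assumes G: "cont_in code \<Psi> (sem_ity C code (A \<leftrightarrow> B)) G"
  shows "cont_in code \<Psi> (homP (sem_ty C A) (sem_ty C B)) (\<lambda>g. mor (G g))"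
  by (rule cont_inI, rule pcpo.scott_cont_comp[OF _ cont_inD[OF G] mor_cont])

text \<open>Continuity alone is too weak an invariant: the join of a clause set exists when the
  clauses are compatible, and compatibility is read off from \<open>factors\<close>. Totality is
  recorded for values.\<close>

definition denotation :: "('b, 'd) coding \<Rightarrow> ictx \<Rightarrow> ctx \<Rightarrow> trm \<Rightarrow> ty \<Rightarrow> (('b, 'd) env \<Rightarrow> 'b) \<Rightarrow> bool" where
  "denotation code \<Psi> \<Delta> t A F \<longleftrightarrow> cont_in code \<Psi> (homP (sem_ctx C \<Delta>) (sem_ty C A)) F \<and>
    (\<forall>g. valid_env code \<Psi> g \<longrightarrow> factors t A (F g) \<and> (is_val t \<longrightarrow> total (F g)))"

lemma denotationD:
  assumes "denotation code \<Psi> \<Delta> t A F" "rep_ctx code \<Psi>" "valid_env code \<Psi> g"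
  shows "src C (F g) = sem_ctx C \<Delta>" "tgt C (F g) = sem_ty C A" "factors t A (F g)"
    "is_val t \<Longrightarrow> total (F g)"
  using assms cont_in_closed[of code \<Psi> "homP (sem_ctx C \<Delta>) (sem_ty C A)" F g]
  by (auto simp: denotation_def hom_iff)

lemma denotation_cont: "denotation code \<Psi> \<Delta> t A F \<Longrightarrow> cont_in code \<Psi> (homP (sem_ctx C \<Delta>) (sem_ty C A)) F"
  by (simp add: denotation_def)

lemma denotation_unary:
  assumes F: "denotation code \<Psi> \<Delta> t A F" "rep_ctx code \<Psi>"
    and h: "src C h = sem_ty C A" "tgt C h = sem_ty C B" "total h"
    and K: "\<And>f x. factors t A f \<Longrightarrow> tgt C f = sem_ty C A \<Longrightarrow> tgt C x = src C f \<Longrightarrow> factors (K t) B (h \<cdot> f \<cdot> x)"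
      "is_val (K t) \<Longrightarrow> is_val t"
  shows "denotation code \<Psi> \<Delta> (K t) B (\<lambda>g. h \<cdot> F g)"
  unfolding denotation_def
proof (intro conjI allI impI)
  show "cont_in code \<Psi> (homP (sem_ctx C \<Delta>) (sem_ty C B)) (\<lambda>g. h \<cdot> F g)"
    by (rule cont_in_comp[OF cont_in_const denotation_cont[OF F(1)]]) (simp add: hom_iff h)
  fix g assume g: "valid_env code \<Psi> g"
  note t = denotationD[OF F g]
  show "factors (K t) B (h \<cdot> F g)" using K(1)[OF t(3), of "idm C (sem_ctx C \<Delta>)"] t by simp
  show "total (h \<cdot> F g)" if "is_val (K t)" using t h K(2)[OF that] by (intro total_comp) simp_all
qed

lemma interp_cont:
  "interp C code \<Psi> \<Delta> t A F \<Longrightarrow> rep_ctx code \<Psi> \<longrightarrow> denotation code \<Psi> \<Delta> t A F"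
  "iinterp C code \<Psi> w T G \<Longrightarrow> rep_ctx code \<Psi> \<longrightarrow> cont_in code \<Psi> (sem_ity C code T) G"
proof (induction rule: interp_iinterp.inducts)
  case (in_Unit \<Psi>)
  show ?case by (auto simp: denotation_def hom_iff intro!: cont_in_const factors.intros)
next
  case (in_Var A \<Psi> x)
  show ?case by (auto simp: denotation_def hom_iff intro!: cont_in_const factors.intros is_iso_total)
next
  case (in_Inl \<Psi> \<Delta> t A F B)
  show ?case
    by (intro impI denotation_unary[OF in_Inl(2)[rule_format]]) (simp_all add: total_def factors.intros)
next
  case (in_Inr \<Psi> \<Delta> t B F A)
  show ?case
    by (intro impI denotation_unary[OF in_Inr(2)[rule_format]]) (simp_all add: total_def factors.intros)
next
  case (in_Fold \<Psi> \<Delta> t A F)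
  show ?case
    by (intro impI denotation_unary[OF in_Fold(2)[rule_format]]) (simp_all add: is_iso_total factors.intros)
next
  case (in_Pair \<Psi> \<Delta>1 t1 A F1 \<Delta>2 t2 B F2)
  show ?case
  proof
    assume r: "rep_ctx code \<Psi>"
    note D1 = in_Pair(2)[rule_format, OF r] and D2 = in_Pair(4)[rule_format, OF r]
    show "denotation code \<Psi> (\<Delta>1 @ \<Delta>2) (Pair t1 t2) (Prod A B) (\<lambda>g. (F1 g \<otimes>\<^sub>m[C] F2 g) \<cdot> split C \<Delta>1 \<Delta>2)"
      unfolding denotation_def
    proof (intro conjI allI impI)
      show "cont_in code \<Psi> (homP (sem_ctx C (\<Delta>1 @ \<Delta>2)) (sem_ty C (Prod A B)))
          (\<lambda>g. (F1 g \<otimes>\<^sub>m[C] F2 g) \<cdot> split C \<Delta>1 \<Delta>2)"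
        using cont_in_mult[OF denotation_cont[OF D1] denotation_cont[OF D2]]
        by (intro cont_in_comp[OF _ cont_in_const]) (simp_all add: hom_iff)
      fix g assume g: "valid_env code \<Psi> g"
      note t = denotationD[OF D1 r g] denotationD[OF D2 r g]
      show "factors (Pair t1 t2) (Prod A B) ((F1 g \<otimes>\<^sub>m[C] F2 g) \<cdot> split C \<Delta>1 \<Delta>2)"
        using t by (intro factors.intros) simp_all
      show "total ((F1 g \<otimes>\<^sub>m[C] F2 g) \<cdot> split C \<Delta>1 \<Delta>2)" if "is_val (Pair t1 t2)"
        using that t by (intro total_comp total_mult) (simp_all add: is_iso_total)
    qed
  qed
next
  case (in_App \<Psi> w A B G \<Delta> t F)
  show ?case
  proof
    assume r: "rep_ctx code \<Psi>"
    have *: "cont_in code \<Psi> (homP (sem_ctx C \<Delta>) (sem_ty C B)) (\<lambda>g. mor (G g) \<cdot> F g)"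
      by (rule cont_in_comp[OF cont_in_mor[OF in_App(2)[rule_format, OF r]]
        denotation_cont[OF in_App(4)[rule_format, OF r]]])
    then show "denotation code \<Psi> \<Delta> (App w t) B (\<lambda>g. mor (G g) \<cdot> F g)"
      using cont_in_closed[OF * r] by (auto simp: denotation_def hom_iff intro: factors.intros)
  qed
next
  case (in_Let \<Psi> \<Delta>1 t1 A F1 \<Gamma> p P \<Delta>2 t2 B F2)
  show ?case
  proof
    assume r: "rep_ctx code \<Psi>"
    note D1 = in_Let(2)[rule_format, OF r] and DP = in_Let(4)[rule_format, OF r]
      and D2 = in_Let(6)[rule_format, OF r]
    let ?G = "\<lambda>g. pinv C (split C \<Delta>2 \<Gamma>) \<cdot> (idm C (sem_ctx C \<Delta>2) \<otimes>\<^sub>m[C] (pinv C (P g) \<cdot> F1 g))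
        \<cdot> symm (mult C) (sem_ctx C \<Delta>1) (sem_ctx C \<Delta>2) \<cdot> split C \<Delta>1 \<Delta>2"
    show "denotation code \<Psi> (\<Delta>1 @ \<Delta>2) (Let p t1 t2) B (\<lambda>g. F2 g \<cdot> ?G g)"
      unfolding denotation_def
    proof (intro conjI allI impI)
      have "cont_in code \<Psi> (homP (sem_ctx C \<Delta>1) (sem_ctx C \<Gamma>)) (\<lambda>g. pinv C (P g) \<cdot> F1 g)"
        by (rule cont_in_comp[OF cont_in_pinv[OF denotation_cont[OF DP]] denotation_cont[OF D1]])
      then have "cont_in code \<Psi> (homP (sem_ctx C \<Delta>2 \<otimes>\<^sub>o[C] sem_ctx C \<Delta>1) (sem_ctx C \<Delta>2 \<otimes>\<^sub>o[C] sem_ctx C \<Gamma>))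
          (\<lambda>g. idm C (sem_ctx C \<Delta>2) \<otimes>\<^sub>m[C] (pinv C (P g) \<cdot> F1 g))"
        by (intro cont_in_mult cont_in_const) (simp_all add: hom_iff)
      then have "cont_in code \<Psi> (homP (sem_ctx C (\<Delta>1 @ \<Delta>2)) (sem_ctx C \<Delta>2 \<otimes>\<^sub>o[C] sem_ctx C \<Gamma>))
          (\<lambda>g. (idm C (sem_ctx C \<Delta>2) \<otimes>\<^sub>m[C] (pinv C (P g) \<cdot> F1 g))
            \<cdot> symm (mult C) (sem_ctx C \<Delta>1) (sem_ctx C \<Delta>2) \<cdot> split C \<Delta>1 \<Delta>2)"
        by (rule cont_in_comp) (rule cont_in_const, simp add: hom_iff)
      then have "cont_in code \<Psi> (homP (sem_ctx C (\<Delta>1 @ \<Delta>2)) (sem_ctx C (\<Delta>2 @ \<Gamma>))) ?G"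
        by (rule cont_in_comp[rotated]) (rule cont_in_const, simp add: hom_iff)
      then show "cont_in code \<Psi> (homP (sem_ctx C (\<Delta>1 @ \<Delta>2)) (sem_ty C B)) (\<lambda>g. F2 g \<cdot> ?G g)"
        by (rule cont_in_comp[OF denotation_cont[OF D2]])
      fix g assume g: "valid_env code \<Psi> g"
      show "factors (Let p t1 t2) B (F2 g \<cdot> ?G g)"
        using denotationD[OF D1 r g] denotationD[OF DP r g] denotationD[OF D2 r g]
        by (intro factors.intros) simp_all
    qed simp
  qed
next
  case (in_Exch \<Psi> \<Delta>1 x A y B \<Delta>2 t D F)
  show ?case
  proof
    assume r: "rep_ctx code \<Psi>"
    note D = in_Exch(2)[rule_format, OF r]
    note ex = src_exch[of _ _ _ _ y x] tgt_exch[of _ _ _ _ x y]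
    show "denotation code \<Psi> (\<Delta>1 @ (y, B) # (x, A) # \<Delta>2) t D (\<lambda>g. F g \<cdot> exch C \<Delta>1 B A \<Delta>2)"
      unfolding denotation_def
    proof (intro conjI allI impI)
      show "cont_in code \<Psi> (homP (sem_ctx C (\<Delta>1 @ (y, B) # (x, A) # \<Delta>2)) (sem_ty C D))
          (\<lambda>g. F g \<cdot> exch C \<Delta>1 B A \<Delta>2)"
        by (rule cont_in_comp[OF denotation_cont[OF D] cont_in_const]) (simp add: hom_iff ex)
      fix g assume g: "valid_env code \<Psi> g"
      note t = denotationD[OF D r g]
      show "factors t D (F g \<cdot> exch C \<Delta>1 B A \<Delta>2)"
        by (rule factors_precomp[OF t(3)]) (simp add: t ex)
      show "total (F g \<cdot> exch C \<Delta>1 B A \<Delta>2)" if "is_val t"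
        using t(4)[OF that] by (intro total_comp) (simp_all add: is_iso_total t ex)
    qed
  qed
next
  case (in_Clauses A B cs \<Psi> \<Delta> V E)
  show ?case unfolding cont_in_def
  proof (intro impI allI)
    assume rep: "rep_ctx code \<Psi>"
    fix X \<gamma> assume X: "pcpo X" and \<gamma>: "cont_env code \<Psi> X \<gamma>"
    have V: "denotation code \<Psi> (\<Delta> i) (fst (cs ! i)) A (V i)"
      and E: "denotation code \<Psi> (\<Delta> i) (snd (cs ! i)) B (E i)" if "i < length cs" for i
      using in_Clauses(8)[OF that] in_Clauses(10)[OF that] rep by auto
    show "scott_cont X (sem_ity C code (A \<leftrightarrow> B))
        (\<lambda>x. Mor (Join C (sem_ty C A) (sem_ty C B) ((\<lambda>i. E i (\<gamma> x) \<cdot> pinv C (V i (\<gamma> x))) ` {..<length cs})))"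
    proof (intro Mor_cont Join_cont[OF X])
      show "scott_cont X (homP (sem_ty C A) (sem_ty C B)) (\<lambda>x. E i (\<gamma> x) \<cdot> pinv C (V i (\<gamma> x)))"
        if "i \<in> {..<length cs}" for i
        using that by (intro comp_cont[OF X cont_inD[OF denotation_cont[OF E] X \<gamma>]]
          pcpo.scott_cont_comp[OF X cont_inD[OF denotation_cont[OF V] X \<gamma>] pinv_cont]) auto
      fix x assume "x \<in> fst X"
      with \<gamma> have g: "valid_env code \<Psi> (\<gamma> x)" by (rule cont_env_valid)
      note t = denotationD[OF E rep g] denotationD[OF V rep g]
      \<comment> \<open>Orthogonality of left and right sides of the clauses is what makes
        \<open>Join\<close> a genuine least upper bound at every point of the family.\<close>
      show "compatible C ((\<lambda>i. E i (\<gamma> x) \<cdot> pinv C (V i (\<gamma> x))) ` {..<length cs})"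
      proof (rule compatible_orthogonal[where X = "\<lambda>i. sem_ctx C (\<Delta> i)" and A = "sem_ty C A" and B = "sem_ty C B"])
        show "pinv C (E i (\<gamma> x)) \<cdot> E j (\<gamma> x) = zero C (sem_ctx C (\<Delta> j)) (sem_ctx C (\<Delta> i))"
          if "i \<in> {..<length cs}" "j \<in> {..<length cs}" "i \<noteq> j" for i j
          using that t orth_zero[OF in_Clauses(6)[of j i] t(3) t(3)] by auto
        show "pinv C (V i (\<gamma> x)) \<cdot> V j (\<gamma> x) = zero C (sem_ctx C (\<Delta> j)) (sem_ctx C (\<Delta> i))"
          if "i \<in> {..<length cs}" "j \<in> {..<length cs}" "i \<noteq> j" for i j
          using that t orth_zero[OF in_Clauses(5)[of j i] t(7) t(7)] by auto
      qed (use t in auto)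
    qed
  qed
next
  case (in_Fix \<Psi> \<phi> T w G)
  show ?case unfolding cont_in_def
  proof (intro impI allI)
    assume rep: "rep_ctx code \<Psi>"
    fix X \<gamma> assume X: "pcpo X" and \<gamma>: "cont_env code \<Psi> X \<gamma>"
    have T: "representable C code T" by (rule iinterp_representable[OF in_Fix(1)])
    note IH = in_Fix(2)[rule_format, OF rep_ctx_update[OF rep T]]
    note P = pcpo_sem_ity[OF T]
    show "scott_cont X (sem_ity C code T)
        (\<lambda>y. least_fixpoint (sem_ity C code T) (\<lambda>x. G ((\<gamma> y)(\<phi> := x))))"
    proof (rule scott_cont_least_fixpoint[OF X P])
      show "scott_cont (sem_ity C code T) (sem_ity C code T) (\<lambda>x. G ((\<gamma> y)(\<phi> := x)))"
        if "y \<in> fst X" for y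
        using cont_env_valid[OF \<gamma> that]
        by (intro cont_inD[OF IH P] cont_env_update cont_env_const[OF rep] scott_cont_id)
      show "scott_cont X (sem_ity C code T) (\<lambda>y. G ((\<gamma> y)(\<phi> := a)))"
        if "a \<in> fst (sem_ity C code T)" for a
        by (intro cont_inD[OF IH X] cont_env_update \<gamma> pcpo.scott_cont_const[OF P] that)
    qed
  qed
next
  case (in_Lam T1 T2 \<Psi> \<phi> w G)
  show ?case unfolding cont_in_def
  proof (intro impI allI)
    assume rep: "rep_ctx code \<Psi>"
    fix X \<gamma> assume X: "pcpo X" and \<gamma>: "cont_env code \<Psi> X \<gamma>"
    have T1: "representable C code T1" using in_Lam(1) by simp
    note IH = in_Lam(3)[rule_format, OF rep_ctx_update[OF rep T1]]
    note P = pcpo_sem_ity[OF T1] and coded = coded_maps_sem_ity[OF in_Lam(1)]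
    show "scott_cont X (sem_ity C code (Fun T1 T2))
        (\<lambda>y. Fn (code (restrict (\<lambda>x. G ((\<gamma> y)(\<phi> := x))) (fst (sem_ity C code T1)))))"
      unfolding sem_Fun[OF coded]
    proof (rule coded_maps.cont_code[OF coded X])
      show "scott_cont (sem_ity C code T1) (sem_ity C code T2) (\<lambda>x. G ((\<gamma> y)(\<phi> := x)))"
        if "y \<in> fst X" for y
        using cont_env_valid[OF \<gamma> that]
        by (intro cont_inD[OF IH P] cont_env_update cont_env_const[OF rep] scott_cont_id)
      show "scott_cont X (sem_ity C code T2) (\<lambda>y. G ((\<gamma> y)(\<phi> := a)))"
        if "a \<in> fst (sem_ity C code T1)" for a
        by (intro cont_inD[OF IH X] cont_env_update \<gamma> pcpo.scott_cont_const[OF P] that)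
    qed
  qed
next
  case (in_IVar T \<Psi> \<phi>)
  then show ?case by (simp add: cont_in_def cont_env_def)
next
  case (in_IApp \<Psi> w1 T1 T2 G1 w2 G2)
  show ?case unfolding cont_in_def
  proof (intro impI allI)
    assume rep: "rep_ctx code \<Psi>"
    fix X \<gamma> assume X: "pcpo X" and \<gamma>: "cont_env code \<Psi> X \<gamma>"
    note IH1 = in_IApp(2)[rule_format, OF rep] and IH2 = in_IApp(4)[rule_format, OF rep]
    have T: "representable C code (Fun T1 T2)" by (rule iinterp_representable[OF in_IApp(1)])
    then have T12: "representable C code T1" "representable C code T2" by simp_all
    note coded = coded_maps_sem_ity[OF T]
    let ?P = "sem_ity C code T1" and ?Q = "sem_ity C code T2"
    show "scott_cont X ?Q (\<lambda>x. decode code ?P ?Q (G1 (\<gamma> x)) (G2 (\<gamma> x)))"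
    proof (rule scott_cont_bin[OF X pcpo_sem_ity[OF T] pcpo_sem_ity[OF T12(1)] pcpo_sem_ity[OF T12(2)]
          _ _ cont_inD[OF IH1 X \<gamma>] cont_inD[OF IH2 X \<gamma>]])
      show "scott_cont ?P ?Q (decode code ?P ?Q a)" if "a \<in> fst (sem_ity C code (Fun T1 T2))" for a
        using that unfolding sem_Fun[OF coded] by (rule coded_maps.decode_cont[OF coded])
      show "scott_cont (sem_ity C code (Fun T1 T2)) ?Q (\<lambda>a. decode code ?P ?Q a b)" if "b \<in> fst ?P" for b
        using that unfolding sem_Fun[OF coded] by (rule coded_maps.decode_cont_left[OF coded])
    qed
  qed
qed

lemma
  assumes "interp C code \<Psi> \<Delta> t A F" "rep_ctx code \<Psi>" "valid_env code \<Psi> g"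
  shows src_interp: "src C (F g) = sem_ctx C \<Delta>" and tgt_interp: "tgt C (F g) = sem_ty C A"
    and factors_interp: "factors t A (F g)" and total_interp: "is_val t \<Longrightarrow> total (F g)"
  using denotationD[OF interp_cont(1)[OF assms(1), rule_format] assms(2,3)] assms(2) by simp_all

lemma iinterp_closed:
  "iinterp C code \<Psi> w T G \<Longrightarrow> rep_ctx code \<Psi> \<Longrightarrow> valid_env code \<Psi> g \<Longrightarrow> G g \<in> fst (sem_ity C code T)"
  using interp_cont(2) cont_in_closed by blast

end

section \<open>Substitution and the logical relation\<close>

lemma val_irreducible: "is_val v \<Longrightarrow> \<not> red v t"
proof
  assume "red v t" "is_val v"
  then show False by (induction) auto
qed

text \<open>The recursion runs on the value, since the type may grow at \<open>Fold\<close>.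
  Variables satisfy no clause, which builds closedness in.\<close>

fun cval :: "ty \<Rightarrow> trm \<Rightarrow> bool" where
  "cval One Unit = True"
| "cval (Sum A B) (Inl v) = cval A v"
| "cval (Sum A B) (Inr v) = cval B v"
| "cval (Prod A B) (Pair v w) = (cval A v \<and> cval B w)"
| "cval (Mu A) (Fold v) = cval (ty_subst A 0 (Mu A)) v"
| "cval _ _ = False"

lemma cval_is_val: "cval A v \<Longrightarrow> is_val v"
  by (induction A v rule: cval.induct) auto

lemma subst_cval: "cval A v \<Longrightarrow> subst \<sigma> v = v"
  by (induction A v rule: cval.induct) auto

lemma cval_One: "cval One v \<longleftrightarrow> v = Unit"
  by (cases v) auto

lemma cval_Sum: "cval (Sum A B) v \<longleftrightarrow> (\<exists>u. v = Inl u \<and> cval A u) \<or> (\<exists>u. v = Inr u \<and> cval B u)"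
  by (cases v) auto

lemma cval_Prod: "cval (Prod A B) v \<longleftrightarrow> (\<exists>u w. v = Pair u w \<and> cval A u \<and> cval B w)"
  by (cases v) auto

lemma cval_Mu: "cval (Mu A) v \<longleftrightarrow> (\<exists>u. v = Fold u \<and> cval (ty_subst A 0 (Mu A)) u)"
  by (cases v) auto

section \<open>Free iso variables and closing substitutions\<close>

primrec fivt :: "trm \<Rightarrow> ivar set" and fiv :: "iso \<Rightarrow> ivar set" where
  "fivt Unit = {}"
| "fivt (Var x) = {}"
| "fivt (Inl t) = fivt t"
| "fivt (Inr t) = fivt t"
| "fivt (Pair t u) = fivt t \<union> fivt u"
| "fivt (Fold t) = fivt t"
| "fivt (App w t) = fiv w \<union> fivt t"
| "fivt (Let p t u) = fivt t \<union> fivt u"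
| "fiv (Clauses cs) = (\<Union>c\<in>set (map (map_prod fivt fivt) cs). fst c \<union> snd c)"
| "fiv (Fix \<psi> w) = fiv w - {\<psi>}"
| "fiv (Lam \<psi> w) = fiv w - {\<psi>}"
| "fiv (IVar \<psi>) = {\<psi>}"
| "fiv (IApp w1 w2) = fiv w1 \<union> fiv w2"

lemma fiv_Clauses: "fiv (Clauses cs) = (\<Union>c\<in>set cs. fivt (fst c) \<union> fivt (snd c))"
  by simp

lemma isubst_fresh:
  "\<phi> \<notin> fivt t \<Longrightarrow> isubst_trm \<phi> w0 t = t"
  "\<phi> \<notin> fiv w \<Longrightarrow> isubst \<phi> w0 w = w"
proof (induction t and w rule: trm.induct iso.induct)
  case (Clauses cs)
  have "map_prod (isubst_trm \<phi> w0) (isubst_trm \<phi> w0) c = c" if "c \<in> set cs" for c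
    using Clauses.IH(1)[OF that, of "fst c"] Clauses.IH(2)[OF that, of "snd c"] Clauses.prems that
    unfolding fiv_Clauses by (cases c) (auto simp: prod_set_defs)
  then show ?case by (simp add: map_idI)
qed auto

lemma fiv_isubst:
  "fivt (isubst_trm \<phi> w0 t) \<subseteq> (fivt t - {\<phi>}) \<union> fiv w0"
  "fiv (isubst \<phi> w0 w) \<subseteq> (fiv w - {\<phi>}) \<union> fiv w0"
proof (induction t and w rule: trm.induct iso.induct)
  case (Clauses cs)
  have "fivt (isubst_trm \<phi> w0 (fst c)) \<union> fivt (isubst_trm \<phi> w0 (snd c)) \<subseteq>
      (fivt (fst c) \<union> fivt (snd c) - {\<phi>}) \<union> fiv w0" if "c \<in> set cs" for c
    using Clauses.IH(1)[OF that, of "fst c"] Clauses.IH(2)[OF that, of "snd c"]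
    by (cases c) (auto simp: prod_set_defs)
  then show ?case unfolding isubst.simps fiv_Clauses by fastforce
qed auto

text \<open>A list of single substitutions rather than a parallel one: unfolding and beta reduction
  each perform one \<open>isubst\<close>, which becomes a cons on the list.\<close>

definition isubstst :: "(ivar \<times> iso) list \<Rightarrow> trm \<Rightarrow> trm" where
  "isubstst L t = foldr (\<lambda>(\<phi>, w0). isubst_trm \<phi> w0) L t"

definition isubsts :: "(ivar \<times> iso) list \<Rightarrow> iso \<Rightarrow> iso" where
  "isubsts L w = foldr (\<lambda>(\<phi>, w0). isubst \<phi> w0) L w"

abbreviation unbind :: "ivar \<Rightarrow> (ivar \<times> iso) list \<Rightarrow> (ivar \<times> iso) list" where
  "unbind \<phi> L \<equiv> filter (\<lambda>p. fst p \<noteq> \<phi>) L"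

lemma isubsts_Cons: "isubsts ((\<phi>, w0) # L) w = isubst \<phi> w0 (isubsts L w)"
  by (simp add: isubsts_def)

lemma isubstst_simps [simp]:
  "isubstst L Unit = Unit"
  "isubstst L (Var x) = Var x"
  "isubstst L (Inl t) = Inl (isubstst L t)"
  "isubstst L (Inr t) = Inr (isubstst L t)"
  "isubstst L (Pair t u) = Pair (isubstst L t) (isubstst L u)"
  "isubstst L (Fold t) = Fold (isubstst L t)"
  "isubstst L (App w t) = App (isubsts L w) (isubstst L t)"
  "isubstst L (Let p t u) = Let p (isubstst L t) (isubstst L u)"
  by (induction L) (auto simp: isubstst_def isubsts_def)

lemma isubstst_Nil: "isubstst [] = (\<lambda>t. t)"
  by (simp add: isubstst_def fun_eq_iff)

lemma isubsts_simps [simp]: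
  "isubsts L (Clauses cs) = Clauses (map (map_prod (isubstst L) (isubstst L)) cs)"
  "isubsts L (Fix \<psi> w) = Fix \<psi> (isubsts (unbind \<psi> L) w)"
  "isubsts L (Lam \<psi> w) = Lam \<psi> (isubsts (unbind \<psi> L) w)"
  "isubsts L (IApp w1 w2) = IApp (isubsts L w1) (isubsts L w2)"
proof (induction L)
  case Nil
  show "isubsts [] (Clauses cs) = Clauses (map (map_prod (isubstst []) (isubstst [])) cs)"
    by (simp add: isubstst_Nil isubsts_def prod.map_ident)
qed (auto simp: isubstst_def isubsts_def prod.map_comp o_def)

lemma isubstst_val: "is_val v \<Longrightarrow> isubstst L v = v"
  by (induction v rule: is_val.induct) auto

lemma fiv_isubsts:
  "\<forall>p\<in>set L. fiv (snd p) = {} \<Longrightarrow> fiv (isubsts L w) \<subseteq> fiv w - fst ` set L"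
proof (induction L)
  case (Cons p L)
  then show ?case using fiv_isubst(2)[of "fst p" "snd p" "isubsts L w"]
    by (cases p) (auto simp: isubsts_Cons)
qed (simp add: isubsts_def)

text \<open>What has been substituted for \<open>\<psi>\<close> so far is closed or
  \<open>\<psi>\<close> itself, so the entries for \<open>\<phi>\<close> find no occurrence to act
  on.\<close>

lemma isubsts_IVar_unbind:
  assumes "\<forall>p\<in>set L. fiv (snd p) = {}" "\<psi> \<noteq> \<phi>"
  shows "isubsts (unbind \<phi> L) (IVar \<psi>) = isubsts L (IVar \<psi>)"
  using assms(1)
proof (induction L)
  case (Cons p L)
  obtain \<chi> u where p: "p = (\<chi>, u)" by fastforce
  have IH: "isubsts (unbind \<phi> L) (IVar \<psi>) = isubsts L (IVar \<psi>)" using Cons by simp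
  have "\<phi> \<notin> fiv (isubsts L (IVar \<psi>))" using fiv_isubsts[of L "IVar \<psi>"] Cons.prems assms(2) by auto
  then show ?case using IH by (simp add: p isubsts_Cons isubst_fresh)
qed simp

lemma isubsts_IVar_fresh: "\<psi> \<notin> fst ` set L \<Longrightarrow> isubsts L (IVar \<psi>) = IVar \<psi>"
  by (induction L) (auto simp: isubsts_def)

lemma interp_fiv:
  "interp C code \<Psi> \<Delta> t A F \<Longrightarrow> fivt t \<subseteq> dom \<Psi>"
  "iinterp C code \<Psi> w T G \<Longrightarrow> fiv w \<subseteq> dom \<Psi>"
proof (induction rule: interp_iinterp.inducts)
  case (in_Clauses A B cs \<Psi> \<Delta> V E)
  then show ?case unfolding fiv_Clauses by (fastforce simp: in_set_conv_nth)
next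
  case (in_Fix \<Psi> \<phi> T w G)
  have "fiv w \<subseteq> insert \<phi> (dom \<Psi>)" using in_Fix(2) by (auto simp: dom_def split: if_splits)
  then show ?case by auto
next
  case (in_Lam T1 T2 \<Psi> \<phi> w G)
  have "fiv w \<subseteq> insert \<phi> (dom \<Psi>)" using in_Lam(3) by (auto simp: dom_def split: if_splits)
  then show ?case by auto
qed auto

lemma interp_distinct:
  "interp C code \<Psi> \<Delta> t A F \<Longrightarrow> distinct (map fst \<Delta>)"
  "iinterp C code \<Psi> w T G \<Longrightarrow> True"
  by (induction rule: interp_iinterp.inducts) auto

text \<open>Closedness is expressed by invariance under substitution, which spares a definition of
  free term variables.\<close>

definition closed_subst :: "(var \<rightharpoonup> trm) \<Rightarrow> bool" where
  "closed_subst \<sigma> \<longleftrightarrow> (\<forall>x v \<tau>. \<sigma> x = Some v \<longrightarrow> subst \<tau> v = v)"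

lemma subst_subst: "closed_subst \<sigma> \<Longrightarrow> subst \<tau> (subst \<sigma> t) = subst (\<tau> ++ \<sigma>) t"
proof (induction \<sigma> t arbitrary: \<tau> rule: subst.induct)
  case (8 \<sigma> p t u)
  have "closed_subst (\<sigma> |` (- pat_vars p))" using 8(3) by (simp add: closed_subst_def restrict_map_def)
  moreover have "\<tau> |` (- pat_vars p) ++ \<sigma> |` (- pat_vars p) = (\<tau> ++ \<sigma>) |` (- pat_vars p)"
    by (auto simp: restrict_map_def map_add_def split: option.split)
  ultimately show ?case using 8 by simp
qed (auto simp: closed_subst_def map_add_def split: option.split)

lemma subst_empty: "subst Map.empty t = t"
proof -
  have "\<sigma> = Map.empty \<Longrightarrow> subst \<sigma> t = t" for \<sigma>
    by (induction \<sigma> t rule: subst.induct) (auto simp: restrict_map_def)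
  then show ?thesis by simp
qed

lemma subst_val_cong:
  "is_val v \<Longrightarrow> (\<And>x. x \<in> val_vars v \<Longrightarrow> \<sigma> x = \<tau> x) \<Longrightarrow> subst \<sigma> v = subst \<tau> v"
  by (induction v rule: is_val.induct) auto

text \<open>One layer of evaluation context, given by the properties that \<open>rel_bind\<close>
  uses. For applications the head must be a clause set, as any other iso is reduced before its
  argument.\<close>

definition eval_frame :: "(trm \<Rightarrow> trm) \<Rightarrow> bool" where
  "eval_frame K \<longleftrightarrow> (\<forall>t t'. red t t' \<longrightarrow> red (K t) (K t')) \<and>
     (\<forall>t u. \<not> is_val t \<longrightarrow> red (K t) u \<longrightarrow> (\<exists>t'. u = K t' \<and> red t t')) \<and>
     (\<forall>t. is_val (K t) \<longrightarrow> is_val t)"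

inductive_cases red_AppE: "red (App w t) u"
inductive_cases red_LetE: "red (Let p t u) s"
inductive_cases red_InlE: "red (Inl t) u"
inductive_cases red_InrE: "red (Inr t) u"
inductive_cases red_FoldE: "red (Fold t) u"
inductive_cases red_PairE: "red (Pair t u) s"
inductive_cases ired_ClausesE: "ired (Clauses cs) w"
inductive_cases ired_LamE: "ired (Lam \<phi> w) w'"
inductive_cases ired_FixE: "ired (Fix \<phi> w) w'"
inductive_cases ired_IAppE: "ired (IApp w1 w2) w'"

lemma eval_frames:
  "eval_frame Inl" "eval_frame Inr" "eval_frame Fold" "eval_frame (App (Clauses cs))"
  "eval_frame (\<lambda>t. Let p t u)" "eval_frame (\<lambda>t. Pair t u)" "is_val v \<Longrightarrow> eval_frame (Pair v)"
  unfolding eval_frame_def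
  by (auto intro: red.intros elim!: red_InlE red_InrE red_FoldE red_AppE red_LetE red_PairE ired_ClausesE
      dest: val_irreducible)

section \<open>The logical relation\<close>

context dcpo_join_inverse_rig_category
begin

abbreviation "I \<equiv> one_ob C"
abbreviation "lI \<equiv> lunit (mult C) I"

text \<open>A denotation of closed values that refers to no derivation. For pairs,
  \<open>pinv C lI\<close> splits the unit into two copies.\<close>

fun vden :: "ty \<Rightarrow> trm \<Rightarrow> 'b" where
  "vden One Unit = idm C I"
| "vden (Sum A B) (Inl v) = inj_l C (sem_ty C A) (sem_ty C B) \<cdot> vden A v"
| "vden (Sum A B) (Inr v) = inj_r C (sem_ty C A) (sem_ty C B) \<cdot> vden B v"
| "vden (Prod A B) (Pair v w) = (vden A v \<otimes>\<^sub>m[C] vden B w) \<cdot> pinv C lI"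
| "vden (Mu A) (Fold v) = fold_ar C A \<cdot> vden (ty_subst A 0 (Mu A)) v"
| "vden _ _ = undefined"

lemma vden_props: "cval A v \<Longrightarrow> src C (vden A v) = I \<and> tgt C (vden A v) = sem_ty C A \<and> total (vden A v)"
  by (induction A v rule: cval.induct)
    (auto intro!: total_comp total_mult is_iso_pinv_total simp: is_iso_total total_def[of "inj_l _ _ _"] total_def[of "inj_r _ _ _"])

lemma src_vden [simp]: "cval A v \<Longrightarrow> src C (vden A v) = I"
  and tgt_vden [simp]: "cval A v \<Longrightarrow> tgt C (vden A v) = sem_ty C A"
  and total_vden: "cval A v \<Longrightarrow> total (vden A v)"
  by (simp_all add: vden_props)

text \<open>
  \<open>b = True\<close> is adequacy and \<open>b = False\<close> is soundness of evaluations of length at most \<open>n\<close>. The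
  flag lets one fundamental lemma prove both; only its case of fixed points depends on \<open>b\<close>.
\<close>

definition rel :: "bool \<Rightarrow> nat \<Rightarrow> ty \<Rightarrow> trm \<Rightarrow> 'b \<Rightarrow> bool" where
  "rel b n A t f \<longleftrightarrow>
     (if b then f \<noteq> zero C I (sem_ty C A) \<longrightarrow> (\<exists>v. red\<^sup>*\<^sup>* t v \<and> cval A v \<and> f = vden A v)
      else \<forall>k\<le>n. \<forall>v. (red ^^ k) t v \<longrightarrow> is_val v \<longrightarrow> cval A v \<and> f = vden A v)"

text \<open>The indices at which a reduct has to be related: adequacy keeps the index constant,
  while for soundness every step lowers it, which pays for unfolding a fixed point.\<close>

definition later :: "bool \<Rightarrow> nat \<Rightarrow> nat \<Rightarrow> bool" where
  "later b n m \<longleftrightarrow> (if b then m = n else m < n)"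

lemma rel_mono: "rel b n A t f \<Longrightarrow> m \<le> n \<Longrightarrow> rel b m A t f"
  unfolding rel_def by (cases b) (simp_all, meson order_trans)

text \<open>Head expansion for both modes. Adequacy asks for a step only when the denotation is
  nonzero, so a stuck term may be related to a zero map.\<close>

lemma rel_expand:
  assumes "\<not> is_val t" "\<And>t' m. red t t' \<Longrightarrow> later b n m \<Longrightarrow> rel b m A t' f"
    "b \<Longrightarrow> f \<noteq> zero C I (sem_ty C A) \<Longrightarrow> \<exists>t'. red t t'"
  shows "rel b n A t f"
proof (cases b)
  case True
  then show ?thesis using assms(2)[of _ n] assms(3)
    by (auto simp: rel_def later_def) (meson converse_rtranclp_into_rtranclp)
next
  case False
  have "cval A v \<and> f = vden A v" if k: "k \<le> n" "(red ^^ k) t v" "is_val v" for k v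
  proof (cases k)
    case 0 then show ?thesis using k assms(1) by simp
  next
    case (Suc j)
    then obtain t' where "red t t'" "(red ^^ j) t' v" using k(2) relpowp_Suc_D2 by metis
    then show ?thesis using assms(2)[of t' j] False k Suc by (auto simp: rel_def later_def)
  qed
  then show ?thesis using False by (simp add: rel_def)
qed

lemma rel_value: assumes "cval A v" shows "rel b n A v (vden A v)"
proof -
  have "k = 0" if "(red ^^ k) v u" for k u
    using that val_irreducible[OF cval_is_val[OF assms]] by (cases k) (auto simp del: relpowp.simps dest!: relpowp_Suc_D2)
  then show ?thesis using assms by (fastforce simp: rel_def)
qed

text \<open>The argument of a frame is evaluated before the frame itself. Adequacy needs strictness
  of \<open>H\<close> for an argument that denotes zero; soundness is by induction on the index,
  since a step of \<open>K t\<close> with \<open>t\<close> not yet a value is a step of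
  \<open>t\<close>.\<close>

lemma rel_bind:
  assumes K: "eval_frame K" and H: "H (zero C I (sem_ty C A)) = zero C I (sem_ty C B)"
    and "rel b n A t f"
    and "\<And>m v. m \<le> n \<Longrightarrow> cval A v \<Longrightarrow> rel b m B (K v) (H (vden A v))"
  shows "rel b n B (K t) (H f)"
proof (cases b)
  case True
  show ?thesis
  proof (cases "f = zero C I (sem_ty C A)")
    case True
    then show ?thesis using H \<open>b\<close> by (simp add: rel_def)
  next
    case False
    then obtain v where v: "red\<^sup>*\<^sup>* t v" "cval A v" "f = vden A v"
      using assms(3) \<open>b\<close> by (auto simp: rel_def)
    have "red\<^sup>*\<^sup>* (K t) (K v)" using v(1)
      by (induction rule: rtranclp_induct) (use K in \<open>auto simp: eval_frame_def intro: rtranclp.rtrancl_into_rtrancl\<close>)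
    then show ?thesis using assms(4)[OF _ v(2), of n] v(3) \<open>b\<close>
      by (auto simp: rel_def intro: rtranclp_trans)
  qed
next
  case False
  then show ?thesis using assms(3,4)
  proof (induction n arbitrary: t rule: less_induct)
    case (less n)
    show ?case
    proof (cases "is_val t")
      case True
      then have "cval A t" "f = vden A t" using less.prems(2) \<open>\<not> b\<close> by (auto simp: rel_def)
      then show ?thesis using less.prems(3)[of n t] by simp
    next
      case nval: False
      show ?thesis
      proof (rule rel_expand)
        show "\<not> is_val (K t)" using K nval by (auto simp: eval_frame_def)
        fix u m assume u: "red (K t) u" "later b n m"
        then obtain t' where t': "u = K t'" "red t t'" using K nval unfolding eval_frame_def by blast
        have m: "m < n" using u \<open>\<not> b\<close> by (simp add: later_def)
        have "rel b m A t' f" unfolding rel_def using \<open>\<not> b\<close> less.prems(2) t'(2) m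
          by (auto simp: rel_def) (metis Suc_leI le_less_trans relpowp_Suc_I2)+
        then show "rel b m B u (H f)" unfolding t'(1)
          using m \<open>\<not> b\<close> less.prems(3) by (intro less.IH) auto
      qed (use \<open>\<not> b\<close> in simp)
    qed
  qed
qed

text \<open>Closedness is included because related isos get substituted under binders. The
  quantifier over smaller indices makes the relation monotone; recursive base types cause no
  circularity, as \<open>rel\<close> speaks of closed values directly.\<close>

primrec irel :: "('b, 'd) coding \<Rightarrow> bool \<Rightarrow> ity \<Rightarrow> nat \<Rightarrow> iso \<Rightarrow> ('b, 'd) sem \<Rightarrow> bool" where
  "irel code b (A \<leftrightarrow> B) n w d \<longleftrightarrow> fiv w = {} \<and>
     (\<forall>m\<le>n. \<forall>t f. f \<in> hom C I (sem_ty C A) \<longrightarrow> rel b m A t f \<longrightarrow> rel b m B (App w t) (mor d \<cdot> f))"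
| "irel code b (Fun T1 T2) n w d \<longleftrightarrow> fiv w = {} \<and>
     (\<forall>m\<le>n. \<forall>w' d'. d' \<in> fst (sem_ity C code T1) \<longrightarrow> irel code b T1 m w' d' \<longrightarrow>
       irel code b T2 m (IApp w w') (decode code (sem_ity C code T1) (sem_ity C code T2) d d'))"

lemma irel_mono: "irel code b T n w d \<Longrightarrow> m \<le> n \<Longrightarrow> irel code b T m w d"
  by (cases T) auto

lemma irel_closed: "irel code b T n w d \<Longrightarrow> fiv w = {}"
  by (cases T) auto

text \<open>Induction over the iso type lifts the step of \<open>w\<close> to
  \<open>IApp w u\<close> and finally to \<open>App w t\<close>. A reducible iso is neither a clause
  set nor an abstraction, so its step is the only one there too.\<close>

lemma irel_expand:
  assumes "ired w w'" "\<And>w''. ired w w'' \<Longrightarrow> w'' = w'" "fiv w = {}"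
    "\<And>m. later b n m \<Longrightarrow> irel code b T m w' d"
  shows "irel code b T n w d"
  using assms
proof (induction T arbitrary: n w w' d)
  case (Iso A B)
  have w': "irel code b (A \<leftrightarrow> B) k w' d" if "later b m k" "m \<le> n" for m k
    using that Iso.prems(4)[of n] Iso.prems(4)[of k] irel_mono[of code b "A \<leftrightarrow> B" n w' d k]
    by (auto simp: later_def split: if_splits)
  have not_Clauses: "w \<noteq> Clauses cs" for cs
    using Iso.prems(1) by (blast elim: ired_ClausesE)
  have "rel b m B (App w t) (mor d \<cdot> f)"
    if m: "m \<le> n" and f: "f \<in> hom C I (sem_ty C A)" "rel b m A t f" for m t f
  proof (rule rel_expand)
    show "\<exists>t'. red (App w t) t'" using red_iso[OF Iso.prems(1)] by blast
    fix t' k assume t': "red (App w t) t'" and k: "later b m k"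
    have "t' = App w' t"
      using t' by (rule red_AppE) (use not_Clauses Iso.prems(2) in blast)+
    moreover have "k \<le> m" using k by (auto simp: later_def split: if_splits)
    ultimately show "rel b k B t' (mor d \<cdot> f)"
      using w'[OF k m] f rel_mono[of b m A t f k] by simp
  qed simp
  then show ?case using Iso.prems(3) by simp
next
  case (Fun T1 T2)
  have w': "irel code b (Fun T1 T2) k w' d" if "later b m k" "m \<le> n" for m k
    using that Fun.prems(4)[of n] Fun.prems(4)[of k] irel_mono[of code b "Fun T1 T2" n w' d k]
    by (auto simp: later_def split: if_splits)
  have not_Lam: "w \<noteq> Lam \<phi> w0" for \<phi> w0
    using Fun.prems(1) by (blast elim: ired_LamE)
  have "irel code b T2 m (IApp w u) (decode code (sem_ity C code T1) (sem_ity C code T2) d e)"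
    if m: "m \<le> n" and u: "e \<in> fst (sem_ity C code T1)" "irel code b T1 m u e" for m u e
  proof (rule Fun.IH(2))
    show "ired (IApp w u) (IApp w' u)" using Fun.prems(1) by (rule ired_IApp)
    show "w'' = IApp w' u" if "ired (IApp w u) w''" for w''
      using that by (rule ired_IAppE) (use not_Lam Fun.prems(2) in blast)+
    show "fiv (IApp w u) = {}" using Fun.prems(3) irel_closed[OF u(2)] by simp
    fix k assume k: "later b m k"
    have "k \<le> m" using k by (auto simp: later_def split: if_splits)
    then show "irel code b T2 k (IApp w' u) (decode code (sem_ity C code T1) (sem_ity C code T2) d e)"
      using w'[OF k m] u irel_mono[OF u(2)] by simp
  qed
  then show ?case using Fun.prems(3) by simp
qed

text \<open>At \<open>A \<leftrightarrow> B\<close> the least element is the zero map, of whose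
  values adequacy demands nothing; at function types it is constantly the least element.\<close>

lemma irel_bot:
  "representable C code T \<Longrightarrow> fiv w = {} \<Longrightarrow> irel code True T n w (pcpo.bot (sem_ity C code T))"
proof (induction T arbitrary: n w)
  case (Iso A B)
  interpret P: pcpo "sem_ity C code (A \<leftrightarrow> B)" by (rule pcpo_Iso)
  have "mor P.bot \<in> hom C (sem_ty C A) (sem_ty C B)" using P.bot_in by auto
  moreover have "le C (mor P.bot) (zero C (sem_ty C A) (sem_ty C B))"
    using P.bot_least[of "Mor (zero C (sem_ty C A) (sem_ty C B))"] by (simp add: hom_iff)
  ultimately have "mor P.bot = zero C (sem_ty C A) (sem_ty C B)"
    by (simp add: hom_iff le_zeroD)
  then show ?case using Iso.prems by (simp add: rel_def hom_iff)
next
  case (Fun T1 T2)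
  note coded = coded_maps_sem_ity[OF Fun.prems(1)]
  show ?case using Fun by (auto simp: sem_Fun[OF coded] coded_maps.decode_bot[OF coded] irel_closed
    simp del: sem_ity.simps)
qed

lemma irel_lub:
  assumes "representable C code T" "S \<subseteq> fst (sem_ity C code T)" "is_directed (snd (sem_ity C code T)) S"
    "is_lub (fst (sem_ity C code T)) (snd (sem_ity C code T)) S d"
    "\<And>s. s \<in> S \<Longrightarrow> irel code True T n w s"
  shows "irel code True T n w d"
  using assms
proof (induction T arbitrary: n w d S)
  case (Iso A B)
  let ?P = "sem_ity C code (A \<leftrightarrow> B)"
  interpret P: pcpo ?P by (rule pcpo_Iso)
  obtain s0 where s0: "s0 \<in> S" using directed_nonempty[OF Iso.prems(3)] by auto
  have d: "d \<in> fst ?P" by (rule lub_in[OF Iso.prems(4)])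
  have "rel True m B (App w t) (mor d \<cdot> f)"
    if m: "m \<le> n" and f: "f \<in> hom C I (sem_ty C A)" "rel True m A t f" for m t f
  proof -
    have ft: "src C f = I" "tgt C f = sem_ty C A" using f(1) by (simp_all add: hom_iff)
    have dt: "src C (mor d) = sem_ty C A" "tgt C (mor d) = sem_ty C B" using d by (auto simp: hom_iff)
    have st: "src C (mor s) = sem_ty C A" "tgt C (mor s) = sem_ty C B" if "s \<in> S" for s
      using that Iso.prems(2) by (auto simp: hom_iff)
    have "scott_cont ?P (homP I (sem_ty C B)) (\<lambda>s. mor s \<cdot> f)"
      using P.scott_cont_comp[OF mor_cont comp_cont_left[of f "sem_ty C A" "sem_ty C B"]] ft by simp
    then have lub: "is_lub (hom C I (sem_ty C B)) (le C) ((\<lambda>s. mor s \<cdot> f) ` S) (mor d \<cdot> f)"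
      using scott_contD[OF _ Iso.prems(2-4)] by fastforce
    show ?thesis
    \<comment> \<open>If every approximant vanishes on \<open>f\<close>, so does the limit;
      otherwise one approximant that does not vanish supplies the value.\<close>
    proof (cases "\<forall>s\<in>S. mor s \<cdot> f = zero C I (sem_ty C B)")
      case True
      have "le C (mor d \<cdot> f) (zero C I (sem_ty C B))"
        by (rule lub_least[OF lub]) (use True in \<open>auto simp: hom_iff le_refl\<close>)
      then show ?thesis using le_zeroD[of "mor d \<cdot> f"] ft dt by (simp add: rel_def)
    next
      case False
      then obtain s where s: "s \<in> S" "mor s \<cdot> f \<noteq> zero C I (sem_ty C B)" by auto
      have "rel True m B (App w t) (mor s \<cdot> f)" using Iso.prems(5)[OF s(1)] m f by simp
      then obtain v where v: "red\<^sup>*\<^sup>* (App w t) v" "cval B v" "mor s \<cdot> f = vden B v"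
        using s(2) by (auto simp: rel_def)
      have "le C (mor s \<cdot> f) (mor d \<cdot> f)" using s(1) by (intro lub_upper[OF lub]) blast
      then have "le C (vden B v) (mor d \<cdot> f)" by (simp only: v(3))
      then have "vden B v = mor d \<cdot> f"
        by (intro le_total) (simp_all add: v(2) ft dt total_vden)
      then show ?thesis using v by (auto simp: rel_def)
    qed
  qed
  then show ?case using irel_closed[OF Iso.prems(5)[OF s0]] by simp
next
  case (Fun T1 T2)
  note coded = coded_maps_sem_ity[OF Fun.prems(1)]
  let ?dec = "decode code (sem_ity C code T1) (sem_ity C code T2)"
  obtain s0 where s0: "s0 \<in> S" using directed_nonempty[OF Fun.prems(3)] by auto
  have S: "S \<subseteq> fst (coded_maps.maps (sem_ity C code T1) (sem_ity C code T2) code)"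
    "is_directed (snd (coded_maps.maps (sem_ity C code T1) (sem_ity C code T2) code)) S"
    "is_lub (fst (coded_maps.maps (sem_ity C code T1) (sem_ity C code T2) code))
      (snd (coded_maps.maps (sem_ity C code T1) (sem_ity C code T2) code)) S d"
    using Fun.prems(2-4) unfolding sem_Fun[OF coded] by blast+
  have "irel code True T2 m (IApp w u) (?dec d e)"
    if m: "m \<le> n" and u: "e \<in> fst (sem_ity C code T1)" "irel code True T1 m u e" for m u e
  proof (rule Fun.IH(2))
    show "representable C code T2" using Fun.prems(1) by simp
    show "(\<lambda>s. ?dec s e) ` S \<subseteq> fst (sem_ity C code T2)"
      using coded_maps.dec_fst[OF coded _ u(1)] S(1) by blast
    show "is_directed (snd (sem_ity C code T2)) ((\<lambda>s. ?dec s e) ` S)"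
      by (rule coded_maps.pointwise_directed[OF coded S(2) u(1)])
    show "is_lub (fst (sem_ity C code T2)) (snd (sem_ity C code T2)) ((\<lambda>s. ?dec s e) ` S) (?dec d e)"
      by (rule coded_maps.decode_lub[OF coded S u(1)])
    show "irel code True T2 m (IApp w u) s" if "s \<in> (\<lambda>s. ?dec s e) ` S" for s
      using that Fun.prems(5) m u by auto
  qed
  then show ?case using irel_closed[OF Fun.prems(5)[OF s0]] by simp
qed

end

section \<open>Values and matching\<close>

context dcpo_join_inverse_rig_category
begin

section \<open>Closing substitutions as points of a context\<close>

primrec sden :: "(var \<rightharpoonup> trm) \<Rightarrow> ctx \<Rightarrow> 'b" where
  "sden \<sigma> [] = idm C I"
| "sden \<sigma> (xA # \<Delta>) = (vden (snd xA) (the (\<sigma> (fst xA))) \<otimes>\<^sub>m[C] sden \<sigma> \<Delta>) \<cdot> pinv C lI"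

definition closes :: "(var \<rightharpoonup> trm) \<Rightarrow> ctx \<Rightarrow> bool" where
  "closes \<sigma> \<Delta> \<longleftrightarrow> (\<forall>(x, A)\<in>set \<Delta>. \<exists>v. \<sigma> x = Some v \<and> cval A v)"

lemma closes_simps [simp]:
  "closes \<sigma> []"
  "closes \<sigma> ((x, A) # \<Delta>) \<longleftrightarrow> (\<exists>v. \<sigma> x = Some v \<and> cval A v) \<and> closes \<sigma> \<Delta>"
  "closes \<sigma> (\<Delta>1 @ \<Delta>2) \<longleftrightarrow> closes \<sigma> \<Delta>1 \<and> closes \<sigma> \<Delta>2"
  by (simp_all add: closes_def ball_Un)

lemma src_sden [simp]: "closes \<sigma> \<Delta> \<Longrightarrow> src C (sden \<sigma> \<Delta>) = I"
  and tgt_sden [simp]: "closes \<sigma> \<Delta> \<Longrightarrow> tgt C (sden \<sigma> \<Delta>) = sem_ctx C \<Delta>"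
  by (induction \<Delta>) auto

lemma sden_cong: "(\<And>x. x \<in> fst ` set \<Delta> \<Longrightarrow> \<sigma> x = \<tau> x) \<Longrightarrow> sden \<sigma> \<Delta> = sden \<tau> \<Delta>"
  by (induction \<Delta>) auto

lemma closes_cong: "(\<And>x. x \<in> fst ` set \<Delta> \<Longrightarrow> \<sigma> x = \<tau> x) \<Longrightarrow> closes \<sigma> \<Delta> = closes \<tau> \<Delta>"
  by (force simp: closes_def)

lemma pinv_lunit_natural: "src C f = I \<Longrightarrow>
    (idm C I \<otimes>\<^sub>m[C] f) \<cdot> pinv C lI = pinv C (lunit (mult C) (tgt C f)) \<cdot> f"
  using pinv_natural[OF _ _ T.lunit_natural[of f]] by simp

lemma assc_unit: "pinv C (assc (mult C) I I I) \<cdot> (idm C I \<otimes>\<^sub>m[C] pinv C lI) = pinv C lI \<otimes>\<^sub>m[C] idm C I"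
proof -
  have "pinv C ((idm C I \<otimes>\<^sub>m[C] lI) \<cdot> assc (mult C) I I I) = pinv C (lI \<otimes>\<^sub>m[C] idm C I)"
    using T.triangle[of I I] by (simp only: T.lunit_unit_eq_runit_unit)
  then show ?thesis by simp
qed

text \<open>Reassociates three points: naturality moves the associator to the units, where the
  triangle and the agreement of the two unitors absorb it.\<close>

lemma assc_pinv_natural:
  "src C f = I \<Longrightarrow> src C g = I \<Longrightarrow> src C h = I \<Longrightarrow>
    pinv C (assc (mult C) (tgt C f) (tgt C g) (tgt C h)) \<cdot> (f \<otimes>\<^sub>m[C] ((g \<otimes>\<^sub>m[C] h) \<cdot> pinv C lI)) \<cdot> pinv C lI
      = (((f \<otimes>\<^sub>m[C] g) \<cdot> pinv C lI) \<otimes>\<^sub>m[C] h) \<cdot> pinv C lI"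
proof -
  assume t: "src C f = I" "src C g = I" "src C h = I"
  let ?a = "pinv C (assc (mult C) (tgt C f) (tgt C g) (tgt C h))"
  have nat: "((f \<otimes>\<^sub>m[C] g) \<otimes>\<^sub>m[C] h) \<cdot> pinv C (assc (mult C) I I I) = ?a \<cdot> (f \<otimes>\<^sub>m[C] (g \<otimes>\<^sub>m[C] h))"
    using pinv_natural[OF _ _ T.assc_natural[of f g h]] t by simp
  have "?a \<cdot> (f \<otimes>\<^sub>m[C] ((g \<otimes>\<^sub>m[C] h) \<cdot> pinv C lI)) \<cdot> pinv C lI
      = (?a \<cdot> (f \<otimes>\<^sub>m[C] (g \<otimes>\<^sub>m[C] h))) \<cdot> (idm C I \<otimes>\<^sub>m[C] pinv C lI) \<cdot> pinv C lI"
    using t by simp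
  also have "\<dots> = ((f \<otimes>\<^sub>m[C] g) \<otimes>\<^sub>m[C] h) \<cdot> (pinv C (assc (mult C) I I I) \<cdot> (idm C I \<otimes>\<^sub>m[C] pinv C lI)) \<cdot> pinv C lI"
    unfolding nat[symmetric] using t by simp
  also have "\<dots> = (((f \<otimes>\<^sub>m[C] g) \<cdot> pinv C lI) \<otimes>\<^sub>m[C] h) \<cdot> pinv C lI"
    unfolding assc_unit using t by simp
  finally show ?thesis .
qed

lemma split_sden: "closes \<sigma> (\<Delta>1 @ \<Delta>2) \<Longrightarrow>
    split C \<Delta>1 \<Delta>2 \<cdot> sden \<sigma> (\<Delta>1 @ \<Delta>2) = (sden \<sigma> \<Delta>1 \<otimes>\<^sub>m[C] sden \<sigma> \<Delta>2) \<cdot> pinv C lI"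
proof (induction \<Delta>1)
  case Nil
  then show ?case using pinv_lunit_natural[of "sden \<sigma> \<Delta>2"] by simp
next
  case (Cons xA \<Delta>1)
  obtain x A where xA: "xA = (x, A)" by fastforce
  from Cons.prems obtain v where v: "\<sigma> x = Some v" "cval A v" by (auto simp: xA)
  have c: "closes \<sigma> \<Delta>1" "closes \<sigma> \<Delta>2" using Cons.prems by (simp_all add: xA)
  have "split C (xA # \<Delta>1) \<Delta>2 \<cdot> sden \<sigma> ((xA # \<Delta>1) @ \<Delta>2)
      = pinv C (assc (mult C) (sem_ty C A) (sem_ctx C \<Delta>1) (sem_ctx C \<Delta>2))
        \<cdot> (vden A v \<otimes>\<^sub>m[C] (split C \<Delta>1 \<Delta>2 \<cdot> sden \<sigma> (\<Delta>1 @ \<Delta>2))) \<cdot> pinv C lI"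
    using v c by (simp add: xA)
  also have "\<dots> = (((vden A v \<otimes>\<^sub>m[C] sden \<sigma> \<Delta>1) \<cdot> pinv C lI) \<otimes>\<^sub>m[C] sden \<sigma> \<Delta>2) \<cdot> pinv C lI"
    unfolding Cons.IH[OF closes_simps(3)[THEN iffD2, OF conjI[OF c]]]
    using assc_pinv_natural[of "vden A v" "sden \<sigma> \<Delta>1" "sden \<sigma> \<Delta>2"] v c by simp
  finally show ?case using v by (simp add: xA)
qed

text \<open>Naturality reduces the exchange of two points to the symmetry on the unit, which is the
  identity.\<close>

lemma symm_sden: "src C f = I \<Longrightarrow> src C g = I \<Longrightarrow>
    symm (mult C) (tgt C f) (tgt C g) \<cdot> (f \<otimes>\<^sub>m[C] g) \<cdot> pinv C lI = (g \<otimes>\<^sub>m[C] f) \<cdot> pinv C lI"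
proof -
  assume t: "src C f = I" "src C g = I"
  have "symm (mult C) (tgt C f) (tgt C g) \<cdot> (f \<otimes>\<^sub>m[C] g) \<cdot> pinv C lI
      = (symm (mult C) (tgt C f) (tgt C g) \<cdot> (f \<otimes>\<^sub>m[C] g)) \<cdot> pinv C lI" using t by simp
  also have "\<dots> = (g \<otimes>\<^sub>m[C] f) \<cdot> pinv C lI"
    unfolding T.symm_natural using t by (simp add: T.symm_unit_unit)
  finally show ?thesis .
qed

text \<open>The two points are brought together by reassociating, swapped and reassociated back;
  deeper positions follow by tensoring with the preceding point.\<close>

lemma exch_sden: "closes \<sigma> (\<Delta>1 @ (y, B) # (x, A) # \<Delta>2) \<Longrightarrow>
    exch C \<Delta>1 B A \<Delta>2 \<cdot> sden \<sigma> (\<Delta>1 @ (y, B) # (x, A) # \<Delta>2) = sden \<sigma> (\<Delta>1 @ (x, A) # (y, B) # \<Delta>2)"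
proof (induction \<Delta>1)
  case Nil
  then obtain v w where v: "\<sigma> x = Some v" "cval A v" and w: "\<sigma> y = Some w" "cval B w"
    and c: "closes \<sigma> \<Delta>2" by auto
  let ?s = "sden \<sigma> \<Delta>2"
  let ?f = "vden A v" and ?g = "vden B w"
  have "exch C [] B A \<Delta>2 \<cdot> sden \<sigma> ((y, B) # (x, A) # \<Delta>2)
      = assc (mult C) (sem_ty C A) (sem_ty C B) (sem_ctx C \<Delta>2)
        \<cdot> (symm (mult C) (sem_ty C B) (sem_ty C A) \<otimes>\<^sub>m[C] idm C (sem_ctx C \<Delta>2))
        \<cdot> (pinv C (assc (mult C) (sem_ty C B) (sem_ty C A) (sem_ctx C \<Delta>2))
          \<cdot> (?g \<otimes>\<^sub>m[C] ((?f \<otimes>\<^sub>m[C] ?s) \<cdot> pinv C lI)) \<cdot> pinv C lI)"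
    using v w c by simp
  also have "\<dots> = assc (mult C) (sem_ty C A) (sem_ty C B) (sem_ctx C \<Delta>2)
        \<cdot> ((symm (mult C) (sem_ty C B) (sem_ty C A) \<cdot> (?g \<otimes>\<^sub>m[C] ?f) \<cdot> pinv C lI) \<otimes>\<^sub>m[C] ?s) \<cdot> pinv C lI"
    using assc_pinv_natural[of ?g ?f ?s] v w c by simp
  also have "\<dots> = assc (mult C) (sem_ty C A) (sem_ty C B) (sem_ctx C \<Delta>2)
        \<cdot> (((?f \<otimes>\<^sub>m[C] ?g) \<cdot> pinv C lI) \<otimes>\<^sub>m[C] ?s) \<cdot> pinv C lI"
    using symm_sden[of ?g ?f] v w by simp
  also have "\<dots> = assc (mult C) (sem_ty C A) (sem_ty C B) (sem_ctx C \<Delta>2)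
        \<cdot> (pinv C (assc (mult C) (sem_ty C A) (sem_ty C B) (sem_ctx C \<Delta>2))
          \<cdot> (?f \<otimes>\<^sub>m[C] ((?g \<otimes>\<^sub>m[C] ?s) \<cdot> pinv C lI)) \<cdot> pinv C lI)"
    using assc_pinv_natural[of ?f ?g ?s] v w c by simp
  also have "\<dots> = sden \<sigma> ((x, A) # (y, B) # \<Delta>2)" using v w c by simp
  finally show ?case by simp
next
  case (Cons zD \<Delta>1)
  obtain z D where zD: "zD = (z, D)" by fastforce
  from Cons.prems obtain u where u: "\<sigma> z = Some u" "cval D u" by (auto simp: zD)
  have c: "closes \<sigma> (\<Delta>1 @ (y, B) # (x, A) # \<Delta>2)" using Cons.prems by (simp add: zD)
  have "exch C (zD # \<Delta>1) B A \<Delta>2 \<cdot> sden \<sigma> ((zD # \<Delta>1) @ (y, B) # (x, A) # \<Delta>2)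
      = (vden D u \<otimes>\<^sub>m[C] (exch C \<Delta>1 B A \<Delta>2 \<cdot> sden \<sigma> (\<Delta>1 @ (y, B) # (x, A) # \<Delta>2))) \<cdot> pinv C lI"
    using u src_sden[OF c] tgt_sden[OF c] src_exch[of \<Delta>1 B A \<Delta>2 y x] tgt_exch[of \<Delta>1 B A \<Delta>2 x y] by (simp add: zD)
  then show ?case unfolding Cons.IH[OF c] using u by (simp add: zD)
qed

end

lemma interp_val_vars:
  "interp C code \<Psi> \<Delta> t A F \<Longrightarrow> is_val t \<longrightarrow> val_vars t = fst ` set \<Delta>"
  "iinterp C code \<Psi> w T G \<Longrightarrow> True"
  by (induction rule: interp_iinterp.inducts) auto

context dcpo_join_inverse_rig_category
begin

text \<open>The semantic substitution lemma for values. For an empty context it also shows that the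
  denotation of a closed value is the same for all derivations.\<close>

lemma vden_subst:
  "interp C code \<Psi> \<Delta> v A V \<Longrightarrow> is_val v \<longrightarrow> rep_ctx code \<Psi> \<longrightarrow> valid_env code \<Psi> g \<longrightarrow> closes \<sigma> \<Delta> \<longrightarrow>
    cval A (subst \<sigma> v) \<and> vden A (subst \<sigma> v) = V g \<cdot> sden \<sigma> \<Delta>"
  "iinterp C code \<Psi> w T G \<Longrightarrow> True"
proof (induction rule: interp_iinterp.inducts)
  case (in_Var A \<Psi> x)
  have "runit (mult C) (sem_ty C A) \<cdot> (vden A v \<otimes>\<^sub>m[C] idm C I) \<cdot> pinv C lI = vden A v" if v: "cval A v" for v
  proof -
    have "runit (mult C) (sem_ty C A) \<cdot> (vden A v \<otimes>\<^sub>m[C] idm C I) \<cdot> pinv C lI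
        = (runit (mult C) (tgt C (vden A v)) \<cdot> (vden A v \<otimes>\<^sub>m[C] idm C I)) \<cdot> pinv C lI" using v by simp
    also have "\<dots> = vden A v"
      unfolding T.runit_natural using v by (simp flip: T.lunit_unit_eq_runit_unit)
    finally show ?thesis .
  qed
  then show ?case by auto
next
  case (in_Inl \<Psi> \<Delta> t A F B)
  then show ?case using src_interp[of code \<Psi> \<Delta> t A F g] tgt_interp[of code \<Psi> \<Delta> t A F g] by auto
next
  case (in_Inr \<Psi> \<Delta> t B F A)
  then show ?case using src_interp[of code \<Psi> \<Delta> t B F g] tgt_interp[of code \<Psi> \<Delta> t B F g] by auto
next
  case (in_Fold \<Psi> \<Delta> t A F)
  then show ?case using src_interp[of code \<Psi> \<Delta> t _ F g] tgt_interp[of code \<Psi> \<Delta> t _ F g] by auto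
next
  case (in_Pair \<Psi> \<Delta>1 t1 A F1 \<Delta>2 t2 B F2)
  show ?case
  proof (intro impI)
    assume v: "is_val (Pair t1 t2)" and r: "rep_ctx code \<Psi>" "valid_env code \<Psi> g"
      and c: "closes \<sigma> (\<Delta>1 @ \<Delta>2)"
    have t: "src C (F1 g) = sem_ctx C \<Delta>1" "src C (F2 g) = sem_ctx C \<Delta>2"
      using src_interp[OF in_Pair(1) r] src_interp[OF in_Pair(3) r] by simp_all
    have "((F1 g \<otimes>\<^sub>m[C] F2 g) \<cdot> split C \<Delta>1 \<Delta>2) \<cdot> sden \<sigma> (\<Delta>1 @ \<Delta>2)
        = (F1 g \<otimes>\<^sub>m[C] F2 g) \<cdot> (split C \<Delta>1 \<Delta>2 \<cdot> sden \<sigma> (\<Delta>1 @ \<Delta>2))"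
      using t src_sden[OF c] tgt_sden[OF c] by simp
    also have "\<dots> = ((F1 g \<cdot> sden \<sigma> \<Delta>1) \<otimes>\<^sub>m[C] (F2 g \<cdot> sden \<sigma> \<Delta>2)) \<cdot> pinv C lI"
      unfolding split_sden[OF c] using t c by simp
    finally show "cval (Prod A B) (subst \<sigma> (Pair t1 t2)) \<and> vden (Prod A B) (subst \<sigma> (Pair t1 t2)) =
        ((F1 g \<otimes>\<^sub>m[C] F2 g) \<cdot> split C \<Delta>1 \<Delta>2) \<cdot> sden \<sigma> (\<Delta>1 @ \<Delta>2)"
      using in_Pair(2,4) v r c by simp
  qed
next
  case (in_Exch \<Psi> \<Delta>1 x A y B \<Delta>2 t D F)
  show ?case
  proof (intro impI)
    assume v: "is_val t" and r: "rep_ctx code \<Psi>" "valid_env code \<Psi> g"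
      and c: "closes \<sigma> (\<Delta>1 @ (y, B) # (x, A) # \<Delta>2)"
    have t: "src C (F g) = sem_ctx C (\<Delta>1 @ (x, A) # (y, B) # \<Delta>2)"
      using src_interp[OF in_Exch(1) r] .
    have "(F g \<cdot> exch C \<Delta>1 B A \<Delta>2) \<cdot> sden \<sigma> (\<Delta>1 @ (y, B) # (x, A) # \<Delta>2)
        = F g \<cdot> (exch C \<Delta>1 B A \<Delta>2 \<cdot> sden \<sigma> (\<Delta>1 @ (y, B) # (x, A) # \<Delta>2))"
      using t tgt_sden[OF c] src_exch[of \<Delta>1 B A \<Delta>2 y x] tgt_exch[of \<Delta>1 B A \<Delta>2 x y] by simp
    then show "cval D (subst \<sigma> t) \<and> vden D (subst \<sigma> t) =
        (F g \<cdot> exch C \<Delta>1 B A \<Delta>2) \<cdot> sden \<sigma> (\<Delta>1 @ (y, B) # (x, A) # \<Delta>2)"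
      unfolding exch_sden[OF c] using in_Exch(2) v r c by simp
  qed
qed simp_all

text \<open>The value is followed down to its variables, where the typed closed value on the other
  side leaves a typed closed component.\<close>

lemma closes_if_cval_subst:
  "interp C code \<Psi> \<Delta> v A V \<Longrightarrow> is_val v \<longrightarrow> cval A (subst \<sigma> v) \<longrightarrow> closes \<sigma> \<Delta>"
  "iinterp C code \<Psi> w T G \<Longrightarrow> True"
  by (induction rule: interp_iinterp.inducts) (auto split: option.splits elim: cval.elims)

definition is_pat :: "trm \<Rightarrow> bool" where
  "is_pat v \<longleftrightarrow> (\<exists>p. v = pat_trm p)"

lemma is_pat_simps [simp]:
  "is_pat (Var x)" "\<not> is_pat Unit" "\<not> is_pat (Inl t)" "\<not> is_pat (Inr t)" "\<not> is_pat (Fold t)"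
  "is_pat (Pair t u) \<longleftrightarrow> is_pat t \<and> is_pat u"
proof -
  show "is_pat (Var x)" unfolding is_pat_def by (metis pat_trm.simps(1))
  show "\<not> is_pat Unit" "\<not> is_pat (Inl t)" "\<not> is_pat (Inr t)" "\<not> is_pat (Fold t)"
    unfolding is_pat_def by (metis pat.exhaust pat_trm.simps trm.distinct)+
  show "is_pat (Pair t u) \<longleftrightarrow> is_pat t \<and> is_pat u"
    unfolding is_pat_def
  proof
    show "(\<exists>p. t = pat_trm p) \<and> (\<exists>p. u = pat_trm p)" if "\<exists>p. Pair t u = pat_trm p"
    proof -
      obtain p where "Pair t u = pat_trm p" using \<open>\<exists>p. Pair t u = pat_trm p\<close> by auto
      then show ?thesis by (cases p) auto
    qed
  qed (metis pat_trm.simps(2))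
qed

text \<open>Matching fails only where two different injections meet, and there disjointness makes
  the composite vanish. The conjunct \<open>\<not> is_pat v\<close> is carried along because a
  pattern contains no injection: it always matches, so a \<open>Let\<close> is never stuck on a
  value of its type.\<close>

lemma match_or_zero:
  "interp C code \<Psi> \<Delta> v A V \<Longrightarrow> is_val v \<longrightarrow> rep_ctx code \<Psi> \<longrightarrow> valid_env code \<Psi> g \<longrightarrow>
    (\<forall>v'. cval A v' \<longrightarrow> (\<exists>\<sigma>. matches \<sigma> v v') \<or>
      \<not> is_pat v \<and> pinv C (V g) \<cdot> vden A v' = zero C I (sem_ctx C \<Delta>))"
  "iinterp C code \<Psi> w T G \<Longrightarrow> True"
proof (induction rule: interp_iinterp.inducts)
  case (in_Unit \<Psi>)
  have "matches Map.empty Unit Unit" by (simp add: matches_def)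
  then show ?case by (auto simp: cval_One)
next
  case (in_Var A \<Psi> x)
  have "matches [x \<mapsto> v] (Var x) v" for v by (simp add: matches_def)
  then show ?case by blast
next
  case (in_Inl \<Psi> \<Delta> t A F B)
  show ?case
  proof (intro impI allI)
    fix v' assume v: "is_val (Inl t)" and r: "rep_ctx code \<Psi>" "valid_env code \<Psi> g" and v': "cval (Sum A B) v'"
    note t = src_interp[OF in_Inl(1) r] tgt_interp[OF in_Inl(1) r]
    have "matches \<sigma> (Inl t) (Inl u)" if "matches \<sigma> t u" for \<sigma> u using that by (simp add: matches_def)
    then show "(\<exists>\<sigma>. matches \<sigma> (Inl t) v') \<or> \<not> is_pat (Inl t) \<and>
        pinv C (inj_l C (sem_ty C A) (sem_ty C B) \<cdot> F g) \<cdot> vden (Sum A B) v' = zero C I (sem_ctx C \<Delta>)"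
      using v' in_Inl(2) v r t by (auto simp: cval_Sum; blast)
  qed
next
  case (in_Inr \<Psi> \<Delta> t B F A)
  show ?case
  proof (intro impI allI)
    fix v' assume v: "is_val (Inr t)" and r: "rep_ctx code \<Psi>" "valid_env code \<Psi> g" and v': "cval (Sum A B) v'"
    note t = src_interp[OF in_Inr(1) r] tgt_interp[OF in_Inr(1) r]
    have "matches \<sigma> (Inr t) (Inr u)" if "matches \<sigma> t u" for \<sigma> u using that by (simp add: matches_def)
    then show "(\<exists>\<sigma>. matches \<sigma> (Inr t) v') \<or> \<not> is_pat (Inr t) \<and>
        pinv C (inj_r C (sem_ty C A) (sem_ty C B) \<cdot> F g) \<cdot> vden (Sum A B) v' = zero C I (sem_ctx C \<Delta>)"
      using v' in_Inr(2) v r t by (auto simp: cval_Sum; blast)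
  qed
next
  case (in_Fold \<Psi> \<Delta> t A F)
  show ?case
  proof (intro impI allI)
    fix v' assume v: "is_val (Fold t)" and r: "rep_ctx code \<Psi>" "valid_env code \<Psi> g" and v': "cval (Mu A) v'"
    note t = src_interp[OF in_Fold(1) r] tgt_interp[OF in_Fold(1) r]
    have "matches \<sigma> (Fold t) (Fold u)" if "matches \<sigma> t u" for \<sigma> u using that by (simp add: matches_def)
    then show "(\<exists>\<sigma>. matches \<sigma> (Fold t) v') \<or> \<not> is_pat (Fold t) \<and>
        pinv C (fold_ar C A \<cdot> F g) \<cdot> vden (Mu A) v' = zero C I (sem_ctx C \<Delta>)"
      using v' in_Fold(2) v r t by (auto simp: cval_Mu; blast)
  qed
next
  case (in_Pair \<Psi> \<Delta>1 t1 A F1 \<Delta>2 t2 B F2)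
  show ?case
  proof (intro impI allI)
    fix v' assume v: "is_val (Pair t1 t2)" and r: "rep_ctx code \<Psi>" "valid_env code \<Psi> g" and v': "cval (Prod A B) v'"
    note t1 = src_interp[OF in_Pair(1) r] tgt_interp[OF in_Pair(1) r]
      and t2 = src_interp[OF in_Pair(3) r] tgt_interp[OF in_Pair(3) r]
    obtain u w where u: "v' = Pair u w" "cval A u" "cval B w" using v' by (auto simp: cval_Prod)
    have IH1: "(\<exists>\<sigma>. matches \<sigma> t1 u) \<or> \<not> is_pat t1 \<and> pinv C (F1 g) \<cdot> vden A u = zero C I (sem_ctx C \<Delta>1)"
      and IH2: "(\<exists>\<sigma>. matches \<sigma> t2 w) \<or> \<not> is_pat t2 \<and> pinv C (F2 g) \<cdot> vden B w = zero C I (sem_ctx C \<Delta>2)"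
      using in_Pair(2,4) v r u by simp_all
    have den: "pinv C ((F1 g \<otimes>\<^sub>m[C] F2 g) \<cdot> split C \<Delta>1 \<Delta>2) \<cdot> vden (Prod A B) v' =
        pinv C (split C \<Delta>1 \<Delta>2) \<cdot> ((pinv C (F1 g) \<cdot> vden A u) \<otimes>\<^sub>m[C] (pinv C (F2 g) \<cdot> vden B w)) \<cdot> pinv C lI"
      using t1 t2 u by simp
    show "(\<exists>\<sigma>. matches \<sigma> (Pair t1 t2) v') \<or> \<not> is_pat (Pair t1 t2) \<and>
        pinv C ((F1 g \<otimes>\<^sub>m[C] F2 g) \<cdot> split C \<Delta>1 \<Delta>2) \<cdot> vden (Prod A B) v' = zero C I (sem_ctx C (\<Delta>1 @ \<Delta>2))"
    proof (cases "(\<exists>\<sigma>. matches \<sigma> t1 u) \<and> (\<exists>\<sigma>. matches \<sigma> t2 w)")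
      case True
      then obtain \<sigma> \<tau> where \<sigma>: "matches \<sigma> t1 u" and \<tau>: "matches \<tau> t2 w" by auto
      \<comment> \<open>Linearity keeps the two contexts disjoint, so the two matching substitutions
        merge without conflict.\<close>
      have "val_vars t1 \<inter> val_vars t2 = {}"
        using interp_val_vars(1)[OF in_Pair(1)] interp_val_vars(1)[OF in_Pair(3)] v in_Pair(5) by auto
      then have "x \<in> val_vars t1 \<Longrightarrow> x \<notin> dom \<tau>" "x \<in> val_vars t2 \<Longrightarrow> x \<in> dom \<tau>" for x
        using \<tau> unfolding matches_def by blast+
      then have "subst (\<sigma> ++ \<tau>) t1 = subst \<sigma> t1" "subst (\<sigma> ++ \<tau>) t2 = subst \<tau> t2"
        using v by (auto intro!: subst_val_cong map_add_dom_app_simps(1,3) simp del: domIff)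
      then have "matches (\<sigma> ++ \<tau>) (Pair t1 t2) v'" using \<sigma> \<tau> u by (auto simp: matches_def)
      then show ?thesis by blast
    next
      case False
      then show ?thesis unfolding den using IH1 IH2 u t1 t2 by auto
    qed
  qed
next
  case (in_Exch \<Psi> \<Delta>1 x A y B \<Delta>2 t D F)
  show ?case
  proof (intro impI allI)
    fix v' assume v: "is_val t" and r: "rep_ctx code \<Psi>" "valid_env code \<Psi> g" and v': "cval D v'"
    note t = src_interp[OF in_Exch(1) r] tgt_interp[OF in_Exch(1) r]
    have "pinv C (F g \<cdot> exch C \<Delta>1 B A \<Delta>2) \<cdot> vden D v' = pinv C (exch C \<Delta>1 B A \<Delta>2) \<cdot> (pinv C (F g) \<cdot> vden D v')"
      using t v' tgt_exch[of \<Delta>1 B A \<Delta>2 x y] by simp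
    then show "(\<exists>\<sigma>. matches \<sigma> t v') \<or> \<not> is_pat t \<and> pinv C (F g \<cdot> exch C \<Delta>1 B A \<Delta>2) \<cdot> vden D v' =
        zero C I (sem_ctx C (\<Delta>1 @ (y, B) # (x, A) # \<Delta>2))"
      using in_Exch(2) v r v' tgt_exch[of \<Delta>1 B A \<Delta>2 x y] src_exch[of \<Delta>1 B A \<Delta>2 y x] by auto
  qed
qed simp_all

end

section \<open>The fundamental lemma\<close>

context dcpo_join_inverse_rig_category
begin

definition related :: "('b, 'd) coding \<Rightarrow> bool \<Rightarrow> nat \<Rightarrow> ictx \<Rightarrow> (ivar \<times> iso) list \<Rightarrow> ('b, 'd) env \<Rightarrow> bool" where
  "related code b n \<Psi> L g \<longleftrightarrow> (\<forall>p\<in>set L. fiv (snd p) = {}) \<and> dom \<Psi> \<subseteq> fst ` set L \<and> valid_env code \<Psi> g \<and>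
     (\<forall>\<phi> T. \<Psi> \<phi> = Some T \<longrightarrow> irel code b T n (isubsts L (IVar \<phi>)) (g \<phi>))"

lemma related_mono: "related code b n \<Psi> L g \<Longrightarrow> m \<le> n \<Longrightarrow> related code b m \<Psi> L g"
  unfolding related_def using irel_mono by blast

lemma related_closed:
  assumes "related code b n \<Psi> L g" "fiv w \<subseteq> dom \<Psi>" shows "fiv (isubsts L w) = {}"
proof -
  have L: "\<forall>p\<in>set L. fiv (snd p) = {}" "dom \<Psi> \<subseteq> fst ` set L" using assms(1) by (simp_all add: related_def)
  have "fiv w - fst ` set L = {}" using assms(2) L(2) by blast
  show ?thesis using fiv_isubsts[OF L(1), of w] unfolding \<open>fiv w - fst ` set L = {}\<close> by blast
qed

text \<open>The new binding stands at the head of the list and is applied last, as a reduction step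
  would do. What was substituted for the other variables is closed and stays unchanged.\<close>

lemma related_update:
  assumes r: "related code b n \<Psi> L g" and w: "irel code b T n w d" and d: "d \<in> fst (sem_ity C code T)"
  shows "related code b n (\<Psi>(\<phi> \<mapsto> T)) ((\<phi>, w) # unbind \<phi> L) (g(\<phi> := d))"
  unfolding related_def
proof (intro conjI allI impI)
  let ?L = "(\<phi>, w) # unbind \<phi> L"
  have L: "\<forall>p\<in>set L. fiv (snd p) = {}" "dom \<Psi> \<subseteq> fst ` set L" "valid_env code \<Psi> g"
    using r by (simp_all add: related_def)
  have w0: "fiv w = {}" by (rule irel_closed[OF w])
  show "\<forall>p\<in>set ?L. fiv (snd p) = {}" using L w0 by simp
  show "dom (\<Psi>(\<phi> \<mapsto> T)) \<subseteq> fst ` set ?L" using L(2) by force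
  show "valid_env code (\<Psi>(\<phi> \<mapsto> T)) (g(\<phi> := d))" using L(3) d by (rule valid_env_update)
  fix \<psi> T' assume T': "(\<Psi>(\<phi> \<mapsto> T)) \<psi> = Some T'"
  show "irel code b T' n (isubsts ?L (IVar \<psi>)) ((g(\<phi> := d)) \<psi>)"
  proof (cases "\<psi> = \<phi>")
    case True
    have "isubsts (unbind \<phi> L) (IVar \<phi>) = IVar \<phi>" by (rule isubsts_IVar_fresh) auto
    then show ?thesis using True T' w by (simp add: isubsts_Cons)
  next
    case False
    have \<psi>: "irel code b T' n (isubsts L (IVar \<psi>)) (g \<psi>)" using r T' False by (simp add: related_def)
    have "isubsts ?L (IVar \<psi>) = isubst \<phi> w (isubsts L (IVar \<psi>))"
      using isubsts_IVar_unbind[OF L(1) False] by (simp add: isubsts_Cons)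
    also have "\<dots> = isubsts L (IVar \<psi>)" using irel_closed[OF \<psi>] by (simp add: isubst_fresh)
    finally show ?thesis using \<psi> False by simp
  qed
qed

lemma Join_lub_eq: "is_lub (hom C A B) (le C) S f \<Longrightarrow> Join C A B S = f"
  unfolding Join_def using lub_unique by blast

lemma Join_zero_except:
  assumes "x \<in> S" "S \<subseteq> {x, zero C A B}" "x \<in> hom C A B" shows "Join C A B S = x"
  using assms by (intro Join_lub_eq is_lubI) (auto simp: hom_iff le_refl zero_le)

text \<open>If clause \<open>i\<close> matches, orthogonality of the left sides makes all other
  members of the join vanish, so the join is the denotation of the chosen right side. If no clause
  matches, the whole join vanishes, and adequacy tolerates the stuck application.\<close>

lemma fundamental_clauses:
  assumes r: "rep_ctx code \<Psi>" "related code b n \<Psi> L g"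
    and vals: "\<And>i. i < length cs \<Longrightarrow> is_val (fst (cs ! i))"
    and V: "\<And>i. i < length cs \<Longrightarrow> interp C code \<Psi> (\<Delta> i) (fst (cs ! i)) A (V i)"
    and E: "\<And>i. i < length cs \<Longrightarrow> interp C code \<Psi> (\<Delta> i) (snd (cs ! i)) B (E i)"
    and orth: "\<And>i j. i < length cs \<Longrightarrow> j < length cs \<Longrightarrow> i \<noteq> j \<Longrightarrow> fst (cs ! i) \<bottom> fst (cs ! j)"
      "\<And>i j. i < length cs \<Longrightarrow> j < length cs \<Longrightarrow> i \<noteq> j \<Longrightarrow> snd (cs ! i) \<bottom> snd (cs ! j)"
    and IH: "\<And>i m \<sigma>. i < length cs \<Longrightarrow> m \<le> n \<Longrightarrow> closed_subst \<sigma> \<Longrightarrow> closes \<sigma> (\<Delta> i) \<Longrightarrow>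
      rel b m B (subst \<sigma> (isubstst L (snd (cs ! i)))) (E i g \<cdot> sden \<sigma> (\<Delta> i))"
    and v: "cval A v" and m: "m \<le> n"
  shows "rel b m B (App (isubsts L (Clauses cs)) v)
    (Join C (sem_ty C A) (sem_ty C B) ((\<lambda>i. E i g \<cdot> pinv C (V i g)) ` {..<length cs}) \<cdot> vden A v)"
proof -
  let ?f = "\<lambda>i. E i g \<cdot> pinv C (V i g)"
  let ?J = "Join C (sem_ty C A) (sem_ty C B) (?f ` {..<length cs})"
  have g: "valid_env code \<Psi> g" using r(2) by (simp add: related_def)
  have t: "src C (E i g) = sem_ctx C (\<Delta> i)" "tgt C (E i g) = sem_ty C B"
    "src C (V i g) = sem_ctx C (\<Delta> i)" "tgt C (V i g) = sem_ty C A"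
    "factors (fst (cs ! i)) A (V i g)" "factors (snd (cs ! i)) B (E i g)" "total (V i g)"
    if i: "i < length cs" for i
    using src_interp[OF E[OF i] r(1) g] tgt_interp[OF E[OF i] r(1) g] src_interp[OF V[OF i] r(1) g]
      tgt_interp[OF V[OF i] r(1) g] factors_interp[OF E[OF i] r(1) g] factors_interp[OF V[OF i] r(1) g]
      total_interp[OF V[OF i] r(1) g vals[OF i]] by simp_all
  have V0: "pinv C (V i g) \<cdot> V j g = zero C (sem_ctx C (\<Delta> j)) (sem_ctx C (\<Delta> i))"
    and E0: "pinv C (E i g) \<cdot> E j g = zero C (sem_ctx C (\<Delta> j)) (sem_ctx C (\<Delta> i))"
    if "i < length cs" "j < length cs" "i \<noteq> j" for i j
    using that orth_zero[OF orth(1)[of j i] t(5)[of j] t(5)[of i]] orth_zero[OF orth(2)[of j i] t(6)[of j] t(6)[of i]] t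
    by auto
  have comp: "compatible C (?f ` {..<length cs})"
    by (rule compatible_orthogonal[where X = "\<lambda>i. sem_ctx C (\<Delta> i)" and A = "sem_ty C A" and B = "sem_ty C B"])
      (use t V0 E0 in auto)
  have sub: "?f ` {..<length cs} \<subseteq> hom C (sem_ty C A) (sem_ty C B)" using t by (auto simp: hom_iff)
  have "?J \<cdot> vden A v = Join C I (sem_ty C B) ((\<lambda>s. s \<cdot> vden A v) ` ?f ` {..<length cs})"
    by (rule Join_comp_right[OF sub comp]) (simp add: hom_iff v)
  moreover have "(\<lambda>s. s \<cdot> vden A v) ` ?f ` {..<length cs} =
      (\<lambda>i. E i g \<cdot> (pinv C (V i g) \<cdot> vden A v)) ` {..<length cs}"
    unfolding image_image using t v by (intro image_cong) simp_all
  ultimately have J: "?J \<cdot> vden A v = Join C I (sem_ty C B)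
      ((\<lambda>i. E i g \<cdot> (pinv C (V i g) \<cdot> vden A v)) ` {..<length cs})" by simp
  let ?cs = "map (map_prod (isubstst L) (isubstst L)) cs"
  have cs: "fst (?cs ! i) = fst (cs ! i)" "snd (?cs ! i) = isubstst L (snd (cs ! i))" if "i < length cs" for i
    using that vals by (simp_all add: isubstst_val)
  have match: "closes \<sigma> (\<Delta> i) \<and> closed_subst \<sigma> \<and> ?J \<cdot> vden A v = E i g \<cdot> sden \<sigma> (\<Delta> i)"
    if i: "i < length cs" and \<sigma>: "matches \<sigma> (fst (cs ! i)) v" for i \<sigma>
  proof -
    have s: "subst \<sigma> (fst (cs ! i)) = v" "dom \<sigma> = val_vars (fst (cs ! i))" using \<sigma> by (simp_all add: matches_def)
    have c: "closes \<sigma> (\<Delta> i)" using closes_if_cval_subst(1)[OF V[OF i]] vals[OF i] v s by simp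
    have "dom \<sigma> = fst ` set (\<Delta> i)" using interp_val_vars(1)[OF V[OF i]] vals[OF i] s by simp
    then have cl: "closed_subst \<sigma>"
      unfolding closed_subst_def
    proof (intro allI impI)
      fix x u \<tau> assume "\<sigma> x = Some u"
      moreover from this obtain D where "(x, D) \<in> set (\<Delta> i)" using \<open>dom \<sigma> = fst ` set (\<Delta> i)\<close> by force
      ultimately have "cval D u" using c by (auto simp: closes_def)
      then show "subst \<tau> u = u" by (rule subst_cval)
    qed
    have vd: "vden A v = V i g \<cdot> sden \<sigma> (\<Delta> i)"
      using vden_subst(1)[OF V[OF i], of g \<sigma>] vals[OF i] r(1) g c s by simp
    have same: "pinv C (V i g) \<cdot> vden A v = sden \<sigma> (\<Delta> i)"
      unfolding vd using t[OF i] c by (simp add: total_def)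
    \<comment> \<open>The value factors through the left side of clause \<open>i\<close>, to which
      every other left side is orthogonal.\<close>
    have other: "pinv C (V j g) \<cdot> vden A v = zero C I (sem_ctx C (\<Delta> j))" if j: "j < length cs" "j \<noteq> i" for j
    proof -
      have "pinv C (V j g) \<cdot> vden A v = (pinv C (V j g) \<cdot> V i g) \<cdot> sden \<sigma> (\<Delta> i)"
        unfolding vd using t[OF i] t[OF j(1)] c by simp
      then show ?thesis using V0[OF j(1) i j(2)] c by simp
    qed
    have "Join C I (sem_ty C B) ((\<lambda>i. E i g \<cdot> (pinv C (V i g) \<cdot> vden A v)) ` {..<length cs}) = E i g \<cdot> sden \<sigma> (\<Delta> i)"
    proof (rule Join_zero_except)
      show "E i g \<cdot> sden \<sigma> (\<Delta> i) \<in> (\<lambda>i. E i g \<cdot> (pinv C (V i g) \<cdot> vden A v)) ` {..<length cs}"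
        by (rule image_eqI[of _ _ i]) (simp_all only: same i lessThan_iff)
      show "(\<lambda>i. E i g \<cdot> (pinv C (V i g) \<cdot> vden A v)) ` {..<length cs} \<subseteq> {E i g \<cdot> sden \<sigma> (\<Delta> i), zero C I (sem_ty C B)}"
      proof (intro image_subsetI)
        fix j assume "j \<in> {..<length cs}"
        then have j: "j < length cs" by simp
        show "E j g \<cdot> (pinv C (V j g) \<cdot> vden A v) \<in> {E i g \<cdot> sden \<sigma> (\<Delta> i), zero C I (sem_ty C B)}"
          using same other[OF j] t[OF j] by (cases "j = i") simp_all
      qed
      show "E i g \<cdot> sden \<sigma> (\<Delta> i) \<in> hom C I (sem_ty C B)" using t[OF i] c by (simp add: hom_iff)
    qed
    then show ?thesis using c cl J by simp
  qed
  show ?thesis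
  proof (rule rel_expand)
    show "\<not> is_val (App (isubsts L (Clauses cs)) v)" by simp
    show "\<exists>t'. red (App (isubsts L (Clauses cs)) v) t'"
      if nz: "?J \<cdot> vden A v \<noteq> zero C I (sem_ty C B)"
    proof -
      have "\<exists>i<length cs. \<exists>\<sigma>. matches \<sigma> (fst (cs ! i)) v"
      proof (rule ccontr)
        assume "\<not> ?thesis"
        then have "E i g \<cdot> (pinv C (V i g) \<cdot> vden A v) = zero C I (sem_ty C B)" if i: "i < length cs" for i
          using match_or_zero(1)[OF V[OF i], of g] vals[OF i] r(1) g v i t[OF i] by auto
        then have "(\<lambda>i. E i g \<cdot> (pinv C (V i g) \<cdot> vden A v)) ` {..<length cs} \<subseteq> {zero C I (sem_ty C B)}" by auto
        then have "?J \<cdot> vden A v = zero C I (sem_ty C B)"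
          unfolding J by (intro Join_lub_eq is_lubI) (auto simp: hom_iff le_refl zero_le)
        then show False using nz by simp
      qed
      then obtain i \<sigma> where i: "i < length cs" "matches \<sigma> (fst (cs ! i)) v" by auto
      then have "red (App (Clauses ?cs) v) (subst \<sigma> (snd (?cs ! i)))"
        using cs(1)[OF i(1)] by (intro red_clause cval_is_val[OF v]) simp_all
      then show ?thesis by auto
    qed
    fix t' k assume t': "red (App (isubsts L (Clauses cs)) v) t'" and k: "later b m k"
    have "k \<le> n" using k m by (auto simp: later_def split: if_splits)
    from t' obtain i \<sigma> where "i < length ?cs" "matches \<sigma> (fst (?cs ! i)) v" "t' = subst \<sigma> (snd (?cs ! i))"
      unfolding isubsts_simps
      by (rule red_AppE) (use val_irreducible[OF cval_is_val[OF v]] in \<open>blast elim: ired_ClausesE\<close>)+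
    then have i: "i < length cs" "matches \<sigma> (fst (cs ! i)) v" "t' = subst \<sigma> (isubstst L (snd (cs ! i)))"
      using cs by (simp_all only: length_map)
    then show "rel b k B t' (?J \<cdot> vden A v)"
      using match[OF i(1,2)] IH[OF i(1) \<open>k \<le> n\<close>, of \<sigma>] by simp
  qed
qed

text \<open>The denotation of the \<open>Let\<close> depends on the bound term through a strict map
  \<open>H\<close>, so the bound term can be evaluated as in a frame. Once it is a value, its
  components form a point that joins the rest of the context.\<close>

lemma fundamental_let:
  assumes r: "rep_ctx code \<Psi>" "valid_env code \<Psi> g"
    and t1: "interp C code \<Psi> \<Delta>1 t1 A F1" and p: "interp C code \<Psi> \<Gamma> (pat_trm p) A P"
    and t2: "interp C code \<Psi> (\<Delta>2 @ \<Gamma>) t2 B F2"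
    and c: "closed_subst \<sigma>" "closes \<sigma> (\<Delta>1 @ \<Delta>2)"
    and IH1: "rel b n A u1 (F1 g \<cdot> sden \<sigma> \<Delta>1)"
    and IH2: "\<And>m \<tau>. m \<le> n \<Longrightarrow> closed_subst \<tau> \<Longrightarrow> closes \<tau> (\<Delta>2 @ \<Gamma>) \<Longrightarrow>
      rel b m B (subst \<tau> u2) (F2 g \<cdot> sden \<tau> (\<Delta>2 @ \<Gamma>))"
  shows "rel b n B (Let p u1 (subst (\<sigma> |` (- pat_vars p)) u2))
    ((F2 g \<cdot> pinv C (split C \<Delta>2 \<Gamma>) \<cdot> (idm C (sem_ctx C \<Delta>2) \<otimes>\<^sub>m[C] (pinv C (P g) \<cdot> F1 g))
      \<cdot> symm (mult C) (sem_ctx C \<Delta>1) (sem_ctx C \<Delta>2) \<cdot> split C \<Delta>1 \<Delta>2) \<cdot> sden \<sigma> (\<Delta>1 @ \<Delta>2))"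
proof -
  note T = src_interp[OF t1 r] tgt_interp[OF t1 r] src_interp[OF t2 r] tgt_interp[OF t2 r]
    src_interp[OF p r] tgt_interp[OF p r]
  have c1: "closes \<sigma> \<Delta>1" "closes \<sigma> \<Delta>2" using c(2) by simp_all
  have val_p: "is_val (pat_trm q)" for q by (induction q) simp_all
  have vars_p: "val_vars (pat_trm q) = pat_vars q" for q by (induction q) simp_all
  have dom_p: "pat_vars p = fst ` set \<Gamma>" using interp_val_vars(1)[OF p] val_p vars_p by simp
  let ?u = "subst (\<sigma> |` (- pat_vars p)) u2"
  define H where "H = (\<lambda>f. F2 g \<cdot> pinv C (split C \<Delta>2 \<Gamma>) \<cdot> (sden \<sigma> \<Delta>2 \<otimes>\<^sub>m[C] (pinv C (P g) \<cdot> f)) \<cdot> pinv C lI)"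
  have "(F2 g \<cdot> pinv C (split C \<Delta>2 \<Gamma>) \<cdot> (idm C (sem_ctx C \<Delta>2) \<otimes>\<^sub>m[C] (pinv C (P g) \<cdot> F1 g))
      \<cdot> symm (mult C) (sem_ctx C \<Delta>1) (sem_ctx C \<Delta>2) \<cdot> split C \<Delta>1 \<Delta>2) \<cdot> sden \<sigma> (\<Delta>1 @ \<Delta>2)
    = F2 g \<cdot> pinv C (split C \<Delta>2 \<Gamma>) \<cdot> (idm C (sem_ctx C \<Delta>2) \<otimes>\<^sub>m[C] (pinv C (P g) \<cdot> F1 g))
      \<cdot> symm (mult C) (sem_ctx C \<Delta>1) (sem_ctx C \<Delta>2) \<cdot> (split C \<Delta>1 \<Delta>2 \<cdot> sden \<sigma> (\<Delta>1 @ \<Delta>2))"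
    using T src_sden[OF c(2)] tgt_sden[OF c(2)] by simp
  also have "\<dots> = F2 g \<cdot> pinv C (split C \<Delta>2 \<Gamma>) \<cdot> (idm C (sem_ctx C \<Delta>2) \<otimes>\<^sub>m[C] (pinv C (P g) \<cdot> F1 g))
      \<cdot> (symm (mult C) (sem_ctx C \<Delta>1) (sem_ctx C \<Delta>2) \<cdot> (sden \<sigma> \<Delta>1 \<otimes>\<^sub>m[C] sden \<sigma> \<Delta>2) \<cdot> pinv C lI)"
    by (simp only: split_sden[OF c(2)])
  also have "\<dots> = H (F1 g \<cdot> sden \<sigma> \<Delta>1)"
    using symm_sden[of "sden \<sigma> \<Delta>1" "sden \<sigma> \<Delta>2"] T c1 by (simp add: H_def)
  finally have eq: "(F2 g \<cdot> pinv C (split C \<Delta>2 \<Gamma>) \<cdot> (idm C (sem_ctx C \<Delta>2) \<otimes>\<^sub>m[C] (pinv C (P g) \<cdot> F1 g))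
      \<cdot> symm (mult C) (sem_ctx C \<Delta>1) (sem_ctx C \<Delta>2) \<cdot> split C \<Delta>1 \<Delta>2) \<cdot> sden \<sigma> (\<Delta>1 @ \<Delta>2)
    = H (F1 g \<cdot> sden \<sigma> \<Delta>1)" .
  show ?thesis unfolding eq
  proof (rule rel_bind[OF eval_frames(5) _ IH1])
    show "H (zero C I (sem_ty C A)) = zero C I (sem_ty C B)" unfolding H_def using T c1 by simp
    fix m v assume m: "m \<le> n" and v: "cval A v"
    have match: "rel b k B (subst \<tau> ?u) (H (vden A v))" if \<tau>: "matches \<tau> (pat_trm p) v" and k: "k \<le> n" for \<tau> k
    proof -
      have s: "subst \<tau> (pat_trm p) = v" "dom \<tau> = pat_vars p" using \<tau> vars_p by (simp_all add: matches_def)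
      have cp: "closes \<tau> \<Gamma>" using closes_if_cval_subst(1)[OF p] val_p v s by simp
      \<comment> \<open>Bound names shadow \<open>\<sigma>\<close>: the matching substitution acts
        on \<open>\<Gamma>\<close> and the original one on \<open>\<Delta>2\<close>; distinct names
        keep the two apart.\<close>
      let ?\<tau> = "\<tau> ++ \<sigma> |` (- pat_vars p)"
      have \<tau>\<Gamma>: "?\<tau> x = \<tau> x" if "x \<in> fst ` set \<Gamma>" for x
        using that by (simp add: map_add_def restrict_map_def dom_p)
      have \<tau>\<Delta>: "?\<tau> x = \<sigma> x" if x: "x \<in> fst ` set \<Delta>2" for x
      proof -
        have "x \<notin> pat_vars p" using interp_distinct(1)[OF t2] x by (auto simp: dom_p)
        moreover from this have "\<tau> x = None" using s(2) by blast
        ultimately show ?thesis by (simp add: map_add_def restrict_map_def split: option.split)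
      qed
      have c': "closes ?\<tau> (\<Delta>2 @ \<Gamma>)"
        using closes_cong[of \<Gamma>, OF \<tau>\<Gamma>] closes_cong[of \<Delta>2, OF \<tau>\<Delta>] cp c1 by simp
      have sd: "sden ?\<tau> \<Delta>2 = sden \<sigma> \<Delta>2" "sden ?\<tau> \<Gamma> = sden \<tau> \<Gamma>"
        by (rule sden_cong, erule \<tau>\<Delta>) (rule sden_cong, erule \<tau>\<Gamma>)
      have cl\<sigma>: "closed_subst (\<sigma> |` (- pat_vars p))"
        using c(1) by (simp add: closed_subst_def restrict_map_def)
      have cl\<tau>: "closed_subst ?\<tau>"
        unfolding closed_subst_def
      proof (intro allI impI)
        fix x u \<rho> assume x: "?\<tau> x = Some u"
        show "subst \<rho> u = u"
        proof (cases "x \<in> pat_vars p")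
          case True
          then obtain D where D: "(x, D) \<in> set \<Gamma>" using dom_p by force
          have "\<tau> x = Some u" using x True by (simp add: map_add_def restrict_map_def)
          then have "cval D u" using cp D by (auto simp: closes_def)
          then show ?thesis by (rule subst_cval)
        next
          case False
          then have "\<tau> x = None" using s(2) by blast
          then have "\<sigma> x = Some u" using x False by (auto simp: map_add_def restrict_map_def split: option.splits)
          then show ?thesis using c(1) by (simp add: closed_subst_def)
        qed
      qed
      have "vden A v = P g \<cdot> sden \<tau> \<Gamma>"
        using vden_subst(1)[OF p, of g \<tau>] val_p r cp s by simp
      then have "pinv C (P g) \<cdot> vden A v = sden \<tau> \<Gamma>"
        using T cp total_interp[OF p r val_p] by (simp add: total_def)
      then have "H (vden A v) = F2 g \<cdot> pinv C (split C \<Delta>2 \<Gamma>) \<cdot> (split C \<Delta>2 \<Gamma> \<cdot> sden ?\<tau> (\<Delta>2 @ \<Gamma>))"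
        unfolding H_def split_sden[OF c'] sd by simp
      also have "\<dots> = F2 g \<cdot> sden ?\<tau> (\<Delta>2 @ \<Gamma>)" using T src_sden[OF c'] tgt_sden[OF c'] by simp
      finally show ?thesis using IH2[OF k cl\<tau> c'] by (simp add: subst_subst[OF cl\<sigma>])
    qed
    show "rel b m B (Let p v ?u) (H (vden A v))"
    proof (rule rel_expand)
      show "\<not> is_val (Let p v ?u)" by simp
      have "is_pat (pat_trm p)" unfolding is_pat_def by blast
      then obtain \<tau> where "matches \<tau> (pat_trm p) v"
        using match_or_zero(1)[OF p, of g] val_p r v by blast
      then show "\<exists>t'. red (Let p v ?u) t'" using red_let[OF cval_is_val[OF v]] by blast
      fix t' k assume t': "red (Let p v ?u) t'" and k: "later b m k"
      have "k \<le> n" using k m by (auto simp: later_def split: if_splits)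
      with t' show "rel b k B t' (H (vden A v))"
        using val_irreducible[OF cval_is_val[OF v]] match by (auto elim!: red_LetE)
    qed
  qed
qed

text \<open>The common argument for \<open>Inl\<close>, \<open>Inr\<close> and \<open>Fold\<close>,
  frames that denote postcomposition with a fixed map.\<close>

lemma fundamental_unary:
  assumes F: "interp C code \<Psi> \<Delta> t A F" and r: "rep_ctx code \<Psi>" "related code b n \<Psi> L g"
    and c: "closes \<sigma> \<Delta>" and t: "rel b n A (subst \<sigma> (isubstst L t)) (F g \<cdot> sden \<sigma> \<Delta>)"
    and K: "eval_frame K" "subst \<sigma> (isubstst L (K t)) = K (subst \<sigma> (isubstst L t))"
    and h: "src C h = sem_ty C A" "tgt C h = sem_ty C B"
    and v: "\<And>v. cval A v \<Longrightarrow> cval B (K v) \<and> vden B (K v) = h \<cdot> vden A v"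
  shows "rel b n B (subst \<sigma> (isubstst L (K t))) ((h \<cdot> F g) \<cdot> sden \<sigma> \<Delta>)"
proof -
  have g: "valid_env code \<Psi> g" using r(2) by (simp add: related_def)
  have "(h \<cdot> F g) \<cdot> sden \<sigma> \<Delta> = h \<cdot> (F g \<cdot> sden \<sigma> \<Delta>)"
    using src_interp[OF F r(1) g] tgt_interp[OF F r(1) g] c h by simp
  moreover have "rel b n B (K (subst \<sigma> (isubstst L t))) (h \<cdot> (F g \<cdot> sden \<sigma> \<Delta>))"
  proof (rule rel_bind[OF K(1) _ t, where H = "\<lambda>f. h \<cdot> f"])
    show "rel b m B (K u) (h \<cdot> vden A u)" if "cval A u" for m u using rel_value[of B "K u"] v[OF that] by simp
  qed (simp add: h)
  ultimately show ?thesis by (simp only: K(2))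
qed

text \<open>Lists, environments and indices are quantified inside the induction, so that binders can
  extend the environment and steps can lower the index.\<close>

lemma fundamental:
  "interp C code \<Psi> \<Delta> t A F \<Longrightarrow> rep_ctx code \<Psi> \<longrightarrow> (\<forall>L g n \<sigma>. related code b n \<Psi> L g \<longrightarrow>
    closed_subst \<sigma> \<longrightarrow> closes \<sigma> \<Delta> \<longrightarrow> rel b n A (subst \<sigma> (isubstst L t)) (F g \<cdot> sden \<sigma> \<Delta>))"
  "iinterp C code \<Psi> w T G \<Longrightarrow> rep_ctx code \<Psi> \<longrightarrow> (\<forall>L g n. related code b n \<Psi> L g \<longrightarrow>
    irel code b T n (isubsts L w) (G g))"
proof (induction rule: interp_iinterp.inducts)
  case (in_Unit \<Psi>)
  show ?case using rel_value[of One Unit] by simp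
next
  case (in_Var A \<Psi> x)
  show ?case
  proof (intro impI allI)
    fix L g n \<sigma> assume "rep_ctx code \<Psi>" "related code b n \<Psi> L g" and c: "closes \<sigma> [(x, A)]"
    then have r: "rep_ctx code \<Psi>" "valid_env code \<Psi> g" by (simp_all add: related_def)
    show "rel b n A (subst \<sigma> (isubstst L (Var x))) (runit (mult C) (sem_ty C A) \<cdot> sden \<sigma> [(x, A)])"
      using vden_subst(1)[OF interp_iinterp.in_Var[OF in_Var(1), of C code \<Psi> x], of g \<sigma>] r c
        rel_value[of A "subst \<sigma> (Var x)" b n] by simp
  qed
next
  case (in_Inl \<Psi> \<Delta> t A F B)
  show ?case
    by (intro impI allI, rule fundamental_unary[OF in_Inl(1) _ _ _ _ eval_frames(1)]) (use in_Inl(2) in simp_all)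
next
  case (in_Inr \<Psi> \<Delta> t B F A)
  show ?case
    by (intro impI allI, rule fundamental_unary[OF in_Inr(1) _ _ _ _ eval_frames(2)]) (use in_Inr(2) in simp_all)
next
  case (in_Pair \<Psi> \<Delta>1 t1 A F1 \<Delta>2 t2 B F2)
  show ?case
  proof (intro impI allI)
    fix L g n \<sigma> assume r: "rep_ctx code \<Psi>" "related code b n \<Psi> L g" and c: "closed_subst \<sigma>" "closes \<sigma> (\<Delta>1 @ \<Delta>2)"
    then have g: "valid_env code \<Psi> g" by (simp add: related_def)
    note t = src_interp[OF in_Pair(1) r(1) g] tgt_interp[OF in_Pair(1) r(1) g]
      src_interp[OF in_Pair(3) r(1) g] tgt_interp[OF in_Pair(3) r(1) g]
    have c': "closes \<sigma> \<Delta>1" "closes \<sigma> \<Delta>2" using c(2) by simp_all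
    let ?f1 = "F1 g \<cdot> sden \<sigma> \<Delta>1" and ?f2 = "F2 g \<cdot> sden \<sigma> \<Delta>2"
    let ?u1 = "subst \<sigma> (isubstst L t1)" and ?u2 = "subst \<sigma> (isubstst L t2)"
    \<comment> \<open>Evaluation from left to right gives two nested bindings, the inner one in a
      frame whose left component is already a value.\<close>
    have "rel b n (Prod A B) (Pair ?u1 ?u2) ((?f1 \<otimes>\<^sub>m[C] ?f2) \<cdot> pinv C lI)"
    proof (rule rel_bind[OF eval_frames(6), where A = A and H = "\<lambda>f. (f \<otimes>\<^sub>m[C] ?f2) \<cdot> pinv C lI"])
      show "rel b n A ?u1 ?f1" using in_Pair(2) r c(1) c' by blast
      fix m v assume m: "m \<le> n" and v: "cval A v"
      show "rel b m (Prod A B) (Pair v ?u2) ((vden A v \<otimes>\<^sub>m[C] ?f2) \<cdot> pinv C lI)"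
      proof (rule rel_bind[OF eval_frames(7)[OF cval_is_val[OF v]], where A = B and H = "\<lambda>f. (vden A v \<otimes>\<^sub>m[C] f) \<cdot> pinv C lI"])
        show "rel b m B ?u2 ?f2" using in_Pair(4) r(1) related_mono[OF r(2) m] c(1) c' by blast
        show "rel b k (Prod A B) (Pair v w) ((vden A v \<otimes>\<^sub>m[C] vden B w) \<cdot> pinv C lI)" if "cval B w" for k w
          using rel_value[of "Prod A B" "Pair v w"] that v by simp
      qed (use v in simp)
    qed (use t c' in simp)
    moreover have "((F1 g \<otimes>\<^sub>m[C] F2 g) \<cdot> split C \<Delta>1 \<Delta>2) \<cdot> sden \<sigma> (\<Delta>1 @ \<Delta>2)
        = (F1 g \<otimes>\<^sub>m[C] F2 g) \<cdot> (split C \<Delta>1 \<Delta>2 \<cdot> sden \<sigma> (\<Delta>1 @ \<Delta>2))"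
      using t src_sden[OF c(2)] tgt_sden[OF c(2)] by simp
    moreover have "\<dots> = (?f1 \<otimes>\<^sub>m[C] ?f2) \<cdot> pinv C lI" unfolding split_sden[OF c(2)] using t c' by simp
    ultimately show "rel b n (Prod A B) (subst \<sigma> (isubstst L (Pair t1 t2)))
        (((F1 g \<otimes>\<^sub>m[C] F2 g) \<cdot> split C \<Delta>1 \<Delta>2) \<cdot> sden \<sigma> (\<Delta>1 @ \<Delta>2))" by simp
  qed
next
  case (in_Fold \<Psi> \<Delta> t A F)
  show ?case
    by (intro impI allI, rule fundamental_unary[OF in_Fold(1) _ _ _ _ eval_frames(3)]) (use in_Fold(2) in simp_all)
next
  case (in_App \<Psi> w A B G \<Delta> t F)
  show ?case
  proof (intro impI allI)
    fix L g n \<sigma> assume r: "rep_ctx code \<Psi>" "related code b n \<Psi> L g" and c: "closed_subst \<sigma>" "closes \<sigma> \<Delta>"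
    then have g: "valid_env code \<Psi> g" by (simp add: related_def)
    note t = src_interp[OF in_App(3) r(1) g] tgt_interp[OF in_App(3) r(1) g]
    have Gt: "src C (mor (G g)) = sem_ty C A" "tgt C (mor (G g)) = sem_ty C B"
      using iinterp_closed[OF in_App(1) r(1) g] by (auto simp: hom_iff)
    have "irel code b (A \<leftrightarrow> B) n (isubsts L w) (G g)" using in_App(2) r by blast
    moreover have "rel b n A (subst \<sigma> (isubstst L t)) (F g \<cdot> sden \<sigma> \<Delta>)" using in_App(4) r c by blast
    moreover have "F g \<cdot> sden \<sigma> \<Delta> \<in> hom C I (sem_ty C A)" using t c by (simp add: hom_iff)
    ultimately have "rel b n B (App (isubsts L w) (subst \<sigma> (isubstst L t))) (mor (G g) \<cdot> (F g \<cdot> sden \<sigma> \<Delta>))"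
      by simp
    then show "rel b n B (subst \<sigma> (isubstst L (App w t))) ((mor (G g) \<cdot> F g) \<cdot> sden \<sigma> \<Delta>)"
      using t Gt c by simp
  qed
next
  case (in_Let \<Psi> \<Delta>1 t1 A F1 \<Gamma> p P \<Delta>2 t2 B F2)
  show ?case
  proof (intro impI allI)
    fix L g n \<sigma> assume r: "rep_ctx code \<Psi>" "related code b n \<Psi> L g" and c: "closed_subst \<sigma>" "closes \<sigma> (\<Delta>1 @ \<Delta>2)"
    then have g: "valid_env code \<Psi> g" by (simp add: related_def)
    show "rel b n B (subst \<sigma> (isubstst L (Let p t1 t2)))
      ((F2 g \<cdot> pinv C (split C \<Delta>2 \<Gamma>) \<cdot> (idm C (sem_ctx C \<Delta>2) \<otimes>\<^sub>m[C] (pinv C (P g) \<cdot> F1 g))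
        \<cdot> symm (mult C) (sem_ctx C \<Delta>1) (sem_ctx C \<Delta>2) \<cdot> split C \<Delta>1 \<Delta>2) \<cdot> sden \<sigma> (\<Delta>1 @ \<Delta>2))"
      unfolding isubstst_simps subst.simps
    proof (rule fundamental_let[OF r(1) g in_Let(1,3,5) c])
      show "rel b n A (subst \<sigma> (isubstst L t1)) (F1 g \<cdot> sden \<sigma> \<Delta>1)" using in_Let(2) r c by simp
      show "rel b m B (subst \<tau> (isubstst L t2)) (F2 g \<cdot> sden \<tau> (\<Delta>2 @ \<Gamma>))"
        if "m \<le> n" "closed_subst \<tau>" "closes \<tau> (\<Delta>2 @ \<Gamma>)" for m \<tau>
        using in_Let(6) r(1) related_mono[OF r(2) that(1)] that(2,3) by blast
    qed
  qed
next
  case (in_Exch \<Psi> \<Delta>1 x A y B \<Delta>2 t D F)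
  show ?case
  proof (intro impI allI)
    fix L g n \<sigma> assume r: "rep_ctx code \<Psi>" "related code b n \<Psi> L g"
      and c: "closed_subst \<sigma>" "closes \<sigma> (\<Delta>1 @ (y, B) # (x, A) # \<Delta>2)"
    then have g: "valid_env code \<Psi> g" by (simp add: related_def)
    have "(F g \<cdot> exch C \<Delta>1 B A \<Delta>2) \<cdot> sden \<sigma> (\<Delta>1 @ (y, B) # (x, A) # \<Delta>2)
        = F g \<cdot> (exch C \<Delta>1 B A \<Delta>2 \<cdot> sden \<sigma> (\<Delta>1 @ (y, B) # (x, A) # \<Delta>2))"
      using src_interp[OF in_Exch(1) r(1) g] tgt_sden[OF c(2)] src_exch[of \<Delta>1 B A \<Delta>2 y x] tgt_exch[of \<Delta>1 B A \<Delta>2 x y]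
      by simp
    then have eq: "(F g \<cdot> exch C \<Delta>1 B A \<Delta>2) \<cdot> sden \<sigma> (\<Delta>1 @ (y, B) # (x, A) # \<Delta>2)
        = F g \<cdot> sden \<sigma> (\<Delta>1 @ (x, A) # (y, B) # \<Delta>2)" by (simp only: exch_sden[OF c(2)])
    have "closes \<sigma> (\<Delta>1 @ (x, A) # (y, B) # \<Delta>2)" using c(2) by auto
    then show "rel b n D (subst \<sigma> (isubstst L t)) ((F g \<cdot> exch C \<Delta>1 B A \<Delta>2) \<cdot> sden \<sigma> (\<Delta>1 @ (y, B) # (x, A) # \<Delta>2))"
      unfolding eq using in_Exch(2) r c(1) by blast
  qed
next
  case (in_Clauses A B cs \<Psi> \<Delta> V E)
  show ?case
  proof (intro impI allI)
    fix L g n assume r: "rep_ctx code \<Psi>" "related code b n \<Psi> L g"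
    let ?J = "Join C (sem_ty C A) (sem_ty C B) ((\<lambda>i. E i g \<cdot> pinv C (V i g)) ` {..<length cs})"
    have g: "valid_env code \<Psi> g" using r(2) by (simp add: related_def)
    have ii: "iinterp C code \<Psi> (Clauses cs) (A \<leftrightarrow> B) (\<lambda>g. Mor (Join C (sem_ty C A) (sem_ty C B)
        ((\<lambda>i. E i g \<cdot> pinv C (V i g)) ` {..<length cs})))"
      by (rule interp_iinterp.in_Clauses[OF in_Clauses(1-4,7,9,5,6)])
    have J: "src C ?J = sem_ty C A" "tgt C ?J = sem_ty C B"
      using iinterp_closed[OF ii r(1) g] by (auto simp: hom_iff)
    \<comment> \<open>Binding reduces an arbitrary related argument to closed values, for which the
      clauses have been analysed.\<close>
    have "rel b m B (App (isubsts L (Clauses cs)) t) (?J \<cdot> f)"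
      if m: "m \<le> n" and f: "rel b m A t f" for m t f
      unfolding isubsts_simps
    proof (rule rel_bind[OF eval_frames(4) _ f, where H = "\<lambda>f. ?J \<cdot> f"])
      show "?J \<cdot> zero C I (sem_ty C A) = zero C I (sem_ty C B)" using J by simp
      fix k v assume k: "k \<le> m" and v: "cval A v"
      show "rel b k B (App (Clauses (map (map_prod (isubstst L) (isubstst L)) cs)) v) (?J \<cdot> vden A v)"
        unfolding isubsts_simps(1)[symmetric]
      proof (rule fundamental_clauses[OF r in_Clauses(3,7,9,5,6) _ v])
        show "rel b j B (subst \<sigma> (isubstst L (snd (cs ! i)))) (E i g \<cdot> sden \<sigma> (\<Delta> i))"
          if "i < length cs" "j \<le> n" "closed_subst \<sigma>" "closes \<sigma> (\<Delta> i)" for i j \<sigma>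
          using in_Clauses(10)[OF that(1)] r(1) related_mono[OF r(2) that(2)] that(3,4) by blast
      qed (use k m in auto)
    qed
    then show "irel code b (A \<leftrightarrow> B) n (isubsts L (Clauses cs)) (Mor ?J)"
      using related_closed[OF r(2) interp_fiv(2)[OF ii]] by (simp del: isubsts_simps)
  qed
next
  case (in_Fix \<Psi> \<phi> T w G)
  show ?case
  proof (intro impI allI)
    fix L g n assume r: "rep_ctx code \<Psi>" "related code b n \<Psi> L g"
    have g: "valid_env code \<Psi> g" using r(2) by (simp add: related_def)
    have T: "representable C code T" by (rule iinterp_representable[OF in_Fix(1)])
    note r' = rep_ctx_update[OF r(1) T, of \<phi>]
    interpret P: pcpo "sem_ity C code T" by (rule pcpo_sem_ity[OF T])
    have cont: "scott_cont (sem_ity C code T) (sem_ity C code T) (\<lambda>x. G (g(\<phi> := x)))"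
      using interp_cont(2)[OF in_Fix(1)] r'
      by (intro cont_inD[of code "\<Psi>(\<phi> \<mapsto> T)"] P.pcpo_axioms cont_env_update cont_env_const[OF r(1) g] scott_cont_id) simp
    let ?w = "Fix \<phi> (isubsts (unbind \<phi> L) w)"
    let ?d = "least_fixpoint (sem_ity C code T) (\<lambda>x. G (g(\<phi> := x)))"
    have closed: "fiv ?w = {}"
      using related_closed[OF r(2) interp_fiv(2)[OF interp_iinterp.in_Fix[OF in_Fix(1)]]] by simp
    \<comment> \<open>Both modes pass through this unfolding. With \<open>d\<close> an approximant
      it is the successor step of the adequacy induction, with \<open>d\<close> the fixed point
      itself it is the soundness step.\<close>
    have unfold_w: "irel code b T m ?w (G (g(\<phi> := d)))"
      if m: "m \<le> n" and d: "d \<in> fst (sem_ity C code T)" "\<And>k. later b m k \<Longrightarrow> irel code b T k ?w d" for m d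
    proof (rule irel_expand[OF ired_Fix _ closed])
      show "w'' = isubst \<phi> ?w (isubsts (unbind \<phi> L) w)" if "ired ?w w''" for w''
        using that by (auto elim: ired_FixE)
      fix k assume k: "later b m k"
      then have "k \<le> n" using m by (auto simp: later_def split: if_splits)
      have "related code b k (\<Psi>(\<phi> \<mapsto> T)) ((\<phi>, ?w) # unbind \<phi> L) (g(\<phi> := d))"
        by (rule related_update[OF related_mono[OF r(2) \<open>k \<le> n\<close>] d(2)[OF k] d(1)])
      then show "irel code b T k (isubst \<phi> ?w (isubsts (unbind \<phi> L) w)) (G (g(\<phi> := d)))"
        using in_Fix(2) r' unfolding isubsts_Cons[symmetric] by blast
    qed
    have "irel code b T n ?w ?d"
    proof (cases b)
      case True
      let ?c = "\<lambda>i. ((\<lambda>x. G (g(\<phi> := x))) ^^ i) P.bot"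
      have c: "irel code True T n ?w (?c i)" for i
      proof (induction i)
        case 0 then show ?case using irel_bot[OF T closed] by simp
      next
        case (Suc i)
        have "irel code b T n ?w (G (g(\<phi> := ?c i)))"
          by (rule unfold_w[OF order_refl P.iterates_in[OF cont]])
            (use Suc True in \<open>simp only: later_def if_True\<close>)
        then show ?case using True by (simp only: funpow.simps o_apply)
      qed
      have "irel code True T n ?w ?d"
        by (rule irel_lub[OF T _ P.iterates_directed[OF cont] P.least_fixpoint_lub[OF cont]])
          (use c P.iterates_in[OF cont] in auto)
      then show ?thesis using True by simp
    next
      case False
      \<comment> \<open>Soundness keeps the denotation and descends in the index; the fixed-point
        equation absorbs the unfolding. At index 0 there is no later index, which grounds the
        induction.\<close>
      have "irel code b T m ?w ?d" if "m \<le> n" for m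
        using that
      proof (induction m rule: less_induct)
        case (less m)
        have "irel code b T m ?w (G (g(\<phi> := ?d)))"
        proof (rule unfold_w[OF less.prems P.least_fixpoint_in[OF cont]])
          fix k assume "later b m k"
          then have "k < m" using False by (simp add: later_def)
          then show "irel code b T k ?w ?d" using less.prems by (intro less.IH) simp_all
        qed
        then show ?case by (simp only: P.least_fixpoint_eq[OF cont])
      qed
      then show ?thesis by simp
    qed
    then show "irel code b T n (isubsts L (Fix \<phi> w)) ?d" by simp
  qed
next
  case (in_Lam T1 T2 \<Psi> \<phi> w G)
  show ?case
  proof (intro impI allI)
    fix L g n assume r: "rep_ctx code \<Psi>" "related code b n \<Psi> L g"
    have g: "valid_env code \<Psi> g" using r(2) by (simp add: related_def)
    have T1: "representable C code T1" using in_Lam(1) by simp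
    note r' = rep_ctx_update[OF r(1) T1, of \<phi>]
    note coded = coded_maps_sem_ity[OF in_Lam(1)]
    let ?P = "sem_ity C code T1" and ?Q = "sem_ity C code T2"
    let ?d = "Fn (code (restrict (\<lambda>x. G (g(\<phi> := x))) (fst ?P)))"
    let ?w = "Lam \<phi> (isubsts (unbind \<phi> L) w)"
    have cont: "scott_cont ?P ?Q (\<lambda>x. G (g(\<phi> := x)))"
      using interp_cont(2)[OF in_Lam(2)] r'
      by (intro cont_inD[of code "\<Psi>(\<phi> \<mapsto> T1)"] pcpo_sem_ity[OF T1] cont_env_update cont_env_const[OF r(1) g] scott_cont_id) simp
    have dec: "decode code ?P ?Q ?d e = G (g(\<phi> := e))" if "e \<in> fst ?P" for e
      using coded_maps.decode_code[OF coded restrict_scott_maps[OF cont]] that by simp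
    have closed: "fiv ?w = {}"
      using related_closed[OF r(2) interp_fiv(2)[OF interp_iinterp.in_Lam[OF in_Lam(1,4,2)]]] by simp
    have "irel code b T2 m (IApp ?w u) (decode code ?P ?Q ?d e)"
      if m: "m \<le> n" and e: "e \<in> fst ?P" and u: "irel code b T1 m u e" for m u e
      unfolding dec[OF e]
    proof (rule irel_expand[OF ired_beta])
      show "w'' = isubst \<phi> u (isubsts (unbind \<phi> L) w)" if "ired (IApp ?w u) w''" for w''
        using that by (auto elim!: ired_IAppE elim: ired_LamE)
      show "fiv (IApp ?w u) = {}" using closed irel_closed[OF u] by simp
      fix k assume k: "later b m k"
      then have "k \<le> m" "k \<le> n" using m by (auto simp: later_def split: if_splits)
      have "related code b k (\<Psi>(\<phi> \<mapsto> T1)) ((\<phi>, u) # unbind \<phi> L) (g(\<phi> := e))"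
        by (rule related_update[OF related_mono[OF r(2) \<open>k \<le> n\<close>] irel_mono[OF u \<open>k \<le> m\<close>] e])
      then show "irel code b T2 k (isubst \<phi> u (isubsts (unbind \<phi> L) w)) (G (g(\<phi> := e)))"
        using in_Lam(3) r' unfolding isubsts_Cons[symmetric] by blast
    qed
    then show "irel code b (Fun T1 T2) n (isubsts L (Lam \<phi> w)) ?d" using closed by simp
  qed
next
  case (in_IVar T \<Psi> \<phi>)
  then show ?case by (simp add: related_def)
next
  case (in_IApp \<Psi> w1 T1 T2 G1 w2 G2)
  show ?case
  proof (intro impI allI)
    fix L g n assume r: "rep_ctx code \<Psi>" "related code b n \<Psi> L g"
    have g: "valid_env code \<Psi> g" using r(2) by (simp add: related_def)
    have "irel code b (Fun T1 T2) n (isubsts L w1) (G1 g)" "irel code b T1 n (isubsts L w2) (G2 g)"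
      using in_IApp(2,4) r by blast+
    then show "irel code b T2 n (isubsts L (IApp w1 w2))
        (decode code (sem_ity C code T1) (sem_ity C code T2) (G1 g) (G2 g))"
      using iinterp_closed[OF in_IApp(3) r(1) g] by simp
  qed
qed

text \<open>Totality would make the zero endomorphism of the unit an identity, and then the zero
  maps between the unit and the zero object would be mutually inverse. Here the distinctness of the
  two objects enters.\<close>

lemma zero_not_total:
  assumes "\<not> isomorphic C (zero_ob C) I" shows "\<not> total (zero C I A)"
proof
  assume "total (zero C I A)"
  then have 1: "zero C I I = idm C I" by (simp add: total_def)
  have 0: "zero C (zero_ob C) (zero_ob C) = idm C (zero_ob C)"
    using to_zero_ob[of "idm C (zero_ob C)"] by simp
  have "is_iso C (zero C (zero_ob C) I)"
    unfolding is_iso_iff by (rule exI[of _ "zero C I (zero_ob C)"]) (simp add: 0 1)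
  then show False using assms by (auto simp: isomorphic_def hom_iff)
qed

lemma terminating_iff_nonzero:
  assumes "\<not> isomorphic C (zero_ob C) I" "interp C code Map.empty [] t A F"
  shows "terminating t \<longleftrightarrow> F g \<noteq> zero C I (sem_ty C A)"
proof -
  have r: "rep_ctx code Map.empty" "valid_env code Map.empty g" "\<And>b n. related code b n Map.empty [] g"
    by (simp_all add: rep_ctx_def valid_env_def related_def)
  have t: "F g \<cdot> sden Map.empty [] = F g" using src_interp[OF assms(2) r(1,2)] by simp
  have rel: "rel b n A t (F g)" for b n
    using fundamental(1)[OF assms(2), of b] r(1) r(3)[of b n] t
    by (auto simp: closed_subst_def subst_empty isubstst_Nil dest!: spec[of _ "[]"] spec[of _ g] spec[of _ n] spec[of _ Map.empty])
  show ?thesis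
  proof
    assume "terminating t"
    then obtain v n where v: "is_val v" "(red ^^ n) t v" by (auto simp: terminating_def rtranclp_power)
    \<comment> \<open>Soundness is taken at the length of the given evaluation; for the converse,
      adequacy holds at every index and is taken at 0.\<close>
    then have "cval A v" "F g = vden A v" using rel[of False n] by (auto simp: rel_def)
    then show "F g \<noteq> zero C I (sem_ty C A)" using zero_not_total[OF assms(1)] total_vden by metis
  next
    assume "F g \<noteq> zero C I (sem_ty C A)"
    then show "terminating t" using rel[of True 0] cval_is_val by (auto simp: rel_def terminating_def)
  qed
qed

end

theorem mainTheorem2:
  fixes C :: "('o, 'm) rig_cat"
    and code :: "('m, 'd) coding"
    and F :: "('m, 'd) env \<Rightarrow> 'm"
    and g :: "('m, 'd) env"
  assumes "dcpo_join_inverse_rig_category C"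
    and "\<not> isomorphic C (zero_ob C) (one_ob C)"
    and "has_type Map.empty [] t A"
    and "interp C code Map.empty [] t A F"
  shows "terminating t \<longleftrightarrow> F g \<noteq> zero C (one_ob C) (sem_ty C A)"
  using dcpo_join_inverse_rig_category.terminating_iff_nonzero[OF assms(1,2,4)] .

end
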